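(* Let $A$ be a C*-algebra generated by a family of projections $\{q_i\}_{i\in I}$ and a family of partial isometries $\{t_j\}_{j\in J}$, and suppose that there exists a strongly continuous action $\gamma:\mathbb{T}\to\mathrm{Aut}(A)$ such that for every $z\in\mathbb{T}$, $i\in I$ and $j\in J$, we have $\gamma_z(q_i)=q_i$ and $\gamma_z(t_j)=zt_j$. Let $$N=\left\langle\{q_i\}_{i\in I}\cup\{t_j\}_{j\in J}\cup\{t_j^*\}_{j\in J}\right\rangle\cap A^{\gamma}$$ and suppose that for every finite subset $Y\subseteq N$, the C*-algebra generated by $Y$ is finite dimensional. Consider a set of symbols $\{p_i\}_{i\in I}$ with the same cardinality as $I$ and a set of symbols $\{s_j\}_{j\in J}$ with the same cardinality as $J$ and disjoint from $\{p_i\}_{i\in I}$. Let $\mathcal{G}=\{p_i\}_{i\in I}\cup\{s_j\}_{j\in J}$ and let $\Phi:\mathcal{B}_{\mathcal{G}}\to A$ be the *-homomorphism given by $\Phi(p_i)=q_i$ for all $i\in I$ and $\Phi(s_j)=t_j$ for all $j\in J$. Define $M=\{x\in\langle\mathcal{G}\cup\mathcal{G}^*\rangle\mid\Phi(x)\in N\}$ and define sets of norm relations $$\mathcal{R}_1=\{p_i=p_i^*=p_i^2\mid i\in I\}\cup\{s_js_j^*s_j=s_j\mid j\in J\}$$ and $$\mathcal{R}_2=\left\{\sum_{x\in M}^{\text{finite}}\lambda_x x=0\ \Big|\ \Phi\Big(\sum_{x\in M}^{\text{finite}}\lambda_x x\Big)=0\right\}$$ (finite linear combinations with $\lambda_x\in\mathbb{C}$).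 Then $\Phi$ factors to an isomorphism between $C^*(\mathcal{G},\mathcal{R}_1\cup\mathcal{R}_2)$ and $A$.
   Context: $\mathbb{T}$ is the unit circle group; $A^\gamma=\{a\in A:\gamma_z(a)=a\ \forall z\in\mathbb{T}\}$ is the fixed-point algebra; strongly continuous means $z\mapsto\gamma_z(a)$ is norm continuous for each $a\in A$. For a subset $B$ of an algebra, $\langle B\rangle$ denotes the set of all finite products (with at least one factor) of elements of $B$. For a non-empty set $\mathcal{G}$, $\mathcal{B}_{\mathcal{G}}=\mathbb{C}\langle\mathcal{G}\cup\mathcal{G}^*\rangle$ is the free (non-unital) complex *-algebra generated by $\mathcal{G}$ (where $\mathcal{G}^*=\{g^*:g\in\mathcal{G}\}$ is a disjoint copy of $\mathcal{G}$); in the claim, $\langle\mathcal{G}\cup\mathcal{G}^*\rangle\subseteq\mathcal{B}_{\mathcal{G}}$ is the set of words. A norm relation is a pair $(x,\eta)\in\mathcal{B}_{\mathcal{G}}\times[0,\infty)$; an equality $x=y$ with $x,y\in\mathcal{B}_{\mathcal{G}}$ is regarded as the norm relation $(x-y,0)$. Given a set $\mathcal{R}$ of norm relations, a representation of $(\mathcal{G},\mathcal{R})$ on a Hilbert space $H$ is a *-homomorphism $\rho:\mathcal{B}_{\mathcal{G}}\to B(H)$ with $\|\rho(x)\|\le\eta$ for all $(x,\eta)\in\mathcal{R}$. $(\mathcal{G},\mathcal{R})$ is admissible if for every family of representations of $(\mathcal{G},\mathcal{R})$ the direct sum $x\mapsto\bigoplus_\alpha\rho_\alpha(x)$ is a well-defined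 representation (into bounded operators) of $(\mathcal{G},\mathcal{R})$. In that case $C^*(\mathcal{G},\mathcal{R})$, the universal C*-algebra of generators $\mathcal{G}$ and relations $\mathcal{R}$, is the completion of $\mathcal{B}_{\mathcal{G}}/\mathcal{N}$ in the norm induced by the C*-seminorm $|||x|||=\sup\{\|\rho(x)\|:\rho\text{ a representation of }(\mathcal{G},\mathcal{R})\}$, where $\mathcal{N}=\{x:|||x|||=0\}$. "$\Phi$ factors to an isomorphism" means that there is a *-isomorphism $C^*(\mathcal{G},\mathcal{R}_1\cup\mathcal{R}_2)\to A$ whose composition with the canonical map $\mathcal{B}_{\mathcal{G}}\to C^*(\mathcal{G},\mathcal{R}_1\cup\mathcal{R}_2)$ is $\Phi$. *)

theory Defs
  imports "HOL-Analysis.Analysis"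
begin

section \<open>Complex *-algebras and C*-algebras\<close>

class scaleC =
  fixes scaleC :: "complex \<Rightarrow> 'a \<Rightarrow> 'a"  (infixr "*\<^sub>C" 75)

class star =
  fixes star :: "'a \<Rightarrow> 'a"

text \<open>Algebras are associative but need not have a unit, and may be zero.\<close>

class complex_star_algebra = ring + scaleC + star +
  assumes scaleC_add_right: "a *\<^sub>C (x + y) = a *\<^sub>C x + a *\<^sub>C y"
    and scaleC_add_left: "(a + b) *\<^sub>C x = a *\<^sub>C x + b *\<^sub>C x"
    and scaleC_scaleC: "a *\<^sub>C b *\<^sub>C x = (a * b) *\<^sub>C x"
    and scaleC_one: "1 *\<^sub>C x = x"
    and mult_scaleC_left: "(a *\<^sub>C x) * y = a *\<^sub>C (x * y)"
    and mult_scaleC_right: "x * (a *\<^sub>C y) = a *\<^sub>C (x * y)"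
    and star_add: "star (x + y) = star x + star y"
    and star_scaleC: "star (a *\<^sub>C x) = cnj a *\<^sub>C star x"
    and star_mult: "star (x * y) = star y * star x"
    and star_star: "star (star x) = x"

class cstar_algebra = complex_star_algebra + real_normed_algebra + banach +
  assumes scaleR_scaleC: "r *\<^sub>R x = complex_of_real r *\<^sub>C x"
    and norm_scaleC: "norm (a *\<^sub>C x) = cmod a * norm x"
    and norm_star_mult_self: "norm (star x * x) = (norm x)\<^sup>2"

global_interpretation complex_vector:
  vector_space "scaleC :: complex \<Rightarrow> 'a \<Rightarrow> 'a::complex_star_algebra"
  by unfold_locales
    (simp_all add: scaleC_add_right scaleC_add_left scaleC_scaleC scaleC_one)

definition star_hom :: "('a::complex_star_algebra \<Rightarrow> 'b::complex_star_algebra) \<Rightarrow> bool" where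
  "star_hom f \<longleftrightarrow>
    (\<forall>x y. f (x + y) = f x + f y) \<and> (\<forall>a x. f (a *\<^sub>C x) = a *\<^sub>C f x) \<and>
    (\<forall>x y. f (x * y) = f x * f y) \<and> (\<forall>x. f (star x) = star (f x))"

definition projection :: "'a::complex_star_algebra \<Rightarrow> bool" where
  "projection q \<longleftrightarrow> star q = q \<and> q * q = q"

definition partial_isometry :: "'a::complex_star_algebra \<Rightarrow> bool" where
  "partial_isometry t \<longleftrightarrow> t * star t * t = t"

definition cstar_subalgebra :: "'a::cstar_algebra set \<Rightarrow> bool" where
  "cstar_subalgebra B \<longleftrightarrow> complex_vector.subspace B \<and> closed B \<and>
    (\<forall>x\<in>B. \<forall>y\<in>B. x * y \<in> B) \<and> (\<forall>x\<in>B. star x \<in> B)"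

definition cstar_generated :: "'a::cstar_algebra set \<Rightarrow> 'a set" where
  "cstar_generated Y = cstar_subalgebra hull Y"

definition finite_dimensional :: "'a::complex_star_algebra set \<Rightarrow> bool" where
  "finite_dimensional V \<longleftrightarrow> (\<exists>B. finite B \<and> V \<subseteq> complex_vector.span B)"

inductive_set products :: "'a::times set \<Rightarrow> 'a set" for B where
  base: "b \<in> B \<Longrightarrow> b \<in> products B"
| step: "x \<in> products B \<Longrightarrow> b \<in> B \<Longrightarrow> x * b \<in> products B"

text \<open>The circle group is \<open>sphere 0 1 :: complex set\<close>; the values of \<open>\<gamma>\<close> outside it are
  irrelevant. That \<open>\<gamma> 1\<close> is the identity follows, since \<open>\<gamma> 1\<close> is bijective.\<close>

definition circle_action :: "(complex \<Rightarrow> 'a::cstar_algebra \<Rightarrow> 'a) \<Rightarrow> bool" where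
  "circle_action \<gamma> \<longleftrightarrow>
    (\<forall>z\<in>sphere 0 1. star_hom (\<gamma> z) \<and> bij (\<gamma> z)) \<and>
    (\<forall>z\<in>sphere 0 1. \<forall>w\<in>sphere 0 1. \<gamma> (z * w) = \<gamma> z \<circ> \<gamma> w)"

definition strongly_continuous :: "(complex \<Rightarrow> 'a::cstar_algebra \<Rightarrow> 'a) \<Rightarrow> bool" where
  "strongly_continuous \<gamma> \<longleftrightarrow> (\<forall>a. continuous_on (sphere 0 1) (\<lambda>z. \<gamma> z a))"

definition fixed_algebra :: "(complex \<Rightarrow> 'a::cstar_algebra \<Rightarrow> 'a) \<Rightarrow> 'a set" where
  "fixed_algebra \<gamma> = {a. \<forall>z\<in>sphere 0 1. \<gamma> z a = a}"


section \<open>The free non-unital *-algebra\<close>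

text \<open>The set of generators is the type \<open>'g\<close>. An element is a finitely supported complex
  function on words in the letters \<open>g\<close> and \<open>g*\<close>; having no unit amounts to giving the
  empty word the coefficient 0.\<close>

datatype 'g letter = Plain 'g | Starred 'g

primrec flip :: "'g letter \<Rightarrow> 'g letter" where
  "flip (Plain g) = Starred g"
| "flip (Starred g) = Plain g"

lemma flip_flip [simp]: "flip (flip l) = l"
  by (cases l) auto

definition word_star :: "'g letter list \<Rightarrow> 'g letter list" where
  "word_star w = rev (map flip w)"

lemma word_star_word_star [simp]: "word_star (word_star w) = w"
  by (simp add: word_star_def rev_map comp_def)

lemma word_star_Nil [simp]: "word_star [] = []"
  by (simp add: word_star_def)

lemma length_word_star [simp]: "length (word_star w) = length w"
  by (simp add: word_star_def)

typedef 'g free_algebra =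
  "{f :: 'g letter list \<Rightarrow> complex. finite {w. f w \<noteq> 0} \<and> f [] = 0}"
  morphisms coeff Abs_free_algebra
  by (rule exI[of _ "\<lambda>_. 0"]) simp

setup_lifting type_definition_free_algebra

lemma coeff_eqI: "(\<And>w. coeff x w = coeff y w) \<Longrightarrow> x = y"
  by (simp add: coeff_inject[symmetric] fun_eq_iff)

lift_definition gen :: "'g \<Rightarrow> 'g free_algebra" is
  "\<lambda>g w. if w = [Plain g] then 1 else 0"
  by simp

definition conv :: "('l list \<Rightarrow> complex) \<Rightarrow> ('l list \<Rightarrow> complex) \<Rightarrow> 'l list \<Rightarrow> complex" where
  "conv f g w = (\<Sum>i\<le>length w. f (take i w) * g (drop i w))"

lemma finite_conv:
  assumes "finite {w. f w \<noteq> 0}" "finite {w. g w \<noteq> 0}"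
  shows "finite {w. conv f g w \<noteq> 0}"
proof (rule finite_subset)
  show "{w. conv f g w \<noteq> 0} \<subseteq> (\<lambda>(u, v). u @ v) ` ({w. f w \<noteq> 0} \<times> {w. g w \<noteq> 0})"
  proof
    fix w assume "w \<in> {w. conv f g w \<noteq> 0}"
    then obtain i where "f (take i w) * g (drop i w) \<noteq> 0"
      unfolding conv_def by (auto elim: sum.not_neutral_contains_not_neutral)
    then show "w \<in> (\<lambda>(u, v). u @ v) ` ({w. f w \<noteq> 0} \<times> {w. g w \<noteq> 0})"
      by (intro image_eqI[of _ _ "(take i w, drop i w)"]) auto
  qed
qed (use assms in auto)

lemma conv_assoc: "conv (conv f g) h w = conv f (conv g h) w"
proof -
  have "conv (conv f g) h w =
      (\<Sum>i\<le>length w. \<Sum>j\<le>i. f (take j w) * g (drop j (take i w)) * h (drop i w))"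
    unfolding conv_def sum_distrib_right by (intro sum.cong refl) (auto simp: min_absorb1)
  also have "\<dots> = (\<Sum>(i, j) \<in> (SIGMA i:{..length w}. {..i}).
      f (take j w) * g (drop j (take i w)) * h (drop i w))"
    by (simp add: sum.Sigma)
  also have "\<dots> = (\<Sum>(j, k) \<in> (SIGMA j:{..length w}. {..length w - j}).
      f (take j w) * (g (take k (drop j w)) * h (drop k (drop j w))))"
    by (rule sum.reindex_bij_witness[of _ "\<lambda>(j, k). (j + k, j)" "\<lambda>(i, j). (j, i - j)"])
      (auto simp: take_drop mult.assoc add.commute)
  also have "\<dots> = conv f (conv g h) w"
    by (simp add: conv_def sum_distrib_left sum.Sigma)
  finally show ?thesis .
qed

lemma cnj_conv_word_star:
  "cnj (conv f g (word_star w)) =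
    conv (\<lambda>w. cnj (g (word_star w))) (\<lambda>w. cnj (f (word_star w))) w"
  unfolding conv_def cnj_sum length_word_star
  by (rule sum.reindex_bij_witness[of _ "\<lambda>i. length w - i" "\<lambda>i. length w - i"])
    (auto simp: word_star_def take_map drop_map take_rev drop_rev rev_map mult.commute)

instantiation free_algebra :: (type) complex_star_algebra
begin

lift_definition zero_free_algebra :: "'a free_algebra" is "\<lambda>_. 0"
  by simp

lift_definition plus_free_algebra :: "'a free_algebra \<Rightarrow> 'a free_algebra \<Rightarrow> 'a free_algebra"
  is "\<lambda>f g w. f w + g w"
proof -
  fix f g :: "'a letter list \<Rightarrow> complex"
  assume f: "finite {w. f w \<noteq> 0} \<and> f [] = 0" and g: "finite {w. g w \<noteq> 0} \<and> g [] = 0"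
  have "{w. f w + g w \<noteq> 0} \<subseteq> {w. f w \<noteq> 0} \<union> {w. g w \<noteq> 0}" by auto
  then have "finite {w. f w + g w \<noteq> 0}" by (rule finite_subset) (use f g in simp)
  with f g show "finite {w. f w + g w \<noteq> 0} \<and> f [] + g [] = 0" by simp
qed

lift_definition uminus_free_algebra :: "'a free_algebra \<Rightarrow> 'a free_algebra"
  is "\<lambda>f w. - f w"
  by simp

lift_definition minus_free_algebra :: "'a free_algebra \<Rightarrow> 'a free_algebra \<Rightarrow> 'a free_algebra"
  is "\<lambda>f g w. f w - g w"
proof -
  fix f g :: "'a letter list \<Rightarrow> complex"
  assume f: "finite {w. f w \<noteq> 0} \<and> f [] = 0" and g: "finite {w. g w \<noteq> 0} \<and> g [] = 0"
  have "{w. f w - g w \<noteq> 0} \<subseteq> {w. f w \<noteq> 0} \<union> {w. g w \<noteq> 0}" by auto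
  then have "finite {w. f w - g w \<noteq> 0}" by (rule finite_subset) (use f g in simp)
  with f g show "finite {w. f w - g w \<noteq> 0} \<and> f [] - g [] = 0" by simp
qed

lift_definition times_free_algebra :: "'a free_algebra \<Rightarrow> 'a free_algebra \<Rightarrow> 'a free_algebra"
  is conv
  by (simp add: finite_conv) (simp add: conv_def)

lift_definition scaleC_free_algebra :: "complex \<Rightarrow> 'a free_algebra \<Rightarrow> 'a free_algebra"
  is "\<lambda>a f w. a * f w"
  by simp

lift_definition star_free_algebra :: "'a free_algebra \<Rightarrow> 'a free_algebra"
  is "\<lambda>f w. cnj (f (word_star w))"
proof -
  fix f :: "'a letter list \<Rightarrow> complex"
  assume f: "finite {w. f w \<noteq> 0} \<and> f [] = 0"
  have "{w. cnj (f (word_star w)) \<noteq> 0} \<subseteq> word_star ` {w. f w \<noteq> 0}"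
  proof
    fix w assume "w \<in> {w. cnj (f (word_star w)) \<noteq> 0}"
    then show "w \<in> word_star ` {w. f w \<noteq> 0}"
      by (intro image_eqI[of _ _ "word_star w"]) simp_all
  qed
  then have "finite {w. cnj (f (word_star w)) \<noteq> 0}"
    by (rule finite_subset) (use f in simp)
  with f show "finite {w. cnj (f (word_star w)) \<noteq> 0} \<and> cnj (f (word_star [])) = 0"
    by simp
qed

instance
proof
  fix a b :: complex and x y z :: "'a free_algebra"
  show "x + y + z = x + (y + z)" by transfer (simp add: add.assoc)
  show "x + y = y + x" by transfer (simp add: add.commute)
  show "0 + x = x" by transfer simp
  show "- x + x = 0" by transfer simp
  show "x - y = x + - y" by transfer simp
  show "x * y * z = x * (y * z)" by transfer (rule ext, rule conv_assoc)
  show "(x + y) * z = x * z + y * z"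
    by transfer (simp add: conv_def fun_eq_iff algebra_simps sum.distrib)
  show "x * (y + z) = x * y + x * z"
    by transfer (simp add: conv_def fun_eq_iff algebra_simps sum.distrib)
  show "a *\<^sub>C (x + y) = a *\<^sub>C x + a *\<^sub>C y" by transfer (simp add: algebra_simps)
  show "(a + b) *\<^sub>C x = a *\<^sub>C x + b *\<^sub>C x" by transfer (simp add: algebra_simps)
  show "a *\<^sub>C b *\<^sub>C x = (a * b) *\<^sub>C x" by transfer (simp add: mult.assoc)
  show "1 *\<^sub>C x = x" by transfer simp
  show "(a *\<^sub>C x) * y = a *\<^sub>C (x * y)"
    by transfer (simp add: conv_def fun_eq_iff sum_distrib_left mult.assoc)
  show "x * (a *\<^sub>C y) = a *\<^sub>C (x * y)"
    by transfer (simp add: conv_def fun_eq_iff sum_distrib_left mult.left_commute)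
  show "star (x + y) = star x + star y" by transfer simp
  show "star (a *\<^sub>C x) = cnj a *\<^sub>C star x" by transfer simp
  show "star (x * y) = star y * star x" by transfer (rule ext, rule cnj_conv_word_star)
  show "star (star x) = x" by transfer simp
qed

end

definition free_words :: "'g free_algebra set" where
  "free_words = products (range gen \<union> star ` range gen)"


section \<open>Hilbert spaces and bounded operators\<close>

text \<open>Hilbert spaces are given by carrier sets, so that one can quantify over them inside a
  formula. The inner product is linear in its first argument. Operators are functions that
  matter only on the carrier.\<close>

record 'h hilbert =
  hcarrier :: "'h set"
  hzero :: 'h
  hadd :: "'h \<Rightarrow> 'h \<Rightarrow> 'h"
  hscale :: "complex \<Rightarrow> 'h \<Rightarrow> 'h"
  hinner :: "'h \<Rightarrow> 'h \<Rightarrow> complex"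

definition hdiff :: "'h hilbert \<Rightarrow> 'h \<Rightarrow> 'h \<Rightarrow> 'h" where
  "hdiff H \<xi> \<eta> = hadd H \<xi> (hscale H (-1) \<eta>)"

definition hnorm :: "'h hilbert \<Rightarrow> 'h \<Rightarrow> real" where
  "hnorm H \<xi> = sqrt (Re (hinner H \<xi> \<xi>))"

locale hilbert_space =
  fixes H :: "'h hilbert"
  assumes hzero_closed: "hzero H \<in> hcarrier H"
    and hadd_closed: "\<lbrakk>\<xi> \<in> hcarrier H; \<eta> \<in> hcarrier H\<rbrakk> \<Longrightarrow> hadd H \<xi> \<eta> \<in> hcarrier H"
    and hscale_closed: "\<xi> \<in> hcarrier H \<Longrightarrow> hscale H a \<xi> \<in> hcarrier H"
    and hadd_assoc: "\<lbrakk>\<xi> \<in> hcarrier H; \<eta> \<in> hcarrier H; \<zeta> \<in> hcarrier H\<rbrakk> \<Longrightarrow>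
      hadd H (hadd H \<xi> \<eta>) \<zeta> = hadd H \<xi> (hadd H \<eta> \<zeta>)"
    and hadd_commute: "\<lbrakk>\<xi> \<in> hcarrier H; \<eta> \<in> hcarrier H\<rbrakk> \<Longrightarrow> hadd H \<xi> \<eta> = hadd H \<eta> \<xi>"
    and hadd_zero: "\<xi> \<in> hcarrier H \<Longrightarrow> hadd H (hzero H) \<xi> = \<xi>"
    and hdiff_self: "\<xi> \<in> hcarrier H \<Longrightarrow> hdiff H \<xi> \<xi> = hzero H"
    and hscale_add_right: "\<lbrakk>\<xi> \<in> hcarrier H; \<eta> \<in> hcarrier H\<rbrakk> \<Longrightarrow>
      hscale H a (hadd H \<xi> \<eta>) = hadd H (hscale H a \<xi>) (hscale H a \<eta>)"
    and hscale_add_left: "\<xi> \<in> hcarrier H \<Longrightarrow>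
      hscale H (a + b) \<xi> = hadd H (hscale H a \<xi>) (hscale H b \<xi>)"
    and hscale_hscale: "\<xi> \<in> hcarrier H \<Longrightarrow> hscale H a (hscale H b \<xi>) = hscale H (a * b) \<xi>"
    and hscale_one: "\<xi> \<in> hcarrier H \<Longrightarrow> hscale H 1 \<xi> = \<xi>"
    and hinner_add_left: "\<lbrakk>\<xi> \<in> hcarrier H; \<eta> \<in> hcarrier H; \<zeta> \<in> hcarrier H\<rbrakk> \<Longrightarrow>
      hinner H (hadd H \<xi> \<eta>) \<zeta> = hinner H \<xi> \<zeta> + hinner H \<eta> \<zeta>"
    and hinner_scale_left: "\<lbrakk>\<xi> \<in> hcarrier H; \<eta> \<in> hcarrier H\<rbrakk> \<Longrightarrow>
      hinner H (hscale H a \<xi>) \<eta> = a * hinner H \<xi> \<eta>"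
    and hinner_commute: "\<lbrakk>\<xi> \<in> hcarrier H; \<eta> \<in> hcarrier H\<rbrakk> \<Longrightarrow>
      hinner H \<xi> \<eta> = cnj (hinner H \<eta> \<xi>)"
    and hinner_nonneg: "\<xi> \<in> hcarrier H \<Longrightarrow> 0 \<le> Re (hinner H \<xi> \<xi>)"
    and hinner_definite: "\<lbrakk>\<xi> \<in> hcarrier H; hinner H \<xi> \<xi> = 0\<rbrakk> \<Longrightarrow> \<xi> = hzero H"
    and hcomplete: "\<lbrakk>\<And>n::nat. X n \<in> hcarrier H;
        \<And>e. 0 < e \<Longrightarrow> \<exists>N. \<forall>m\<ge>N. \<forall>n\<ge>N. hnorm H (hdiff H (X m) (X n)) < e\<rbrakk> \<Longrightarrow>
      \<exists>\<xi>\<in>hcarrier H. (\<lambda>n. hnorm H (hdiff H (X n) \<xi>)) \<longlonglongrightarrow> 0"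

definition bounded_operators :: "'h hilbert \<Rightarrow> ('h \<Rightarrow> 'h) set" where
  "bounded_operators H = {T. T \<in> hcarrier H \<rightarrow> hcarrier H \<and>
    (\<forall>\<xi>\<in>hcarrier H. \<forall>\<eta>\<in>hcarrier H. T (hadd H \<xi> \<eta>) = hadd H (T \<xi>) (T \<eta>)) \<and>
    (\<forall>a. \<forall>\<xi>\<in>hcarrier H. T (hscale H a \<xi>) = hscale H a (T \<xi>)) \<and>
    (\<exists>c. \<forall>\<xi>\<in>hcarrier H. hnorm H (T \<xi>) \<le> c * hnorm H \<xi>)}"

definition operator_norm :: "'h hilbert \<Rightarrow> ('h \<Rightarrow> 'h) \<Rightarrow> real" where
  "operator_norm H T = Sup {hnorm H (T \<xi>) | \<xi>. \<xi> \<in> hcarrier H \<and> hnorm H \<xi> \<le> 1}"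

definition hilbert_sum :: "'k set \<Rightarrow> ('k \<Rightarrow> 'h hilbert) \<Rightarrow> ('k \<Rightarrow> 'h) hilbert" where
  "hilbert_sum K H = \<lparr>
    hcarrier = {\<xi> \<in> \<Pi>\<^sub>E \<alpha>\<in>K. hcarrier (H \<alpha>). (\<lambda>\<alpha>. (hnorm (H \<alpha>) (\<xi> \<alpha>))\<^sup>2) summable_on K},
    hzero = (\<lambda>\<alpha>\<in>K. hzero (H \<alpha>)),
    hadd = (\<lambda>\<xi> \<eta>. \<lambda>\<alpha>\<in>K. hadd (H \<alpha>) (\<xi> \<alpha>) (\<eta> \<alpha>)),
    hscale = (\<lambda>a \<xi>. \<lambda>\<alpha>\<in>K. hscale (H \<alpha>) a (\<xi> \<alpha>)),
    hinner = (\<lambda>\<xi> \<eta>. \<Sum>\<^sub>\<infinity>\<alpha>\<in>K. hinner (H \<alpha>) (\<xi> \<alpha>) (\<eta> \<alpha>))\<rparr>"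


section \<open>Norm relations and their representations\<close>

text \<open>A pair \<open>(x, \<eta>)\<close> stands for the requirement that the norm of \<open>x\<close> is at most \<open>\<eta>\<close>,
  with \<open>\<eta> \<ge> 0\<close>.\<close>

type_synonym 'g norm_relation = "'g free_algebra \<times> real"

definition equality_relation :: "'g free_algebra \<Rightarrow> 'g free_algebra \<Rightarrow> 'g norm_relation" where
  "equality_relation x y = (x - y, 0)"

definition star_hom_into_operators ::
  "'h hilbert \<Rightarrow> ('b::complex_star_algebra \<Rightarrow> 'h \<Rightarrow> 'h) \<Rightarrow> bool" where
  "star_hom_into_operators H \<rho> \<longleftrightarrow>
    (\<forall>x. \<rho> x \<in> bounded_operators H) \<and>
    (\<forall>x y. \<forall>\<xi>\<in>hcarrier H. \<rho> (x + y) \<xi> = hadd H (\<rho> x \<xi>) (\<rho> y \<xi>)) \<and>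
    (\<forall>a x. \<forall>\<xi>\<in>hcarrier H. \<rho> (a *\<^sub>C x) \<xi> = hscale H a (\<rho> x \<xi>)) \<and>
    (\<forall>x y. \<forall>\<xi>\<in>hcarrier H. \<rho> (x * y) \<xi> = \<rho> x (\<rho> y \<xi>)) \<and>
    (\<forall>x. \<forall>\<xi>\<in>hcarrier H. \<forall>\<eta>\<in>hcarrier H.
      hinner H (\<rho> x \<xi>) \<eta> = hinner H \<xi> (\<rho> (star x) \<eta>))"

definition representation ::
  "'g norm_relation set \<Rightarrow> 'h hilbert \<Rightarrow> ('g free_algebra \<Rightarrow> 'h \<Rightarrow> 'h) \<Rightarrow> bool" where
  "representation R H \<rho> \<longleftrightarrow> hilbert_space H \<and> star_hom_into_operators H \<rho> \<and>
    (\<forall>(x, \<eta>)\<in>R. operator_norm H (\<rho> x) \<le> \<eta>)"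

definition direct_sum ::
  "'k set \<Rightarrow> ('k \<Rightarrow> 'b \<Rightarrow> 'h \<Rightarrow> 'h) \<Rightarrow> 'b \<Rightarrow> ('k \<Rightarrow> 'h) \<Rightarrow> ('k \<Rightarrow> 'h)" where
  "direct_sum K \<rho> x \<xi> = (\<lambda>\<alpha>\<in>K. \<rho> \<alpha> x (\<xi> \<alpha>))"

text \<open>HOL cannot quantify over all Hilbert spaces in one formula, so the type \<open>'h\<close> containing
  their carriers and the type \<open>'k\<close> of indices of families are parameters. If a direct sum
  is not square-summable or not bounded, then \<^const>\<open>bounded_operators\<close> excludes it.\<close>

definition admissible :: "'k itself \<Rightarrow> 'h itself \<Rightarrow> 'g norm_relation set \<Rightarrow> bool" where
  "admissible _ _ R \<longleftrightarrow>
    (\<forall>(K :: 'k set) (H :: 'k \<Rightarrow> 'h hilbert) \<rho>.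
      (\<forall>\<alpha>\<in>K. representation R (H \<alpha>) (\<rho> \<alpha>)) \<longrightarrow>
      representation R (hilbert_sum K H) (direct_sum K \<rho>))"


section \<open>The universal C*-algebra\<close>

record 'c cstar_structure =
  ccarrier :: "'c set"
  cadd :: "'c \<Rightarrow> 'c \<Rightarrow> 'c"
  cscale :: "complex \<Rightarrow> 'c \<Rightarrow> 'c"
  cmult :: "'c \<Rightarrow> 'c \<Rightarrow> 'c"
  cstar :: "'c \<Rightarrow> 'c"
  cnorm :: "'c \<Rightarrow> real"

definition seminorm_Cauchy :: "('b::complex_star_algebra \<Rightarrow> real) \<Rightarrow> (nat \<Rightarrow> 'b) \<Rightarrow> bool" where
  "seminorm_Cauchy p X \<longleftrightarrow> (\<forall>e>0. \<exists>N. \<forall>m\<ge>N. \<forall>n\<ge>N. p (X m - X n) < e)"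

definition null_class ::
  "('b::complex_star_algebra \<Rightarrow> real) \<Rightarrow> (nat \<Rightarrow> 'b) \<Rightarrow> (nat \<Rightarrow> 'b) set" where
  "null_class p X = {Y. seminorm_Cauchy p Y \<and> (\<lambda>n. p (Y n - X n)) \<longlonglongrightarrow> 0}"

definition class_rep :: "(nat \<Rightarrow> 'b) set \<Rightarrow> nat \<Rightarrow> 'b" where
  "class_rep C = (SOME X. X \<in> C)"

text \<open>The completion, for the norm induced by a C*-seminorm \<open>p\<close>, of the quotient by the null
  space of \<open>p\<close>: Cauchy sequences modulo sequences tending to 0. This divides out the null
  space as well. The operations do not depend on the chosen representatives.\<close>

definition completion ::
  "('b::complex_star_algebra \<Rightarrow> real) \<Rightarrow> (nat \<Rightarrow> 'b) set cstar_structure" where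
  "completion p = \<lparr>
    ccarrier = null_class p ` {X. seminorm_Cauchy p X},
    cadd = (\<lambda>C D. null_class p (\<lambda>n. class_rep C n + class_rep D n)),
    cscale = (\<lambda>a C. null_class p (\<lambda>n. a *\<^sub>C class_rep C n)),
    cmult = (\<lambda>C D. null_class p (\<lambda>n. class_rep C n * class_rep D n)),
    cstar = (\<lambda>C. null_class p (\<lambda>n. star (class_rep C n))),
    cnorm = (\<lambda>C. lim (\<lambda>n. p (class_rep C n)))\<rparr>"

definition completion_map ::
  "('b::complex_star_algebra \<Rightarrow> real) \<Rightarrow> 'b \<Rightarrow> (nat \<Rightarrow> 'b) set" where
  "completion_map p x = null_class p (\<lambda>_. x)"

definition universal_seminorm ::
  "'h itself \<Rightarrow> 'g norm_relation set \<Rightarrow> 'g free_algebra \<Rightarrow> real" where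
  "universal_seminorm _ R x =
    Sup {operator_norm H (\<rho> x) | (H :: 'h hilbert) \<rho>. representation R H \<rho>}"

definition universal_cstar ::
  "'h itself \<Rightarrow> 'g norm_relation set \<Rightarrow> (nat \<Rightarrow> 'g free_algebra) set cstar_structure" where
  "universal_cstar T R = completion (universal_seminorm T R)"

definition universal_map ::
  "'h itself \<Rightarrow> 'g norm_relation set \<Rightarrow> 'g free_algebra \<Rightarrow> (nat \<Rightarrow> 'g free_algebra) set" where
  "universal_map T R = completion_map (universal_seminorm T R)"

text \<open>The supremum over all representations equals that over the cyclic ones. A cyclic Hilbert
  space consists of limits of sequences in the image of the free algebra, so it has a copy with
  carrier in \<open>nat \<Rightarrow> 'g free_algebra\<close>. The summand \<open>'u\<close> is arbitrary: whatever
  Hilbert spaces one wishes to include, they fit into a suitable universe.\<close>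

type_synonym ('g, 'u) hilbert_universe = "(nat \<Rightarrow> 'g free_algebra) + 'u"

definition star_isomorphism ::
  "'c cstar_structure \<Rightarrow> ('c \<Rightarrow> 'a::cstar_algebra) \<Rightarrow> bool" where
  "star_isomorphism C f \<longleftrightarrow> bij_betw f (ccarrier C) UNIV \<and>
    (\<forall>x\<in>ccarrier C. \<forall>y\<in>ccarrier C. f (cadd C x y) = f x + f y) \<and>
    (\<forall>a. \<forall>x\<in>ccarrier C. f (cscale C a x) = a *\<^sub>C f x) \<and>
    (\<forall>x\<in>ccarrier C. \<forall>y\<in>ccarrier C. f (cmult C x y) = f x * f y) \<and>
    (\<forall>x\<in>ccarrier C. f (cstar C x) = star (f x))"

definition factors_to_isomorphism ::
  "'h itself \<Rightarrow> 'g norm_relation set \<Rightarrow> ('g free_algebra \<Rightarrow> 'a::cstar_algebra) \<Rightarrow> bool" where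
  "factors_to_isomorphism T R \<Phi> \<longleftrightarrow>
    (\<exists>\<Psi>. star_isomorphism (universal_cstar T R) \<Psi> \<and> (\<forall>x. \<Psi> (universal_map T R x) = \<Phi> x))"

end

theory Submission
  imports Defs
begin

text \<open>Every C*-seminorm on the free algebra that vanishes on the relations is dominated by
  \<open>norm (\<Phi> x)\<close>. On the span of the words of degree 0 this holds up to a constant, since
  the relations force factorization through a finite-dimensional C*-algebra, and the C*-identity,
  applied to \<open>x\<close>, \<open>x\<^sup>*x\<close>, \<open>(x\<^sup>*x)\<^sup>2\<close>, \<open>(x\<^sup>*x)\<^sup>4\<close>, ..., removes the constant. If \<open>x\<close> is homogeneous of
  degree \<open>n\<close>, then \<open>x\<^sup>*x\<close> has degree 0. In general the homogeneous components of \<open>x\<close> are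
  bounded by \<open>norm (\<Phi> x)\<close>, by averaging \<open>\<gamma>\<close>, and the number of components grows only
  linearly in the exponents above, hence disappears in the same way. So neither the conditional
  expectation onto the fixed-point algebra nor its faithfulness is needed. In the other direction,
  representations that norm \<open>\<Phi> x\<close> come from states of \<open>A\<close> by the GNS construction. Hence the
  universal seminorm is \<open>norm (\<Phi> x)\<close>, and \<open>\<Phi>\<close> has dense range.\<close>

section \<open>Norming functionals\<close>

text \<open>Besides the seminorm laws, the comparison asks of \<open>p\<close> only that
  \<open>(p x)\<^sup>2 \<le> p (star x * x)\<close> and that \<open>p\<close> vanish on elements of
  degree 0 killed by \<Phi>. It therefore applies to each representation separately, and its bound
  \<open>norm (\<Phi> x)\<close> is the same for all of them; this uniformity is what makes direct
  sums bounded and gives admissibility. The weight lies in the other direction. A state has to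
  satisfy \<open>f (star (x * y) * (x * y)) \<le> (norm x)\<^sup>2 * f (star y * y)\<close>, which
  rests on the positivity of every \<open>star c * c\<close>. That is derived without spectra, from
  the power series of the square root and from positivity written as a norm inequality. As A may
  lack a unit, the argument runs in its multiplier algebra. The same states show that
  *-homomorphisms are contractive, which the averaging of \<gamma> requires. Finally, the Hilbert
  spaces must live in a type fixed beforehand, so the GNS space is formed over the free algebra,
  through \<Phi>, with chosen Cauchy sequences as its points.\<close>

definition sublinear :: "('v::real_vector \<Rightarrow> real) \<Rightarrow> bool" where
  "sublinear p \<longleftrightarrow> (\<forall>x y. p (x + y) \<le> p x + p y) \<and> (\<forall>c x. 0 \<le> c \<longrightarrow> p (c *\<^sub>R x) \<le> c * p x)"

lemma sublinear_add: "sublinear p \<Longrightarrow> p (x + y) \<le> p x + p y"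
  and sublinear_scale_le: "sublinear p \<Longrightarrow> 0 \<le> c \<Longrightarrow> p (c *\<^sub>R x) \<le> c * p x"
  by (auto simp: sublinear_def)

lemma sublinear_zero: "sublinear p \<Longrightarrow> p 0 = 0"
  using sublinear_add[of p 0 0] sublinear_scale_le[of p 0 0] by simp

lemma sublinear_scale:
  assumes "sublinear p" "0 \<le> c"
  shows "p (c *\<^sub>R x) = c * p x"
proof (cases "c = 0")
  case False
  with assms have "p ((1 / c) *\<^sub>R c *\<^sub>R x) \<le> (1 / c) * p (c *\<^sub>R x)"
    by (intro sublinear_scale_le) auto
  with False assms have "c * p x \<le> p (c *\<^sub>R x)" by (simp add: field_simps)
  with sublinear_scale_le[OF assms] show ?thesis by (metis antisym)
qed (use assms sublinear_zero in auto)

lemma sublinear_neg: "sublinear p \<Longrightarrow> - p (- x) \<le> p x"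
  using sublinear_add[of p x "- x"] sublinear_zero[of p] by simp

text \<open>Serves two kinds of infima: over a real parameter in the Hahn-Banach modification, and
  over a chain in the Zorn argument. The hypotheses \<open>add\<close> and \<open>scale\<close> let
  the index change, since neither family satisfies the inequalities with a fixed index on both
  sides.\<close>

lemma sublinear_INF:
  fixes f :: "'i \<Rightarrow> 'v::real_vector \<Rightarrow> real"
  assumes bdd: "\<And>x. bdd_below ((\<lambda>i. f i x) ` A)"
    and add: "\<And>i j x y. i \<in> A \<Longrightarrow> j \<in> A \<Longrightarrow> \<exists>k\<in>A. f k (x + y) \<le> f i x + f j y"
    and scale: "\<And>i c x. i \<in> A \<Longrightarrow> 0 < c \<Longrightarrow> \<exists>k\<in>A. f k (c *\<^sub>R x) \<le> c * f i x"
    and zero: "\<exists>i\<in>A. f i 0 \<le> 0"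
  shows "sublinear (\<lambda>x. INF i\<in>A. f i x)"
  unfolding sublinear_def
proof (intro conjI allI impI)
  let ?q = "\<lambda>x. INF i\<in>A. f i x"
  have le: "?q x \<le> f i x" if "i \<in> A" for i x using that bdd by (intro cINF_lower)
  have ge: "c \<le> ?q x" if "\<And>i. i \<in> A \<Longrightarrow> c \<le> f i x" for c x
    using that zero by (intro cINF_greatest) auto
  fix x y
  have *: "?q (x + y) - f j y \<le> f i x" if ij: "i \<in> A" "j \<in> A" for i j
  proof -
    obtain k where "k \<in> A" "f k (x + y) \<le> f i x + f j y" using add[OF ij] by blast
    with le[of k "x + y"] show ?thesis by simp
  qed
  have "?q (x + y) - ?q x \<le> f j y" if "j \<in> A" for j
    using ge[of "?q (x + y) - f j y" x] *[OF _ that] by simp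
  then have "?q (x + y) - ?q x \<le> ?q y" by (rule ge)
  then show "?q (x + y) \<le> ?q x + ?q y" by simp
  fix c :: real assume "0 \<le> c"
  show "?q (c *\<^sub>R x) \<le> c * ?q x"
  proof (cases "c = 0")
    case True
    obtain i where "i \<in> A" "f i 0 \<le> 0" using zero by blast
    with le[of i 0] True show ?thesis by simp
  next
    case False
    with \<open>0 \<le> c\<close> have "0 < c" by simp
    have "?q (c *\<^sub>R x) / c \<le> f i x" if i: "i \<in> A" for i
    proof -
      obtain k where "k \<in> A" "f k (c *\<^sub>R x) \<le> c * f i x" using scale[OF i \<open>0 < c\<close>] by blast
      with le[of k "c *\<^sub>R x"] \<open>0 < c\<close> show ?thesis by (simp add: pos_divide_le_eq mult.commute)
    qed
    then have "?q (c *\<^sub>R x) / c \<le> ?q x" by (rule ge)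
    then show ?thesis using \<open>0 < c\<close> by (simp add: pos_divide_le_eq mult.commute)
  qed
qed

text \<open>The classical Hahn-Banach modification of \<open>p\<close> in the direction
  \<open>y\<close>. The term \<open>t = 0\<close> keeps it below \<open>p\<close>; the term
  \<open>t = 1\<close> at \<open>- y\<close> makes it at most \<open>- p y\<close>, so a linear
  minorant of it takes the value \<open>p y\<close> at \<open>y\<close>.\<close>

definition sublinear_shift :: "('v::real_vector \<Rightarrow> real) \<Rightarrow> 'v \<Rightarrow> 'v \<Rightarrow> real" where
  "sublinear_shift p y x = (INF t\<in>{0..}. p (x + t *\<^sub>R y) - t * p y)"

lemma bdd_below_sublinear_shift:
  assumes p: "sublinear p"
  shows "bdd_below ((\<lambda>t. p (x + t *\<^sub>R y) - t * p y) ` {0..})"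
proof (rule bdd_belowI2)
  fix t :: real assume "t \<in> {0..}"
  then show "- p (- x) \<le> p (x + t *\<^sub>R y) - t * p y"
    using sublinear_add[OF p, of "x + t *\<^sub>R y" "- x"] sublinear_scale[OF p, of t y] by simp
qed

lemma sublinear_shift_le:
  "sublinear p \<Longrightarrow> 0 \<le> t \<Longrightarrow> sublinear_shift p y x \<le> p (x + t *\<^sub>R y) - t * p y"
  unfolding sublinear_shift_def by (rule cINF_lower[OF bdd_below_sublinear_shift]) auto

lemma sublinear_sublinear_shift:
  assumes p: "sublinear p"
  shows "sublinear (sublinear_shift p y)"
  unfolding sublinear_shift_def[abs_def]
proof (rule sublinear_INF[OF bdd_below_sublinear_shift[OF p]])
  fix t t' :: real and x x' assume "t \<in> {0..}" "t' \<in> {0..}"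
  then show "\<exists>u\<in>{0..}. p (x + x' + u *\<^sub>R y) - u * p y \<le>
      p (x + t *\<^sub>R y) - t * p y + (p (x' + t' *\<^sub>R y) - t' * p y)"
    using sublinear_add[OF p, of "x + t *\<^sub>R y" "x' + t' *\<^sub>R y"]
    by (intro bexI[of _ "t + t'"]) (auto simp: algebra_simps)
next
  fix t c :: real and x assume t: "t \<in> {0..}" and c: "0 < c"
  have "p (c *\<^sub>R x + (c * t) *\<^sub>R y) = c * p (x + t *\<^sub>R y)"
    using sublinear_scale[OF p, of c "x + t *\<^sub>R y"] c by (simp add: scaleR_add_right)
  then show "\<exists>u\<in>{0..}. p (c *\<^sub>R x + u *\<^sub>R y) - u * p y \<le> c * (p (x + t *\<^sub>R y) - t * p y)"
    using t c by (intro bexI[of _ "c * t"]) (auto simp: right_diff_distrib)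
next
  show "\<exists>t\<in>{0..}. p (0 + t *\<^sub>R y) - t * p y \<le> 0"
    using sublinear_zero[OF p] by (intro bexI[of _ 0]) auto
qed

text \<open>Zorn's lemma: a chain is bounded below by its pointwise infimum, which is finite because
  every sublinear functional below \<open>p\<close> is at least \<open>- p (- x)\<close> at
  \<open>x\<close>.\<close>

lemma minimal_sublinear:
  assumes p: "sublinear p"
  obtains q where "sublinear q" "q \<le> p" "\<And>r. sublinear r \<Longrightarrow> r \<le> q \<Longrightarrow> r = q"
proof -
  let ?A = "{q. sublinear q \<and> q \<le> p}"
  \<comment> \<open>The order is reversed, so the maximal element delivered by Zorn's lemma is a
    minimal functional.\<close>
  let ?P = "\<lambda>q r :: 'a \<Rightarrow> real. r \<le> q"
  have po: "partial_order_on ?A (relation_of ?P ?A)"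
    by (rule partial_order_on_relation_ofI) auto
  have ub: "\<exists>u\<in>?A. \<forall>a\<in>C. ?P a u" if C: "C \<in> Chains (relation_of ?P ?A)" for C
  proof (cases "C = {}")
    case True
    then show ?thesis using p by auto
  next
    case False
    have CA: "sublinear a" "a \<le> p" if "a \<in> C" for a
      using C that by (auto simp: Chains_def relation_of_def)
    have tot: "a \<le> b \<or> b \<le> a" if "a \<in> C" "b \<in> C" for a b
      using C that by (auto simp: Chains_def relation_of_def)
    define u where "u x = (INF a\<in>C. a x)" for x
    have bdd: "bdd_below ((\<lambda>a. a x) ` C)" for x
    proof (rule bdd_belowI2)
      fix a assume "a \<in> C"
      then have "- p (- x) \<le> - a (- x)" using CA(2)[of a] by (simp add: le_fun_def)
      also have "\<dots> \<le> a x" using CA(1)[OF \<open>a \<in> C\<close>] by (rule sublinear_neg)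
      finally show "- p (- x) \<le> a x" .
    qed
    then have le: "u x \<le> a x" if "a \<in> C" for a x
      unfolding u_def using that by (intro cINF_lower)
    have "sublinear u"
      unfolding u_def[abs_def]
    proof (rule sublinear_INF[OF bdd])
      fix a b x y assume ab: "a \<in> C" "b \<in> C"
      obtain c where c: "c \<in> C" "c \<le> a" "c \<le> b" using tot[OF ab] ab by blast
      then have "c (x + y) \<le> a x + b y"
        using sublinear_add[OF CA(1)[OF c(1)], of x y] le_funD[OF c(2), of x] le_funD[OF c(3), of y]
        by linarith
      with c(1) show "\<exists>c\<in>C. c (x + y) \<le> a x + b y" by blast
    next
      show "\<exists>b\<in>C. b (c *\<^sub>R x) \<le> c * a x" if "a \<in> C" "0 < c" for a c x
        using sublinear_scale_le[OF CA(1)[OF that(1)], of c x] that by auto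
      obtain a where "a \<in> C" using False by blast
      then show "\<exists>a\<in>C. a 0 \<le> 0" using sublinear_zero[OF CA(1)[OF \<open>a \<in> C\<close>]] by (intro bexI[of _ a]) auto
    qed
    moreover obtain a where "a \<in> C" using False by blast
    then have "u \<le> p" using le[of a] CA(2)[of a] by (meson le_fun_def order_trans)
    ultimately show ?thesis using le by (intro bexI[of _ u]) (auto simp: le_fun_def)
  qed
  obtain q where q: "q \<in> ?A" "\<forall>a\<in>?A. a \<le> q \<longrightarrow> a = q"
    using predicate_Zorn[OF po ub] by blast
  show thesis
  proof (rule that)
    show "sublinear q" "q \<le> p" using q(1) by auto
    show "r = q" if "sublinear r" "r \<le> q" for r
      using q that by (metis (mono_tags, lifting) mem_Collect_eq order_trans)
  qed
qed

text \<open>A minimal sublinear functional equals each of its shifts, and the term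
  \<open>t = 1\<close> of the shift then reads \<open>q x + q y \<le> q (x + y)\<close>. So
  minimality already forces linearity, and no extension from subspaces occurs.\<close>

lemma linear_minorant:
  fixes p :: "'v::real_vector \<Rightarrow> real"
  assumes p: "sublinear p"
  obtains f where "linear f" "\<And>x. f x \<le> p x"
proof -
  obtain q where q: "sublinear q" "q \<le> p" and min: "\<And>r. sublinear r \<Longrightarrow> r \<le> q \<Longrightarrow> r = q"
    using minimal_sublinear[OF p] by blast
  have add: "q (x + y) = q x + q y" for x y
  proof -
    have "sublinear_shift q y \<le> q"
      using sublinear_shift_le[OF q(1), of 0 y] by (simp add: le_fun_def)
    then have "sublinear_shift q y = q"
      using min sublinear_sublinear_shift[OF q(1)] by blast
    then have "q x \<le> q (x + y) - q y"
      using sublinear_shift_le[OF q(1), of 1 y x] by simp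
    with sublinear_add[OF q(1), of x y] show ?thesis by simp
  qed
  have minus: "q (- x) = - q x" for x
    using add[of x "- x"] sublinear_zero[OF q(1)] by simp
  have scale: "q (c *\<^sub>R x) = c * q x" for c x
  proof (cases "0 \<le> c")
    case False
    then show ?thesis
      using sublinear_scale[OF q(1), of "- c" x] minus[of "c *\<^sub>R x"] by simp
  qed (rule sublinear_scale[OF q(1)])
  have "linear q" by (rule linearI) (simp_all add: add scale)
  with q(2) that show thesis by (auto simp: le_fun_def)
qed

text \<open>The minorant is taken of the norm shifted along \<open>v\<close>, whose value at
  \<open>- v\<close> is at most \<open>- norm v\<close>.\<close>

lemma norming_functional:
  fixes v :: "'v::real_normed_vector"
  obtains f where "linear f" "\<And>x. f x \<le> norm x" "f v = norm v"
proof -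
  have n: "sublinear (norm :: 'v \<Rightarrow> real)"
    by (simp add: sublinear_def norm_triangle_ineq)
  obtain f where f: "linear f" "\<And>x. f x \<le> sublinear_shift norm v x"
    using linear_minorant[OF sublinear_sublinear_shift[OF n]] by blast
  have le: "f x \<le> norm x" for x
    using f(2)[of x] sublinear_shift_le[OF n, of 0 v x] by simp
  have "f (- v) \<le> - norm v"
    using f(2)[of "- v"] sublinear_shift_le[OF n, of 1 v "- v"] by simp
  then have "f v = norm v"
    using le[of v] linear_neg[OF f(1), of v] by simp
  with f(1) le that show thesis by blast
qed

section \<open>Complex *-algebras and C*-algebras\<close>

lemma star_zero [simp]: "star 0 = (0::'a::complex_star_algebra)"
  using star_add[of "0::'a" 0] by simp

lemma star_minus [simp]: "star (- x) = - star (x::'a::complex_star_algebra)"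
  using star_add[of x "- x"] by (simp add: eq_neg_iff_add_eq_0 add.commute)

lemma star_diff: "star (x - y) = star x - star (y::'a::complex_star_algebra)"
  using star_add[of x "- y"] by simp

lemma star_scaleR [simp]: "star (r *\<^sub>R x) = r *\<^sub>R star (x::'a::cstar_algebra)"
  by (simp add: scaleR_scaleC star_scaleC)

lemma norm_star [simp]: "norm (star x) = norm (x::'a::cstar_algebra)"
proof -
  have le: "norm y \<le> norm (star y)" for y :: 'a
  proof (cases "norm y = 0")
    case False
    have "norm y * norm y \<le> norm (star y) * norm y"
      using norm_mult_ineq[of "star y" y] by (simp add: norm_star_mult_self power2_eq_square)
    with False show ?thesis by (simp add: mult_le_cancel_right)
  qed simp
  show ?thesis using le[of x] le[of "star x"] by (simp add: star_star)
qed

lemma norm_mult_star_self: "norm (x * star x) = (norm (x::'a::cstar_algebra))\<^sup>2"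
  using norm_star_mult_self[of "star x"] by (simp add: star_star)

lemma star_mult_self_eq_0_iff: "star x * x = 0 \<longleftrightarrow> x = (0::'a::cstar_algebra)"
  by (metis mult_zero_right norm_eq_zero norm_star_mult_self zero_eq_power2)

lemma bounded_linear_star: "bounded_linear (star :: 'a::cstar_algebra \<Rightarrow> 'a)"
  by (rule bounded_linear_intro[of _ 1]) (simp_all add: star_add)

section \<open>Positivity in unital C*-algebras\<close>

lemma star_one [simp]: "star 1 = (1::'a::{cstar_algebra,monoid_mult})"
  by (metis mult_1_left mult_1_right star_mult star_star)

text \<open>Only an inequality, because the zero algebra is allowed, where \<open>1 = 0\<close>. In
  every other case the C*-identity gives norm 1.\<close>

lemma norm_one_le: "norm (1::'a::{cstar_algebra,monoid_mult}) \<le> 1"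
proof -
  have "norm (1::'a) = norm (1::'a) * norm (1::'a)"
    using norm_star_mult_self[of "1::'a"] by (simp add: power2_eq_square)
  then show ?thesis by (cases "norm (1::'a) = 0") auto
qed

lemma norm_power_le_one:
  fixes x :: "'a::{cstar_algebra,monoid_mult}"
  assumes "norm x \<le> 1"
  shows "norm (x ^ n) \<le> 1"
proof (induction n)
  case (Suc n)
  have "norm (x ^ Suc n) \<le> norm x * norm (x ^ n)" by (simp add: norm_mult_ineq)
  also have "\<dots> \<le> 1" using Suc assms by (simp add: mult_le_one)
  finally show ?case .
qed (simp add: norm_one_le)

text \<open>The Taylor coefficients of \<open>r(x) = 1 - \<surd>(1 - x)\<close>, read off from \<open>2r = x + r\<^sup>2\<close>.\<close>

fun sqrt_coeff :: "nat \<Rightarrow> real" where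
  "sqrt_coeff n = (if n = 0 then 0
    else ((if n = 1 then 1 else 0) + (\<Sum>i\<in>{1..<n}. sqrt_coeff i * sqrt_coeff (n - i))) / 2)"

declare sqrt_coeff.simps [simp del]

lemma sqrt_coeff_0 [simp]: "sqrt_coeff 0 = 0"
  by (simp add: sqrt_coeff.simps)

text \<open>Since the coefficient at 0 vanishes, the sum may run over all \<open>i \<le> n\<close>,
  which is the form of a Cauchy product.\<close>

lemma sqrt_coeff_conv:
  "2 * sqrt_coeff n = (if n = 1 then 1 else 0) + (\<Sum>i\<le>n. sqrt_coeff i * sqrt_coeff (n - i))"
proof (cases "n = 0")
  case False
  have "(\<Sum>i\<le>n. sqrt_coeff i * sqrt_coeff (n - i)) =
      (\<Sum>i\<in>{1..<n}. sqrt_coeff i * sqrt_coeff (n - i))"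
  proof (rule sum.mono_neutral_right)
    show "\<forall>i\<in>{..n} - {1..<n}. sqrt_coeff i * sqrt_coeff (n - i) = 0"
    proof
      fix i assume "i \<in> {..n} - {1..<n}"
      then have "i = 0 \<or> i = n" by auto
      then show "sqrt_coeff i * sqrt_coeff (n - i) = 0" by auto
    qed
  qed auto
  with False show ?thesis by (subst sqrt_coeff.simps) simp
qed simp

lemma sqrt_coeff_nonneg: "0 \<le> sqrt_coeff n"
proof (induction n rule: less_induct)
  case (less n)
  then show ?case by (subst sqrt_coeff.simps) (auto intro!: sum_nonneg mult_nonneg_nonneg)
qed

text \<open>With \<open>S n\<close> for the partial sum,
  \<open>2 * S (n + 1) \<le> 1 + S n * S n \<le> 2\<close>: a nonzero product with
  \<open>i + j \<le> n + 1\<close> has \<open>i, j \<ge> 1\<close>, hence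
  \<open>i, j \<le> n\<close>.\<close>

lemma sum_sqrt_coeff_le: "(\<Sum>k\<le>n. sqrt_coeff k) \<le> 1"
proof (induction n)
  case (Suc n)
  let ?S = "\<Sum>k\<le>n. sqrt_coeff k"
  have "2 * (\<Sum>k\<le>Suc n. sqrt_coeff k) =
      (\<Sum>k\<le>Suc n. if k = 1 then 1 else 0) + (\<Sum>k\<le>Suc n. \<Sum>i\<le>k. sqrt_coeff i * sqrt_coeff (k - i))"
    unfolding sum_distrib_left sqrt_coeff_conv sum.distrib ..
  also have "(\<Sum>k\<le>Suc n. \<Sum>i\<le>k. sqrt_coeff i * sqrt_coeff (k - i)) =
      (\<Sum>(k, i)\<in>(SIGMA k:{..Suc n}. {..k}). sqrt_coeff i * sqrt_coeff (k - i))"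
    by (simp add: sum.Sigma del: sum.atMost_Suc)
  also have "\<dots> = (\<Sum>(i, j)\<in>{(i, j). i + j \<le> Suc n}. sqrt_coeff i * sqrt_coeff j)"
    by (rule sum.reindex_bij_witness[of _ "\<lambda>(i, j). (i + j, i)" "\<lambda>(k, i). (i, k - i)"]) auto
  also have "\<dots> \<le> (\<Sum>(i, j)\<in>{..n} \<times> {..n}. sqrt_coeff i * sqrt_coeff j)"
  proof -
    have "(\<Sum>(i, j)\<in>{(i, j). i + j \<le> Suc n}. sqrt_coeff i * sqrt_coeff j) =
        (\<Sum>(i, j)\<in>{(i, j). i + j \<le> Suc n} \<inter> {..n} \<times> {..n}. sqrt_coeff i * sqrt_coeff j)"
    proof (rule sum.mono_neutral_right)
      show "finite {(i, j). i + j \<le> Suc n}"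
        by (rule finite_subset[of _ "{..Suc n} \<times> {..Suc n}"]) auto
      show "\<forall>x\<in>{(i, j). i + j \<le> Suc n} - {(i, j). i + j \<le> Suc n} \<inter> {..n} \<times> {..n}.
          (case x of (i, j) \<Rightarrow> sqrt_coeff i * sqrt_coeff j) = 0"
      proof
        fix x assume x: "x \<in> {(i, j). i + j \<le> Suc n} - {(i, j). i + j \<le> Suc n} \<inter> {..n} \<times> {..n}"
        then have "fst x = 0 \<or> snd x = 0" by auto
        then show "(case x of (i, j) \<Rightarrow> sqrt_coeff i * sqrt_coeff j) = 0" by (auto simp: case_prod_beta)
      qed
    qed auto
    also have "\<dots> \<le> (\<Sum>(i, j)\<in>{..n} \<times> {..n}. sqrt_coeff i * sqrt_coeff j)"
      by (rule sum_mono2) (auto simp: sqrt_coeff_nonneg)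
    finally show ?thesis .
  qed
  also have "\<dots> = ?S * ?S"
    by (simp add: sum_product sum.cartesian_product)
  also have "?S * ?S \<le> 1"
    using Suc sum_nonneg[of "{..n}" sqrt_coeff] by (intro mult_le_one) (auto simp: sqrt_coeff_nonneg)
  also have "(\<Sum>k\<le>Suc n. if k = 1 then 1 else 0 :: real) \<le> 1" by (simp add: sum.delta)
  finally show ?case by simp
qed simp

lemma summable_sqrt_coeff: "summable sqrt_coeff"
proof (rule summableI_nonneg_bounded)
  fix n
  have "(\<Sum>k<n. sqrt_coeff k) \<le> (\<Sum>k\<le>n. sqrt_coeff k)"
    by (rule sum_mono2) (auto simp: sqrt_coeff_nonneg)
  then show "(\<Sum>k<n. sqrt_coeff k) \<le> 1" using sum_sqrt_coeff_le[of n] by simp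
qed (rule sqrt_coeff_nonneg)

lemma suminf_sqrt_coeff_le: "suminf sqrt_coeff \<le> 1"
  using LIMSEQ_le_const2[OF summable_LIMSEQ'[OF summable_sqrt_coeff]] sum_sqrt_coeff_le by blast

context
  fixes x :: "'a::{cstar_algebra,monoid_mult}"
  assumes x: "norm x \<le> 1"
begin

lemma norm_sqrt_term_le: "norm (sqrt_coeff n *\<^sub>R x ^ n) \<le> sqrt_coeff n"
  using norm_power_le_one[OF x, of n] sqrt_coeff_nonneg[of n] by (simp add: mult_left_le)

lemma summable_norm_sqrt_term: "summable (\<lambda>n. norm (sqrt_coeff n *\<^sub>R x ^ n))"
  by (rule summable_comparison_test'[OF summable_sqrt_coeff, of 0]) (use norm_sqrt_term_le in auto)

end

section \<open>Square roots of 1 - x on the closed unit ball\<close>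

text \<open>The coefficients are summable themselves, so the series converges also when
  \<open>norm x = 1\<close>, where a geometric majorant would fail.\<close>

definition sqrt_one_minus :: "'a \<Rightarrow> 'a::{cstar_algebra,monoid_mult}" where
  "sqrt_one_minus x = 1 - (\<Sum>n. sqrt_coeff n *\<^sub>R x ^ n)"

text \<open>This is the inequality that certifies the root as positive, with radius 1.\<close>

lemma norm_one_minus_sqrt_one_minus_le: "norm x \<le> 1 \<Longrightarrow> norm (1 - sqrt_one_minus x) \<le> 1"
proof -
  assume x: "norm x \<le> 1"
  have "norm (\<Sum>n. sqrt_coeff n *\<^sub>R x ^ n) \<le> (\<Sum>n. norm (sqrt_coeff n *\<^sub>R x ^ n))"
    by (rule summable_norm[OF summable_norm_sqrt_term[OF x]])
  also have "\<dots> \<le> suminf sqrt_coeff"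
    by (rule suminf_le[OF norm_sqrt_term_le[OF x] summable_norm_sqrt_term[OF x] summable_sqrt_coeff])
  also have "\<dots> \<le> 1" by (rule suminf_sqrt_coeff_le)
  finally show ?thesis by (simp add: sqrt_one_minus_def)
qed

lemma sqrt_one_minus_square:
  assumes x: "norm x \<le> 1"
  shows "sqrt_one_minus x * sqrt_one_minus x = 1 - x"
proof -
  let ?a = "\<lambda>n. sqrt_coeff n *\<^sub>R x ^ n"
  let ?r = "suminf ?a"
  note sn = summable_norm_sqrt_term[OF x]
  have "(\<Sum>i\<le>k. ?a i * ?a (k - i)) = (\<Sum>i\<le>k. sqrt_coeff i * sqrt_coeff (k - i)) *\<^sub>R x ^ k" for k
    unfolding scaleR_sum_left by (rule sum.cong) (simp_all add: power_add[symmetric])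
  then have "(\<lambda>k. (\<Sum>i\<le>k. sqrt_coeff i * sqrt_coeff (k - i)) *\<^sub>R x ^ k) sums (?r * ?r)"
    using Cauchy_product_sums[OF sn sn] by simp
  moreover have "(\<lambda>k. (if k = 1 then 1 else 0 :: real) *\<^sub>R x ^ k) sums x"
    using sums_single[of 1 "\<lambda>k. x ^ k"] by (simp add: if_distrib if_distribR cong: if_cong)
  ultimately have "(\<lambda>k. ((if k = 1 then 1 else 0) +
      (\<Sum>i\<le>k. sqrt_coeff i * sqrt_coeff (k - i))) *\<^sub>R x ^ k) sums (x + ?r * ?r)"
    by (subst scaleR_add_left) (rule sums_add)
  then have "(\<lambda>k. 2 *\<^sub>R ?a k) sums (x + ?r * ?r)"
    by (simp only: sqrt_coeff_conv[symmetric] scaleR_scaleR)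
  moreover have "(\<lambda>k. 2 *\<^sub>R ?a k) sums (2 *\<^sub>R ?r)"
    by (rule sums_scaleR_right[OF summable_sums[OF summable_norm_cancel[OF sn]]])
  ultimately have "2 *\<^sub>R ?r = x + ?r * ?r" by (rule sums_unique2[symmetric])
  then have "?r + ?r = x + ?r * ?r" by (simp add: scaleR_2)
  then show ?thesis by (simp add: sqrt_one_minus_def algebra_simps)
qed

text \<open>The relation passes to powers and then to the series. Commutation is the case
  \<open>x = x'\<close>; two different elements are needed for comparing \<open>star d * d\<close>
  with \<open>d * star d\<close>.\<close>

lemma sqrt_one_minus_intertwine:
  assumes x: "norm x \<le> 1" "norm x' \<le> 1" and y: "y * x = x' * y"
  shows "y * sqrt_one_minus x = sqrt_one_minus x' * y"
proof -
  have pow: "y * x ^ n = x' ^ n * y" for n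
  proof (induction n)
    case (Suc n)
    have "y * x ^ Suc n = (y * x) * x ^ n" by (simp add: mult.assoc)
    also have "\<dots> = x' * (y * x ^ n)" by (simp add: y mult.assoc)
    finally show ?case by (simp add: Suc mult.assoc)
  qed simp
  have "y * (\<Sum>n. sqrt_coeff n *\<^sub>R x ^ n) = (\<Sum>n. y * sqrt_coeff n *\<^sub>R x ^ n)"
    by (rule bounded_linear.suminf[OF bounded_linear_mult_right])
      (rule summable_norm_cancel[OF summable_norm_sqrt_term[OF x(1)]])
  also have "\<dots> = (\<Sum>n. (sqrt_coeff n *\<^sub>R x' ^ n) * y)"
    by (simp add: pow)
  also have "\<dots> = (\<Sum>n. sqrt_coeff n *\<^sub>R x' ^ n) * y"
    by (rule bounded_linear.suminf[OF bounded_linear_mult_left, symmetric])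
      (rule summable_norm_cancel[OF summable_norm_sqrt_term[OF x(2)]])
  finally show ?thesis by (simp add: sqrt_one_minus_def algebra_simps)
qed

lemma star_power: "star (x ^ n) = (star (x::'a::{cstar_algebra,monoid_mult})) ^ n"
  by (induction n) (simp_all add: star_mult power_commutes)

lemma star_sqrt_one_minus:
  assumes "norm x \<le> 1" "star x = x"
  shows "star (sqrt_one_minus x) = sqrt_one_minus x"
  using bounded_linear.suminf[OF bounded_linear_star
      summable_norm_cancel[OF summable_norm_sqrt_term[OF assms(1)]]]
  by (simp add: sqrt_one_minus_def star_diff star_power assms(2))

section \<open>The cone of positive elements\<close>

text \<open>For self-adjoint \<open>h\<close> the norm condition says that the spectrum lies in the
  interval from 0 to \<open>2 * t\<close>. In this form sums of positive elements are positive by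
  the triangle inequality.\<close>

definition positive :: "'a::{cstar_algebra,monoid_mult} \<Rightarrow> bool" where
  "positive h \<longleftrightarrow> star h = h \<and> (\<exists>t. norm (t *\<^sub>R 1 - h) \<le> t)"

lemma positiveI: "star h = h \<Longrightarrow> norm (t *\<^sub>R 1 - h) \<le> t \<Longrightarrow> positive h"
  by (auto simp: positive_def)

lemma positive_mono:
  assumes "norm (t *\<^sub>R 1 - h) \<le> t" "t \<le> t'"
  shows "norm (t' *\<^sub>R 1 - (h::'a::{cstar_algebra,monoid_mult})) \<le> t'"
proof -
  have "norm ((t' - t) *\<^sub>R (1::'a)) \<le> t' - t"
    using assms(2) mult_left_mono[OF norm_one_le, of "t' - t"] by simp
  moreover have "t' *\<^sub>R 1 - h = (t' - t) *\<^sub>R 1 + (t *\<^sub>R 1 - h)"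
    by (simp add: algebra_simps)
  moreover have "norm ((t' - t) *\<^sub>R 1 + (t *\<^sub>R 1 - h)) \<le> norm ((t' - t) *\<^sub>R (1::'a)) + norm (t *\<^sub>R 1 - h)"
    by (rule norm_triangle_ineq)
  ultimately show ?thesis using assms(1) by (simp only:)
qed

lemma positive_add:
  assumes "positive h" "positive k"
  shows "positive (h + k)"
proof -
  obtain t u where tu: "norm (t *\<^sub>R 1 - h) \<le> t" "norm (u *\<^sub>R 1 - k) \<le> u"
    using assms by (auto simp: positive_def)
  have "norm ((t + u) *\<^sub>R 1 - (h + k)) \<le> t + u"
    using norm_triangle_ineq[of "t *\<^sub>R 1 - h" "u *\<^sub>R 1 - k"] tu by (simp add: algebra_simps)
  with assms show ?thesis by (auto simp: positive_def star_add)
qed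

lemma positive_scaleR:
  assumes "positive h" "0 \<le> c"
  shows "positive (c *\<^sub>R h)"
proof -
  obtain t where "norm (t *\<^sub>R 1 - h) \<le> t" using assms by (auto simp: positive_def)
  then have "c * norm (t *\<^sub>R 1 - h) \<le> c * t" using assms(2) by (rule mult_left_mono)
  moreover have "c * norm (t *\<^sub>R 1 - h) = norm ((c * t) *\<^sub>R 1 - c *\<^sub>R h)"
    using assms(2) by (metis abs_of_nonneg norm_scaleR scaleR_diff_right scaleR_scaleR)
  ultimately show ?thesis using assms(1) by (auto simp: positive_def)
qed

lemma positive_norm_minus: "star h = h \<Longrightarrow> positive (norm h *\<^sub>R 1 - h)"
  by (rule positiveI[of _ "norm h"]) (simp_all add: star_diff)

text \<open>Write \<open>h = t *\<^sub>R (1 - x)\<close> with \<open>norm x \<le> 1\<close>; the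
  root of \<open>1 - x\<close> is given by the series. The commutation property stands in for
  functional calculus in what follows.\<close>

lemma positive_sqrt:
  assumes "positive h"
  obtains s where "positive s" "s * s = h" "\<And>y. y * h = h * y \<Longrightarrow> y * s = s * y"
proof -
  obtain t0 where "norm (t0 *\<^sub>R 1 - h) \<le> t0" using assms by (auto simp: positive_def)
  \<comment> \<open>The radius is enlarged to be strictly positive, so that one can divide by
    it.\<close>
  then have "norm ((\<bar>t0\<bar> + 1) *\<^sub>R 1 - h) \<le> \<bar>t0\<bar> + 1"
    by (rule positive_mono) simp
  moreover have "0 < \<bar>t0\<bar> + 1" by simp
  ultimately obtain t where t: "norm (t *\<^sub>R 1 - h) \<le> t" "0 < t" by blast
  have h: "star h = h" using assms by (simp add: positive_def)
  define x where "x = 1 - (1 / t) *\<^sub>R h"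
  have "x = (1 / t) *\<^sub>R (t *\<^sub>R 1 - h)" using t(2) by (simp add: x_def algebra_simps)
  then have x: "norm x \<le> 1" using t by simp
  have sx: "star x = x" by (simp add: x_def star_diff h)
  define s where "s = sqrt t *\<^sub>R sqrt_one_minus x"
  show thesis
  proof (rule that)
    have "positive (sqrt_one_minus x)"
      using norm_one_minus_sqrt_one_minus_le[OF x] star_sqrt_one_minus[OF x sx]
      by (intro positiveI[of _ 1]) auto
    then show "positive s" unfolding s_def using t(2) by (intro positive_scaleR) auto
    have "s * s = t *\<^sub>R (1 - x)"
      using t(2) by (simp add: s_def sqrt_one_minus_square[OF x])
    then show "s * s = h" using t(2) by (simp add: x_def)
    fix y assume "y * h = h * y"
    then have "y * x = x * y" by (simp add: x_def algebra_simps)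
    then show "y * s = s * y" by (simp add: s_def sqrt_one_minus_intertwine[OF x x])
  qed
qed

text \<open>The elements \<open>k + \<i> *\<^sub>C s\<close> and \<open>k - \<i> *\<^sub>C s\<close>
  are unitary, and \<open>k\<close> is their mean.\<close>

lemma norm_le_one_if_squares_sum_one:
  fixes k s :: "'a::{cstar_algebra,monoid_mult}"
  assumes "star k = k" "star s = s" "k * s = s * k" "k * k + s * s = 1"
  shows "norm k \<le> 1"
proof -
  have sq: "c * c = -1 \<Longrightarrow> cnj c = - c \<Longrightarrow> norm (k + c *\<^sub>C s) \<le> 1" for c :: complex
  proof -
    assume c: "c * c = -1" "cnj c = - c"
    have "star (k + c *\<^sub>C s) * (k + c *\<^sub>C s) = k * k - (c * c) *\<^sub>C (s * s)"
      using assms(3) by (simp add: star_add star_scaleC assms(1,2) c(2) distrib_left distrib_right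
          left_diff_distrib complex_vector.scale_right_diff_distrib mult_scaleC_left mult_scaleC_right scaleC_scaleC)
    also have "\<dots> = 1" using assms(4) by (simp add: c)
    finally have "(norm (k + c *\<^sub>C s))\<^sup>2 \<le> 1\<^sup>2"
      using norm_star_mult_self[of "k + c *\<^sub>C s"] norm_one_le[where 'a='a] by simp
    then show ?thesis by (rule power2_le_imp_le) simp
  qed
  have "2 *\<^sub>R k = (k + \<i> *\<^sub>C s) + (k + (- \<i>) *\<^sub>C s)" by (simp add: scaleR_2)
  then have "2 * norm k \<le> norm (k + \<i> *\<^sub>C s) + norm (k + (- \<i>) *\<^sub>C s)"
    by (metis abs_numeral norm_scaleR norm_triangle_ineq)
  with sq[of \<i>] sq[of "- \<i>"] show ?thesis by simp
qed

text \<open>After scaling \<open>k\<close> to \<open>l\<close> in the unit ball, let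
  \<open>s\<close> be the root of \<open>1 - l * l\<close>. Then \<open>s\<close> and
  \<open>l\<close> commute with squares summing to 1, so \<open>norm s \<le> 1\<close>, and
  \<open>norm (1 - l * l) = (norm s)\<^sup>2 \<le> 1\<close> exhibits \<open>l * l\<close> as
  positive.\<close>

lemma positive_square:
  assumes k: "star k = k"
  shows "positive (k * k)"
proof -
  define T where "T = norm k + 1"
  have T: "0 < T" "norm k \<le> T" by (auto simp: T_def add_nonneg_pos)
  define l where "l = (1 / T) *\<^sub>R k"
  have "norm l \<le> 1" using T by (simp add: l_def)
  then have x: "norm (l * l) \<le> 1"
    using norm_mult_ineq[of l l] mult_le_one[of "norm l" "norm l"] by simp
  have l: "star l = l" by (simp add: l_def k)
  let ?s = "sqrt_one_minus (l * l)"
  have s: "star ?s = ?s" by (rule star_sqrt_one_minus[OF x]) (simp add: star_mult l)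
  have "norm ?s \<le> 1"
    using s l sqrt_one_minus_intertwine[OF x x, of l] sqrt_one_minus_square[OF x]
    by (intro norm_le_one_if_squares_sum_one[of _ l]) (simp_all add: mult.assoc)
  then have "norm (1 - l * l) \<le> 1"
    using norm_star_mult_self[of ?s] by (simp add: s sqrt_one_minus_square[OF x] power_le_one)
  then have "positive (l * l)"
    by (intro positiveI[of _ 1]) (simp_all add: star_mult l)
  then have "positive ((T * T) *\<^sub>R (l * l))" by (rule positive_scaleR) simp
  then show ?thesis using T by (simp add: l_def)
qed

text \<open>With commuting roots \<open>k\<close> of \<open>h\<close> and \<open>l\<close> of
  \<open>- h\<close>, the element \<open>k + \<i> *\<^sub>C l\<close> has \<open>star\<close>
  product with itself equal to \<open>h - h = 0\<close>. So it vanishes together with its adjoint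
  \<open>k - \<i> *\<^sub>C l\<close>, hence \<open>k = 0\<close>.\<close>

lemma positive_antisym:
  assumes "positive h" "positive (- h)"
  shows "h = 0"
proof -
  obtain k where k: "positive k" "k * k = h" "\<And>y. y * h = h * y \<Longrightarrow> y * k = k * y"
    using positive_sqrt[OF assms(1)] by blast
  obtain l where l: "positive l" "l * l = - h" "\<And>y. y * - h = - h * y \<Longrightarrow> y * l = l * y"
    using positive_sqrt[OF assms(2)] by blast
  have sa: "star k = k" "star l = l" using k(1) l(1) by (auto simp: positive_def)
  have "k * h = h * k" using k(2) by (metis mult.assoc)
  then have kl: "k * l = l * k" using l(3) by simp
  have "star (k + \<i> *\<^sub>C l) * (k + \<i> *\<^sub>C l) = k * k + l * l"
    using kl by (simp add: star_add star_scaleC sa distrib_left distrib_right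
        left_diff_distrib complex_vector.scale_right_diff_distrib mult_scaleC_left mult_scaleC_right scaleC_scaleC)
  also have "\<dots> = 0" by (simp add: k(2) l(2))
  finally have 0: "k + \<i> *\<^sub>C l = 0" by (simp add: star_mult_self_eq_0_iff)
  then have "star (k + \<i> *\<^sub>C l) = 0" by simp
  then have "k - \<i> *\<^sub>C l = 0" by (simp add: star_add star_scaleC sa)
  with 0 have "(k + \<i> *\<^sub>C l) + (k - \<i> *\<^sub>C l) = 0" by simp
  then have "2 *\<^sub>R k = 0" by (simp add: scaleR_2)
  then show ?thesis using k(2) by simp
qed

text \<open>The root \<open>s\<close> of \<open>a\<close> commutes with \<open>m\<close>, so
  \<open>m * a * m\<close> is the square of the self-adjoint \<open>m * s\<close>.\<close>

lemma positive_commute_mult: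
  assumes "positive a" "star m = m" "m * a = a * m"
  shows "positive (m * a * m)"
proof -
  obtain s where s: "positive s" "s * s = a" "\<And>y. y * a = a * y \<Longrightarrow> y * s = s * y"
    using positive_sqrt[OF assms(1)] by blast
  have ms: "m * s = s * m" using s(3) assms(3) by simp
  have sa: "star s = s" using s(1) by (simp add: positive_def)
  have "positive ((m * s) * (m * s))"
    by (rule positive_square) (metis assms(2) ms sa star_mult)
  also have "(m * s) * (m * s) = m * a * m" by (metis ms mult.assoc s(2))
  finally show ?thesis .
qed

text \<open>Order bounds are norm bounds: for \<open>c = b / t\<close> the roots of \<open>c\<close>
  and of \<open>1 - c\<close> commute and have squares summing to 1, so the first has norm at most
  1.\<close>

lemma positive_norm_le:
  assumes b: "positive b" and tb: "positive (t *\<^sub>R 1 - b)" and t: "0 \<le> t"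
  shows "norm b \<le> t"
proof (cases "t = 0")
  case True
  then show ?thesis using positive_antisym[OF b] tb by simp
next
  case False
  with t have t: "0 < t" by simp
  have "positive ((1 / t) *\<^sub>R b)" "positive ((1 / t) *\<^sub>R (t *\<^sub>R 1 - b))"
    using t b tb by (auto intro!: positive_scaleR)
  then have pos: "positive ((1 / t) *\<^sub>R b)" "positive (1 - (1 / t) *\<^sub>R b)"
    using t by (simp_all add: scaleR_diff_right)
  define c where "c = (1 / t) *\<^sub>R b"
  note pos = pos[folded c_def]
  obtain l where l: "positive l" "l * l = c" "\<And>y. y * c = c * y \<Longrightarrow> y * l = l * y"
    using positive_sqrt[OF pos(1)] by blast
  obtain k where k: "positive k" "k * k = 1 - c" "\<And>y. y * (1 - c) = (1 - c) * y \<Longrightarrow> y * k = k * y"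
    using positive_sqrt[OF pos(2)] by blast
  have "l * c = c * l" by (simp add: l(2)[symmetric] mult.assoc)
  then have "l * k = k * l" by (intro k(3)) (simp add: algebra_simps)
  then have "norm l \<le> 1"
    using l(1,2) k(1,2) by (intro norm_le_one_if_squares_sum_one[of l k]) (auto simp: positive_def)
  then have "norm c \<le> 1"
    using norm_mult_ineq[of l l] mult_le_one[of "norm l" "norm l"] l(2) by simp
  then show ?thesis using t by (simp add: c_def)
qed

section \<open>Unique roots, and positivity of star c * c\<close>

text \<open>For \<open>d = a - b\<close>, the positive elements \<open>d * a * d\<close> and
  \<open>d * b * d\<close> add up to \<open>d * (a + b) * d = 0\<close>, so both vanish. Their
  difference is the cube of the self-adjoint \<open>d\<close>, which is therefore 0.\<close>

lemma positive_sqrt_unique: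
  assumes a: "positive a" and b: "positive b" and comm: "a * b = b * a" and sq: "a * a = b * b"
  shows "a = b"
proof -
  let ?d = "a - b"
  have d: "star ?d = ?d" using a b by (simp add: positive_def star_diff)
  have "?d * a = a * ?d" "?d * b = b * ?d"
    using comm by (simp_all add: left_diff_distrib right_diff_distrib)
  then have "positive (?d * a * ?d)" "positive (?d * b * ?d)"
    using a b d by (blast intro: positive_commute_mult)+
  moreover have "?d * a * ?d + ?d * b * ?d = 0"
  proof -
    have "?d * a * ?d + ?d * b * ?d = ?d * ((a + b) * ?d)" by (simp only: distrib_left distrib_right mult.assoc)
    also have "(a + b) * ?d = 0" using comm sq by (simp add: algebra_simps)
    finally show ?thesis by simp
  qed
  moreover from this have "?d * b * ?d = - (?d * a * ?d)" by (rule minus_unique[symmetric])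
  ultimately have da: "?d * a * ?d = 0" and db: "?d * b * ?d = 0"
    using positive_antisym[of "?d * a * ?d"] by simp_all
  have "?d * ?d * ?d = ?d * a * ?d - ?d * b * ?d" by (simp add: left_diff_distrib right_diff_distrib mult.assoc)
  then have "?d * ?d * ?d = 0" by (simp add: da db)
  then have "star (?d * ?d) * (?d * ?d) = 0" by (simp add: star_mult d mult.assoc[symmetric])
  then have "?d * ?d = 0" by (simp add: star_mult_self_eq_0_iff)
  then have "star ?d * ?d = 0" by (simp add: d)
  then show ?thesis by (simp add: star_mult_self_eq_0_iff)
qed

text \<open>Since \<open>y\<close> intertwines \<open>g\<close> and \<open>-e\<close>, it also intertwines \<open>\<bar>g\<bar> = g\<close> and \<open>\<bar>-e\<bar> = e\<close>.\<close>

lemma positive_intertwine_minus: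
  assumes g: "positive g" and e: "positive e" and y: "y * g = - (e * y)"
  shows "e * y = 0"
proof -
  have sa: "star g = g" "star e = e" using g e by (auto simp: positive_def)
  obtain t u where tu: "norm (t *\<^sub>R 1 - g * g) \<le> t" "norm (u *\<^sub>R 1 - e * e) \<le> u"
    using positive_square[OF sa(1)] positive_square[OF sa(2)] by (auto simp: positive_def)
  \<comment> \<open>One scale for both \<open>g\<close> and \<open>e\<close>, so that the two square
    roots are values of the same power series.\<close>
  define T where "T = max 1 (max t u)"
  have T: "0 < T" "norm (T *\<^sub>R 1 - g * g) \<le> T" "norm (T *\<^sub>R 1 - e * e) \<le> T"
    using positive_mono[OF tu(1), of T] positive_mono[OF tu(2), of T] by (auto simp: T_def)
  define X where "X h = 1 - (1 / T) *\<^sub>R (h * h)" for h :: 'a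
  \<comment> \<open>By uniqueness of roots, \<open>h\<close> is recovered from \<open>h * h\<close>
    through the series. An intertwining relation between the squares thus descends to
    \<open>g\<close> and \<open>e\<close>, where the sign of \<open>y * g = - (e * y)\<close> has
    disappeared.\<close>
  have root: "norm (X h) \<le> 1 \<and> sqrt T *\<^sub>R sqrt_one_minus (X h) = h"
    if h: "positive h" "norm (T *\<^sub>R 1 - h * h) \<le> T" for h
  proof -
    have "X h = (1 / T) *\<^sub>R (T *\<^sub>R 1 - h * h)" using T(1) by (simp add: X_def algebra_simps)
    then have x: "norm (X h) \<le> 1" using T(1) h by simp
    have sx: "star (X h) = X h" using h(1) by (simp add: X_def star_diff star_mult positive_def)
    have "positive (sqrt_one_minus (X h))"
      using norm_one_minus_sqrt_one_minus_le[OF x] star_sqrt_one_minus[OF x sx]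
      by (intro positiveI[of _ 1]) auto
    then have p: "positive (sqrt T *\<^sub>R sqrt_one_minus (X h))" using T(1) by (intro positive_scaleR) auto
    have "h * X h = X h * h" by (simp add: X_def algebra_simps)
    then have "h * sqrt_one_minus (X h) = sqrt_one_minus (X h) * h"
      by (rule sqrt_one_minus_intertwine[OF x x])
    moreover have "(sqrt T *\<^sub>R sqrt_one_minus (X h)) * (sqrt T *\<^sub>R sqrt_one_minus (X h)) = T *\<^sub>R (1 - X h)"
      using T(1) by (simp add: sqrt_one_minus_square[OF x])
    moreover have "\<dots> = h * h" using T(1) by (simp add: X_def)
    ultimately have "sqrt T *\<^sub>R sqrt_one_minus (X h) = h"
      by (intro positive_sqrt_unique[OF p h(1)]) simp_all
    with x show ?thesis by blast
  qed
  note rg = root[OF g T(2)] and re = root[OF e T(3)]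
  have "y * (g * g) = (e * e) * y"
    by (simp add: mult.assoc[symmetric] y) (simp add: mult.assoc y)
  then have "y * X g = X e * y" by (simp add: X_def algebra_simps)
  then have "y * sqrt_one_minus (X g) = sqrt_one_minus (X e) * y"
    using rg re by (intro sqrt_one_minus_intertwine) simp_all
  then have "y * (sqrt T *\<^sub>R sqrt_one_minus (X g)) = (sqrt T *\<^sub>R sqrt_one_minus (X e)) * y"
    by simp
  then have "y * g = e * y" using rg re by simp
  with y have "e * y + e * y = 0" by (simp add: eq_neg_iff_add_eq_0)
  then have "2 *\<^sub>R (e * y) = 0" by (simp add: scaleR_2)
  then show ?thesis by simp
qed

text \<open>The real and imaginary parts of \<open>d\<close>, doubled, have squares summing to twice
  \<open>star d * d + d * star d\<close>. If \<open>star d * d\<close> is negative, then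
  \<open>d * star d\<close> is positive. The usual comparison of the spectra of these two products
  is replaced by the fact that \<open>star d\<close> intertwines them.\<close>

lemma negative_star_mult_self:
  assumes "positive (- (star d * d))"
  shows "d = 0"
proof -
  define r where "r = d + star d"
  define m where "m = \<i> *\<^sub>C (d - star d)"
  have "star r = r" "star m = m"
    by (simp_all add: r_def m_def star_add star_scaleC star_diff star_star complex_vector.scale_right_diff_distrib add.commute)
  then have "positive (r * r + m * m)" by (intro positive_add positive_square)
  moreover have "r * r + m * m = 2 *\<^sub>R (star d * d) + 2 *\<^sub>R (d * star d)"
    by (simp add: r_def m_def mult_scaleC_left mult_scaleC_right scaleC_scaleC algebra_simps scaleR_2)
  moreover have "positive (2 *\<^sub>R (- (star d * d)))" using assms by (rule positive_scaleR) simp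
  ultimately have "positive (2 *\<^sub>R (star d * d) + 2 *\<^sub>R (d * star d) + 2 *\<^sub>R (- (star d * d)))"
    by (metis positive_add)
  then have "positive (2 *\<^sub>R (d * star d))" by simp
  then have "positive ((1/2) *\<^sub>R (2 *\<^sub>R (d * star d)))" by (rule positive_scaleR) simp
  then have g: "positive (d * star d)" by simp
  have "- (star d * d) * star d = 0"
    by (rule positive_intertwine_minus[OF g assms]) (simp add: mult.assoc)
  then have "star (d * star d) * (d * star d) = 0" by (simp add: star_mult star_star mult.assoc)
  then have "d * star d = 0" by (simp add: star_mult_self_eq_0_iff)
  then show ?thesis using norm_mult_star_self[of d] by simp
qed

text \<open>With \<open>a = \<bar>h\<bar>\<close>, the element \<open>m = a - h\<close> is twice the negative part of \<open>h\<close>.\<close>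

lemma positive_star_mult_self: "positive (star c * c)"
proof -
  define h where "h = star c * c"
  have h: "star h = h" by (simp add: h_def star_mult star_star)
  obtain a where a: "positive a" "a * a = h * h" "\<And>y. y * (h * h) = (h * h) * y \<Longrightarrow> y * a = a * y"
    using positive_sqrt[OF positive_square[OF h]] by blast
  have ha: "h * a = a * h" by (rule a(3)) (simp add: mult.assoc)
  have sa: "star a = a" using a(1) by (simp add: positive_def)
  define m where "m = a - h"
  have m: "star m = m" by (simp add: m_def star_diff sa h)
  have ma: "m * a = a * m" using ha by (simp add: m_def algebra_simps)
  have hm: "h * m = - (a * m)" using ha a(2) by (simp add: m_def algebra_simps)
  \<comment> \<open>As \<open>h\<close> acts on \<open>m\<close> like \<open>- a\<close>, the
    element \<open>c * m\<close> has a negative \<open>star\<close> product with itself and so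
    vanishes. Then \<open>h * m\<close> and \<open>a * m\<close> vanish, and with them
    \<open>m * m\<close>.\<close>
  have "star (c * m) * (c * m) = m * (h * m)" by (simp add: star_mult m h_def mult.assoc)
  also have "\<dots> = - (m * a * m)" by (simp add: hm mult.assoc)
  finally have eq: "star (c * m) * (c * m) = - (m * a * m)" .
  have "positive (m * a * m)" by (rule positive_commute_mult[OF a(1) m ma])
  then have "c * m = 0" by (intro negative_star_mult_self) (simp add: eq)
  then have "h * m = 0" by (simp add: h_def mult.assoc)
  moreover from this hm have "a * m = 0" by simp
  moreover have "m * m = a * m - h * m" unfolding m_def by (rule left_diff_distrib)
  ultimately have "star m * m = 0" by (simp add: m)
  then have "m = 0" by (simp add: star_mult_self_eq_0_iff)
  then show ?thesis using a(1) by (simp add: m_def h_def)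
qed

section \<open>States on unital algebras\<close>

text \<open>If \<open>s = norm (1 + b)\<close>, then \<open>s *\<^sub>R 1 - (1 + b)\<close> is
  positive, which bounds \<open>b\<close> by \<open>(s - 1) *\<^sub>R 1\<close> in the order and
  hence in norm. The equality lets one functional norm \<open>1\<close> and \<open>b\<close> at
  once.\<close>

lemma norm_one_plus_positive:
  assumes "positive b" "norm (1::'a) = 1"
  shows "norm (1 + b) = 1 + norm (b::'a::{cstar_algebra,monoid_mult})"
proof (rule antisym)
  show "norm (1 + b) \<le> 1 + norm b" using norm_triangle_ineq[of 1 b] assms(2) by simp
  have sa: "star b = b" using assms(1) by (simp add: positive_def)
  have one: "positive (1::'a)" using positive_square[of "1::'a"] by simp
  let ?s = "norm (1 + b)"
  have p: "positive (?s *\<^sub>R 1 - (1 + b))"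
    by (rule positive_norm_minus) (simp add: star_add sa)
  have "positive (?s *\<^sub>R 1 - 1 :: 'a)"
    using positive_add[OF p assms(1)] by (simp add: algebra_simps)
  then have s1: "positive ((?s - 1) *\<^sub>R (1::'a))" by (simp add: scaleR_diff_left)
  have "1 \<le> ?s"
  proof (rule ccontr)
    assume s: "\<not> 1 \<le> ?s"
    then have "positive ((1 - ?s) *\<^sub>R (1::'a))" by (intro positive_scaleR one) simp
    then have "(?s - 1) *\<^sub>R (1::'a) = 0"
      using s1 by (intro positive_antisym) (simp_all add: scaleR_diff_left)
    then have "?s - 1 = 0 \<or> (1::'a) = 0" by simp
    with s assms(2) show False by auto
  qed
  then have "norm b \<le> ?s - 1"
    using p by (intro positive_norm_le[OF assms(1)]) (simp_all add: algebra_simps)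
  then show "1 + norm b \<le> ?s" by simp
qed

text \<open>A functional norming \<open>1 + star a * a\<close> must attain the norm on each summand.
  From \<open>f 1 = 1\<close> and \<open>f \<le> norm\<close> it is nonnegative on positive
  \<open>h\<close>, because \<open>t - f h = f (t *\<^sub>R 1 - h) \<le> t\<close>.\<close>

lemma unital_state:
  fixes a :: "'a::{cstar_algebra,monoid_mult}"
  assumes "a \<noteq> 0"
  obtains f :: "'a \<Rightarrow> real" where "linear f" "\<And>x. f x \<le> norm x" "\<And>x. 0 \<le> f (star x * x)"
    "f (star a * a) = (norm a)\<^sup>2"
proof -
  have "norm (1::'a) = norm (1::'a) * norm (1::'a)"
    using norm_star_mult_self[of "1::'a"] by (simp add: power2_eq_square)
  moreover have "(1::'a) \<noteq> 0" using assms by (metis mult_1_left mult_zero_left)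
  ultimately have one: "norm (1::'a) = 1" by simp
  let ?b = "star a * a"
  obtain f where f: "linear f" "\<And>x. f x \<le> norm x" "f (1 + ?b) = norm (1 + ?b)"
    using norming_functional[of "1 + ?b"] by blast
  have "f 1 + f ?b = 1 + norm ?b"
    using f(3) linear_add[OF f(1)] norm_one_plus_positive[OF positive_star_mult_self one] by simp
  with f(2)[of 1] f(2)[of ?b] one have f1: "f 1 = 1" "f ?b = norm ?b" by auto
  have "0 \<le> f h" if "positive h" for h
  proof -
    obtain t where "norm (t *\<^sub>R 1 - h) \<le> t" using \<open>positive h\<close> by (auto simp: positive_def)
    then have "f (t *\<^sub>R 1 - h) \<le> t" by (rule order_trans[OF f(2)])
    then show ?thesis by (simp add: linear_diff[OF f(1)] linear_cmul[OF f(1)] f1)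
  qed
  then have "0 \<le> f (star x * x)" for x by (simp add: positive_star_mult_self)
  moreover have "f ?b = (norm a)\<^sup>2" using f1 by (simp add: norm_star_mult_self)
  ultimately show thesis using f(1,2) by (intro that)
qed

section \<open>The multiplier algebra\<close>

text \<open>A C*-algebra is a Hilbert module over itself with inner product \<open>star x * y\<close>. Its
  adjointable operators form a unital C*-algebra in which it embeds by left multiplication.\<close>

definition adjoint_pair :: "('a \<Rightarrow>\<^sub>L 'a) \<Rightarrow> ('a \<Rightarrow>\<^sub>L 'a::cstar_algebra) \<Rightarrow> bool" where
  "adjoint_pair T S \<longleftrightarrow> (\<forall>x y. star (T x) * y = star x * S y)"

text \<open>Nondegeneracy of the module inner product, tested at \<open>u - v\<close>.\<close>

lemma star_mult_cancel:
  assumes "\<And>x. star x * u = star x * (v::'a::cstar_algebra)"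
  shows "u = v"
proof -
  have "star (u - v) * (u - v) = 0" using assms[of "u - v"] by (simp add: right_diff_distrib)
  then show ?thesis by (simp add: star_mult_self_eq_0_iff)
qed

lemma adjoint_pair_sym: "adjoint_pair T S \<Longrightarrow> adjoint_pair S T"
  unfolding adjoint_pair_def by (metis star_mult star_star)

lemma adjoint_pair_unique: "adjoint_pair T S \<Longrightarrow> adjoint_pair T S' \<Longrightarrow> S = S'"
  unfolding adjoint_pair_def by (rule blinfun_eqI, rule star_mult_cancel) metis

lemma adjoint_pair_scaleC:
  assumes "adjoint_pair T S"
  shows "T (c *\<^sub>C x) = c *\<^sub>C T x"
proof (rule star_mult_cancel)
  have "star y * T z = star (S y) * z" for y z
    using adjoint_pair_sym[OF assms] by (simp add: adjoint_pair_def)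
  then show "star y * T (c *\<^sub>C x) = star y * (c *\<^sub>C T x)" for y
    by (simp add: mult_scaleC_right)
qed

lemma adjoint_pair_mult:
  assumes "adjoint_pair T S"
  shows "T (x * y) = T x * y"
proof (rule star_mult_cancel)
  have "star z * T w = star (S z) * w" for z w
    using adjoint_pair_sym[OF assms] by (simp add: adjoint_pair_def)
  then show "star z * T (x * y) = star z * (T x * y)" for z
    by (simp add: mult.assoc[symmetric])
qed

text \<open>The nontrivial half of the C*-identity: \<open>(norm (T x))\<^sup>2\<close> is the norm
  of \<open>star x * S (T x)\<close>.\<close>

lemma norm_adjoint_pair:
  assumes TS: "adjoint_pair T S"
  shows "(norm T)\<^sup>2 \<le> norm (S o\<^sub>L T)"
proof -
  have "norm (T x) \<le> sqrt (norm (S o\<^sub>L T)) * norm x" for x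
  proof -
    have "(norm (T x))\<^sup>2 = norm (star x * (S o\<^sub>L T) x)"
      using TS by (simp add: norm_star_mult_self[symmetric] adjoint_pair_def)
    also have "\<dots> \<le> norm x * (norm (S o\<^sub>L T) * norm x)"
      using norm_mult_ineq[of "star x" "(S o\<^sub>L T) x"] norm_blinfun[of "S o\<^sub>L T" x]
      by (smt (verit) mult_left_mono norm_ge_zero norm_star)
    also have "\<dots> = (sqrt (norm (S o\<^sub>L T)) * norm x)\<^sup>2"
      by (simp add: power_mult_distrib) (simp add: power2_eq_square)
    finally show ?thesis by (rule power2_le_imp_le) simp
  qed
  then have "norm T \<le> sqrt (norm (S o\<^sub>L T))" by (intro norm_blinfun_bound) auto
  then have "(norm T)\<^sup>2 \<le> (sqrt (norm (S o\<^sub>L T)))\<^sup>2" by (rule power_mono) simp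
  then show ?thesis by simp
qed

lemma norm_adjoint_eq:
  assumes "adjoint_pair T S"
  shows "norm S = norm T"
proof -
  have le: "norm T \<le> norm S" if "adjoint_pair T S" for T S :: "'a \<Rightarrow>\<^sub>L 'a"
  proof (cases "norm T = 0")
    case False
    have "norm T * norm T \<le> norm S * norm T"
      using norm_adjoint_pair[OF that] norm_blinfun_compose[of S T] by (simp add: power2_eq_square)
    with False show ?thesis by (simp add: mult_le_cancel_right)
  qed simp
  show ?thesis using le[OF assms] le[OF adjoint_pair_sym[OF assms]] by simp
qed

lift_definition scaleC_blinfun :: "complex \<Rightarrow> 'a \<Rightarrow>\<^sub>L 'a::cstar_algebra" is "scaleC"
proof -
  fix c
  show "bounded_linear (scaleC c :: 'a \<Rightarrow> 'a)"
    by (rule bounded_linear_intro[of _ "cmod c"])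
      (simp_all add: scaleC_add_right scaleR_scaleC scaleC_scaleC norm_scaleC mult.commute)
qed

lift_definition mult_blinfun :: "'a \<Rightarrow> 'a \<Rightarrow>\<^sub>L 'a::cstar_algebra" is "(*)"
  by (rule bounded_linear_mult_right)

lemma adjoint_pair_zero: "adjoint_pair 0 0"
  and adjoint_pair_id: "adjoint_pair id_blinfun id_blinfun"
  and adjoint_pair_scaleC_blinfun: "adjoint_pair (scaleC_blinfun c) (scaleC_blinfun (cnj c))"
  and adjoint_pair_mult_blinfun: "adjoint_pair (mult_blinfun a) (mult_blinfun (star a))"
  by (simp_all add: adjoint_pair_def scaleC_blinfun.rep_eq mult_blinfun.rep_eq star_scaleC
      mult_scaleC_left mult_scaleC_right star_mult mult.assoc)

lemma adjoint_pair_add: "adjoint_pair T S \<Longrightarrow> adjoint_pair T' S' \<Longrightarrow> adjoint_pair (T + T') (S + S')"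
  and adjoint_pair_diff: "adjoint_pair T S \<Longrightarrow> adjoint_pair T' S' \<Longrightarrow> adjoint_pair (T - T') (S - S')"
  and adjoint_pair_minus: "adjoint_pair T S \<Longrightarrow> adjoint_pair (- T) (- S)"
  and adjoint_pair_scaleR: "adjoint_pair T S \<Longrightarrow> adjoint_pair (r *\<^sub>R T) (r *\<^sub>R S)"
  by (simp_all add: adjoint_pair_def blinfun.bilinear_simps star_add star_diff distrib_left
      distrib_right left_diff_distrib right_diff_distrib)

lemma adjoint_pair_compose:
  "adjoint_pair T S \<Longrightarrow> adjoint_pair T' S' \<Longrightarrow> adjoint_pair (T o\<^sub>L T') (S' o\<^sub>L S)"
  by (simp add: adjoint_pair_def)

section \<open>The C*-algebra of adjointable operators\<close>

text \<open>The adjoint is not part of the data: it is unique, so \<open>star\<close> can select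
  it.\<close>

typedef (overloaded) 'a multiplier = "{T :: 'a \<Rightarrow>\<^sub>L 'a::cstar_algebra. \<exists>S. adjoint_pair T S}"
  morphisms multiplier_op Abs_multiplier
  using adjoint_pair_zero by blast

setup_lifting type_definition_multiplier

instantiation multiplier :: (cstar_algebra) complex_star_algebra
begin

lift_definition zero_multiplier :: "'a multiplier" is 0
  using adjoint_pair_zero by blast

lift_definition plus_multiplier :: "'a multiplier \<Rightarrow> 'a multiplier \<Rightarrow> 'a multiplier" is "(+)"
  using adjoint_pair_add by blast

lift_definition minus_multiplier :: "'a multiplier \<Rightarrow> 'a multiplier \<Rightarrow> 'a multiplier" is "(-)"
  using adjoint_pair_diff by blast

lift_definition uminus_multiplier :: "'a multiplier \<Rightarrow> 'a multiplier" is uminus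
  using adjoint_pair_minus by blast

lift_definition times_multiplier :: "'a multiplier \<Rightarrow> 'a multiplier \<Rightarrow> 'a multiplier" is "(o\<^sub>L)"
  using adjoint_pair_compose by blast

lift_definition scaleC_multiplier :: "complex \<Rightarrow> 'a multiplier \<Rightarrow> 'a multiplier"
  is "\<lambda>c T. scaleC_blinfun c o\<^sub>L T"
  using adjoint_pair_compose adjoint_pair_scaleC_blinfun by blast

lift_definition star_multiplier :: "'a multiplier \<Rightarrow> 'a multiplier"
  is "\<lambda>T. THE S. adjoint_pair T S"
proof -
  fix T :: "'a \<Rightarrow>\<^sub>L 'a" assume "\<exists>S. adjoint_pair T S"
  then obtain S where S: "adjoint_pair T S" by blast
  then have "(THE S. adjoint_pair T S) = S" by (intro the_equality) (auto intro: adjoint_pair_unique)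
  with adjoint_pair_sym[OF S] show "\<exists>S'. adjoint_pair (THE S. adjoint_pair T S) S'" by auto
qed

lemma multiplier_star: "adjoint_pair (multiplier_op T) (multiplier_op (star T))"
proof -
  obtain S where S: "adjoint_pair (multiplier_op T) S" using multiplier_op[of T] by blast
  then have "(THE S. adjoint_pair (multiplier_op T) S) = S"
    by (intro the_equality) (auto intro: adjoint_pair_unique)
  with S show ?thesis by (simp add: star_multiplier.rep_eq)
qed

lemma multiplier_star_eqI: "adjoint_pair (multiplier_op T) (multiplier_op S) \<Longrightarrow> star T = S"
  using multiplier_star[of T] adjoint_pair_unique multiplier_op_inject by blast

lemma multiplier_op_scaleC: "multiplier_op (T :: 'a multiplier) (c *\<^sub>C x) = c *\<^sub>C multiplier_op T x"
  by (rule adjoint_pair_scaleC[OF multiplier_star])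

instance
proof
  fix a b :: complex and x y z :: "'a multiplier"
  show "x + y + z = x + (y + z)" by transfer simp
  show "x + y = y + x" by transfer simp
  show "0 + x = x" by transfer simp
  show "- x + x = 0" by transfer simp
  show "x - y = x + - y" by transfer simp
  show "x * y * z = x * (y * z)" by transfer (rule blinfun_eqI, simp)
  show "(x + y) * z = x * z + y * z" by transfer (rule blinfun_eqI, simp add: blinfun.bilinear_simps)
  show "x * (y + z) = x * y + x * z" by transfer (rule blinfun_eqI, simp add: blinfun.bilinear_simps)
  show "a *\<^sub>C (x + y) = a *\<^sub>C x + a *\<^sub>C y"
    by transfer (rule blinfun_eqI, simp add: blinfun.bilinear_simps)
  show "(a + b) *\<^sub>C x = a *\<^sub>C x + b *\<^sub>C x"
    by transfer (rule blinfun_eqI, simp add: blinfun.bilinear_simps scaleC_blinfun.rep_eq scaleC_add_left)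
  show "a *\<^sub>C b *\<^sub>C x = (a * b) *\<^sub>C x"
    by transfer (rule blinfun_eqI, simp add: scaleC_blinfun.rep_eq scaleC_scaleC)
  show "1 *\<^sub>C x = x"
    by transfer (rule blinfun_eqI, simp add: scaleC_blinfun.rep_eq scaleC_one)
  show "(a *\<^sub>C x) * y = a *\<^sub>C (x * y)" by transfer (rule blinfun_eqI, simp)
  show "x * (a *\<^sub>C y) = a *\<^sub>C (x * y)"
    by transfer (rule blinfun_eqI, auto simp: scaleC_blinfun.rep_eq adjoint_pair_scaleC)
  show "star (x + y) = star x + star y"
    by (rule multiplier_star_eqI)
      (simp add: plus_multiplier.rep_eq adjoint_pair_add multiplier_star)
  show "star (x * y) = star y * star x"
    by (rule multiplier_star_eqI)
      (simp add: times_multiplier.rep_eq adjoint_pair_compose multiplier_star)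
  show "star (star x) = x"
    by (rule multiplier_star_eqI) (simp add: adjoint_pair_sym multiplier_star)
  show "star (a *\<^sub>C x) = cnj a *\<^sub>C star x"
  proof (rule multiplier_star_eqI)
    have "multiplier_op (cnj a *\<^sub>C star x) = multiplier_op (star x) o\<^sub>L scaleC_blinfun (cnj a)"
      by (rule blinfun_eqI) (simp add: scaleC_multiplier.rep_eq scaleC_blinfun.rep_eq multiplier_op_scaleC)
    then show "adjoint_pair (multiplier_op (a *\<^sub>C x)) (multiplier_op (cnj a *\<^sub>C star x))"
      using adjoint_pair_compose[OF adjoint_pair_scaleC_blinfun[of a] multiplier_star[of x]]
      by (simp add: scaleC_multiplier.rep_eq)
  qed
qed

end

instantiation multiplier :: (cstar_algebra) real_normed_vector
begin

lift_definition scaleR_multiplier :: "real \<Rightarrow> 'a multiplier \<Rightarrow> 'a multiplier" is scaleR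
  using adjoint_pair_scaleR by blast

lift_definition norm_multiplier :: "'a multiplier \<Rightarrow> real" is norm .

lift_definition dist_multiplier :: "'a multiplier \<Rightarrow> 'a multiplier \<Rightarrow> real" is dist .

definition sgn_multiplier :: "'a multiplier \<Rightarrow> 'a multiplier" where
  "sgn_multiplier x = inverse (norm x) *\<^sub>R x"

definition uniformity_multiplier :: "('a multiplier \<times> 'a multiplier) filter" where
  "uniformity_multiplier = (INF e\<in>{0<..}. principal {(x, y). dist x y < e})"

definition open_multiplier :: "'a multiplier set \<Rightarrow> bool" where
  "open_multiplier U \<longleftrightarrow> (\<forall>x\<in>U. eventually (\<lambda>(x', y). x' = x \<longrightarrow> y \<in> U) uniformity)"

instance
proof
  fix r q :: real and x y :: "'a multiplier" and U :: "'a multiplier set"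
  show "r *\<^sub>R (x + y) = r *\<^sub>R x + r *\<^sub>R y" by transfer (rule scaleR_add_right)
  show "(r + q) *\<^sub>R x = r *\<^sub>R x + q *\<^sub>R x" by transfer (rule scaleR_add_left)
  show "r *\<^sub>R q *\<^sub>R x = (r * q) *\<^sub>R x" by transfer simp
  show "1 *\<^sub>R x = x" by transfer simp
  show "dist x y = norm (x - y)" by transfer (rule dist_norm)
  show "sgn x = inverse (norm x) *\<^sub>R x" by (rule sgn_multiplier_def)
  show "uniformity = (INF e\<in>{0<..}. principal {(x, y :: 'a multiplier). dist x y < e})"
    by (rule uniformity_multiplier_def)
  show "open U \<longleftrightarrow> (\<forall>x\<in>U. eventually (\<lambda>(x', y). x' = x \<longrightarrow> y \<in> U) uniformity)"
    by (rule open_multiplier_def)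
  show "norm x = 0 \<longleftrightarrow> x = 0" by transfer simp
  show "norm (x + y) \<le> norm x + norm y" by transfer (rule norm_triangle_ineq)
  show "norm (r *\<^sub>R x) = \<bar>r\<bar> * norm x" by transfer simp
qed

end

instantiation multiplier :: (cstar_algebra) "{real_normed_algebra,monoid_mult}"
begin

lift_definition one_multiplier :: "'a multiplier" is id_blinfun
  using adjoint_pair_id by blast

instance
proof
  fix r :: real and x y :: "'a multiplier"
  show "r *\<^sub>R x * y = r *\<^sub>R (x * y)" by transfer (rule blinfun_eqI, simp add: blinfun.bilinear_simps)
  show "x * r *\<^sub>R y = r *\<^sub>R (x * y)" by transfer (rule blinfun_eqI, simp add: blinfun.bilinear_simps)
  show "norm (x * y) \<le> norm x * norm y" by transfer (rule norm_blinfun_compose)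
  show "1 * x = x" by transfer (rule blinfun_eqI, simp)
  show "x * 1 = x" by transfer (rule blinfun_eqI, simp)
qed

end

text \<open>A limit of adjointable operators is adjointable, since the adjoints form a Cauchy
  sequence as well and their limit is the adjoint of the limit.\<close>

instance multiplier :: (cstar_algebra) banach
proof
  fix X :: "nat \<Rightarrow> 'a multiplier"
  assume X: "Cauchy X"
  \<comment> \<open>The fact for C*-algebras cannot be quoted here, since that instance presupposes
    the completeness being proved.\<close>
  have norm_star: "norm (star T) = norm T" for T :: "'a multiplier"
    using norm_adjoint_eq[OF multiplier_star[of T]] by (simp add: norm_multiplier.rep_eq)
  have Cauchy_op: "Cauchy (\<lambda>n. multiplier_op (Y n))" if "Cauchy Y" for Y :: "nat \<Rightarrow> 'a multiplier"
    using that by (simp add: Cauchy_def dist_multiplier.rep_eq)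
  have star_diff: "star (S - T) = star S - star T" for S T :: "'a multiplier"
    using star_add[of S "- T"] by simp
  have "Cauchy (\<lambda>n. star (X n))"
    using X by (simp add: Cauchy_def dist_norm star_diff[symmetric] norm_star)
  from Cauchy_op[OF this] obtain S where S: "(\<lambda>n. multiplier_op (star (X n))) \<longlonglongrightarrow> S"
    by (auto simp: Cauchy_convergent_iff convergent_def)
  from Cauchy_op[OF X] obtain T where T: "(\<lambda>n. multiplier_op (X n)) \<longlonglongrightarrow> T"
    by (auto simp: Cauchy_convergent_iff convergent_def)
  have "star (T x) * y = star x * S y" for x y
  proof (rule LIMSEQ_unique)
    show "(\<lambda>n. star (multiplier_op (X n) x) * y) \<longlonglongrightarrow> star (T x) * y"
      by (intro tendsto_intros bounded_linear.tendsto[OF bounded_linear_star] T)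
    have "(\<lambda>n. star x * multiplier_op (star (X n)) y) \<longlonglongrightarrow> star x * S y"
      by (intro tendsto_intros S)
    then show "(\<lambda>n. star (multiplier_op (X n) x) * y) \<longlonglongrightarrow> star x * S y"
      using multiplier_star[of "X _"] by (simp add: adjoint_pair_def)
  qed
  then have "adjoint_pair T S" by (simp add: adjoint_pair_def)
  then have T': "multiplier_op (Abs_multiplier T) = T" by (auto intro!: Abs_multiplier_inverse)
  have "X \<longlonglongrightarrow> Abs_multiplier T"
    using T by (simp add: tendsto_iff dist_multiplier.rep_eq T')
  then show "convergent X" by (auto simp: convergent_def)
qed

instance multiplier :: (cstar_algebra) cstar_algebra
proof
  fix r :: real and a :: complex and x :: "'a multiplier"
  show "r *\<^sub>R x = complex_of_real r *\<^sub>C x"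
    by transfer (rule blinfun_eqI, simp add: blinfun.bilinear_simps scaleC_blinfun.rep_eq scaleR_scaleC)
  show "norm (a *\<^sub>C x) = cmod a * norm x"
  proof (rule antisym)
    have le: "norm (c *\<^sub>C y) \<le> cmod c * norm y" for c and y :: "'a multiplier"
    proof -
      have "norm (scaleC_blinfun c :: 'a \<Rightarrow>\<^sub>L 'a) \<le> cmod c"
        by (rule norm_blinfun_bound) (simp_all add: scaleC_blinfun.rep_eq norm_scaleC)
      then show ?thesis
        using norm_blinfun_compose[of "scaleC_blinfun c" "multiplier_op y"]
        by (simp add: norm_multiplier.rep_eq scaleC_multiplier.rep_eq)
          (meson mult_right_mono norm_ge_zero order_trans)
    qed
    show "norm (a *\<^sub>C x) \<le> cmod a * norm x" by (rule le)
    show "cmod a * norm x \<le> norm (a *\<^sub>C x)"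
    proof (cases "a = 0")
      case False
      have "inverse a *\<^sub>C a *\<^sub>C x = x" using False by (simp add: scaleC_scaleC scaleC_one)
      then have "norm x \<le> inverse (cmod a) * norm (a *\<^sub>C x)"
        using le[of "inverse a" "a *\<^sub>C x"] by (simp add: norm_inverse)
      then show ?thesis using False by (simp add: field_simps)
    qed simp
  qed
  show "norm (star x * x) = (norm x)\<^sup>2"
  proof (rule antisym)
    show "(norm x)\<^sup>2 \<le> norm (star x * x)"
      using norm_adjoint_pair[OF multiplier_star[of x]]
      by (simp add: norm_multiplier.rep_eq times_multiplier.rep_eq)
    show "norm (star x * x) \<le> (norm x)\<^sup>2"
      using norm_mult_ineq[of "star x" x] norm_adjoint_eq[OF multiplier_star[of x]]
      by (simp add: norm_multiplier.rep_eq power2_eq_square)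
  qed
qed

lift_definition multiplier :: "'a \<Rightarrow> 'a::cstar_algebra multiplier" is mult_blinfun
  using adjoint_pair_mult_blinfun by blast

lemma multiplier_add: "multiplier (x + y) = multiplier x + multiplier y"
  by transfer (rule blinfun_eqI, simp add: mult_blinfun.rep_eq blinfun.bilinear_simps distrib_right)

lemma multiplier_scaleR: "multiplier (r *\<^sub>R x) = r *\<^sub>R multiplier x"
  by transfer (rule blinfun_eqI, simp add: mult_blinfun.rep_eq blinfun.bilinear_simps)

lemma multiplier_mult: "multiplier (x * y) = multiplier x * multiplier y"
  by transfer (rule blinfun_eqI, simp add: mult_blinfun.rep_eq mult.assoc)

lemma multiplier_of_star: "multiplier (star x) = star (multiplier x)"
  by (rule multiplier_star_eqI[symmetric]) (simp add: multiplier.rep_eq adjoint_pair_mult_blinfun)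

text \<open>The operator norm is attained at \<open>star x\<close>, by the C*-identity for
  \<open>x * star x\<close>.\<close>

lemma norm_multiplier [simp]: "norm (multiplier x) = norm x"
proof -
  have "norm (mult_blinfun x) = norm x"
  proof (rule antisym)
    show "norm (mult_blinfun x) \<le> norm x"
      by (rule norm_blinfun_bound) (simp_all add: mult_blinfun.rep_eq norm_mult_ineq)
    show "norm x \<le> norm (mult_blinfun x)"
    proof (cases "norm x = 0")
      case False
      have "norm x * norm x \<le> norm (mult_blinfun x) * norm x"
        using norm_blinfun[of "mult_blinfun x" "star x"]
        by (simp add: mult_blinfun.rep_eq norm_mult_star_self power2_eq_square)
      with False show ?thesis by (simp add: mult_le_cancel_right)
    qed simp
  qed
  then show ?thesis by (simp add: norm_multiplier.rep_eq multiplier.rep_eq)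
qed

text \<open>The algebra is a left ideal in its multipliers. This brings square roots taken among the
  multipliers back to elements of the algebra.\<close>

lemma multiplier_times: "T * multiplier x = multiplier (multiplier_op T x)"
  by (rule multiplier_op_inject[THEN iffD1], rule blinfun_eqI)
    (simp add: times_multiplier.rep_eq multiplier.rep_eq mult_blinfun.rep_eq
      adjoint_pair_mult[OF multiplier_star])

lemma inj_multiplier: "multiplier x = multiplier y \<Longrightarrow> x = y"
proof -
  assume eq: "multiplier x = multiplier y"
  have "multiplier (x - y) = multiplier x - multiplier y"
    using multiplier_add[of "x - y" y] by simp
  with eq norm_multiplier[of "x - y"] show ?thesis by simp
qed

section \<open>States\<close>

text \<open>Invariance under \<open>star\<close> makes \<open>f\<close> the real part of a hermitian complex functional,
  namely of \<open>\<lambda>a. f a - \<i> * f (\<i> *\<^sub>C a)\<close>.\<close>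

definition positive_functional :: "('a::cstar_algebra \<Rightarrow> real) \<Rightarrow> bool" where
  "positive_functional f \<longleftrightarrow> linear f \<and> (\<forall>x. f (star x) = f x) \<and> (\<forall>x. 0 \<le> f (star x * x))"

text \<open>A state of the multiplier algebra is restricted and averaged with its composition with
  \<open>star\<close>. The averaging leaves the values at self-adjoint elements
  \<open>star x * x\<close> unchanged.\<close>

lemma exists_state:
  fixes a :: "'a::cstar_algebra"
  assumes "a \<noteq> 0"
  obtains f where "positive_functional f" "\<And>x. f x \<le> norm x" "f (star a * a) = (norm a)\<^sup>2"
proof -
  have "multiplier a \<noteq> 0" using norm_multiplier[of a] assms by (metis norm_eq_zero)
  from unital_state[OF this] obtain F :: "'a multiplier \<Rightarrow> real" where F: "linear F" "\<And>x. F x \<le> norm x"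
    "\<And>x. 0 \<le> F (star x * x)" "F (star (multiplier a) * multiplier a) = (norm (multiplier a))\<^sup>2"
    by metis
  define f where "f x = (F (multiplier x) + F (multiplier (star x))) / 2" for x
  have sq: "f (star x * x) = F (star (multiplier x) * multiplier x)" for x
    by (simp add: f_def star_mult star_star multiplier_mult multiplier_of_star)
  have "linear f"
    by (rule linearI) (simp_all add: f_def star_add multiplier_add multiplier_scaleR
        linear_add[OF F(1)] linear_cmul[OF F(1)] field_simps)
  moreover have "f (star x) = f x" for x by (simp add: f_def star_star)
  moreover have "f x \<le> norm x" for x
    using F(2)[of "multiplier x"] F(2)[of "multiplier (star x)"] by (simp add: f_def)
  ultimately show thesis
    using sq F(3,4) by (intro that[of f]) (simp_all add: positive_functional_def)
qed

text \<open>The witness is \<open>w = \<surd>(norm x\<^sup>2 - star x * x) y\<close>, with the square root taken among the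
  multipliers.\<close>

lemma norm_mult_domination:
  fixes x y :: "'a::cstar_algebra"
  obtains w where "(norm x)\<^sup>2 *\<^sub>R (star y * y) - star (x * y) * (x * y) = star w * w"
proof -
  let ?m = "multiplier :: 'a \<Rightarrow> _"
  let ?h = "star (?m x) * ?m x"
  have "positive (norm ?h *\<^sub>R 1 - ?h)"
    by (rule positive_norm_minus) (simp add: star_mult star_star)
  then obtain s where s: "positive s" "s * s = norm ?h *\<^sub>R 1 - ?h"
    using positive_sqrt by blast
  let ?w = "multiplier_op s y"
  have w: "?m ?w = s * ?m y" by (simp add: multiplier_times)
  have "star (?m ?w) * ?m ?w = star (?m y) * (s * s) * ?m y"
    using s(1) by (simp add: w star_mult mult.assoc positive_def)
  also have "\<dots> = (norm x)\<^sup>2 *\<^sub>R (star (?m y) * ?m y) - star (?m x * ?m y) * (?m x * ?m y)"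
    by (simp add: s(2) norm_star_mult_self left_diff_distrib right_diff_distrib star_mult mult.assoc)
  finally have m: "?m (star ?w * ?w) + ?m (star (x * y) * (x * y)) = ?m ((norm x)\<^sup>2 *\<^sub>R (star y * y))"
    by (simp add: multiplier_mult multiplier_of_star multiplier_scaleR)
  have "star ?w * ?w + star (x * y) * (x * y) = (norm x)\<^sup>2 *\<^sub>R (star y * y)"
    by (rule inj_multiplier) (simp only: multiplier_add m)
  then show thesis by (intro that[of ?w]) (simp add: algebra_simps)
qed

text \<open>This bounds left multiplication by \<open>x\<close> in the form given by
  \<open>f\<close>; both contractivity of *-homomorphisms and the GNS construction depend on
  it.\<close>

lemma positive_functional_mult_le:
  assumes f: "positive_functional f"
  shows "f (star (x * y) * (x * y)) \<le> (norm x)\<^sup>2 * f (star y * y)"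
proof -
  have lin: "linear f" using f by (simp add: positive_functional_def)
  obtain w where "(norm x)\<^sup>2 *\<^sub>R (star y * y) - star (x * y) * (x * y) = star w * w"
    by (rule norm_mult_domination)
  then have "f ((norm x)\<^sup>2 *\<^sub>R (star y * y) - star (x * y) * (x * y)) \<ge> 0"
    using f by (simp add: positive_functional_def)
  then show ?thesis by (simp add: linear_diff[OF lin] linear_cmul[OF lin])
qed

lemma cauchy_schwarz_form:
  fixes \<alpha> \<beta> \<gamma> :: real
  assumes "\<And>c. 0 \<le> \<alpha> + 2 * c * \<beta> + c\<^sup>2 * \<gamma>" "0 \<le> \<gamma>"
  shows "\<beta>\<^sup>2 \<le> \<alpha> * \<gamma>"
proof (cases "\<gamma> = 0")
  case True
  have "\<beta> = 0"
  proof (rule ccontr)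
    assume "\<beta> \<noteq> 0"
    \<comment> \<open>When \<gamma> vanishes the form is affine in \<open>c\<close>, and at this
      \<open>c\<close> its value would be -1.\<close>
    define c where "c = - (\<alpha> + 1) / (2 * \<beta>)"
    have "2 * c * \<beta> = - (\<alpha> + 1)" using \<open>\<beta> \<noteq> 0\<close> by (simp add: c_def)
    with assms(1)[of c] True show False by simp
  qed
  with True show ?thesis by simp
next
  case False
  with assms(2) have \<gamma>: "0 < \<gamma>" by simp
  have "0 \<le> \<gamma> * (\<alpha> + 2 * (- \<beta> / \<gamma>) * \<beta> + (- \<beta> / \<gamma>)\<^sup>2 * \<gamma>)"
    using assms(1)[of "- \<beta> / \<gamma>"] \<gamma> by simp
  also have "\<dots> = \<alpha> * \<gamma> - \<beta>\<^sup>2"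
    using \<gamma> by (simp add: field_simps power2_eq_square)
  finally show ?thesis by simp
qed

lemma positive_functional_cauchy_schwarz:
  assumes f: "positive_functional f"
  shows "(f (star y * x))\<^sup>2 \<le> f (star x * x) * f (star y * y)"
proof (rule cauchy_schwarz_form)
  have lin: "linear f" and sa: "\<And>x. f (star x) = f x" and pos: "\<And>x. 0 \<le> f (star x * x)"
    using f by (auto simp: positive_functional_def)
  show "0 \<le> f (star y * y)" by (rule pos)
  fix c
  have "f (star x * y) = f (star y * x)" using sa[of "star x * y"] by (simp add: star_mult star_star)
  then have "f (star (x + c *\<^sub>R y) * (x + c *\<^sub>R y)) =
      f (star x * x) + 2 * c * f (star y * x) + c\<^sup>2 * f (star y * y)"
    by (simp add: star_add distrib_left distrib_right linear_add[OF lin] linear_cmul[OF lin] power2_eq_square)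
  with pos show "0 \<le> f (star x * x) + 2 * c * f (star y * x) + c\<^sup>2 * f (star y * y)" by metis
qed

section \<open>States that detect the norm, and contractivity\<close>

text \<open>Without a unit there is no canonical vector on which to test \<open>x\<close>; the
  element \<open>b = star x * x\<close> takes its place. A state with
  \<open>f (star b * b) = (norm b)\<^sup>2\<close> and the Cauchy-Schwarz inequality for
  \<open>x\<close> and \<open>x * b\<close> give
  \<open>(norm b) ^ 3 \<le> f (star (x * b) * (x * b))\<close>, and
  \<open>norm b = (norm x)\<^sup>2\<close>.\<close>

lemma norming_state:
  fixes x :: "'a::cstar_algebra"
  assumes "x \<noteq> 0"
  obtains f where "positive_functional f" "0 < f (star (star x * x) * (star x * x))"
    "(norm x)\<^sup>2 * f (star (star x * x) * (star x * x)) \<le>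
      f (star (x * (star x * x)) * (x * (star x * x)))"
proof -
  let ?b = "star x * x"
  have b: "?b \<noteq> 0" using assms by (simp add: star_mult_self_eq_0_iff)
  have sb: "star ?b = ?b" by (simp add: star_mult star_star)
  obtain f where f: "positive_functional f" "\<And>x. f x \<le> norm x" "f (star ?b * ?b) = (norm ?b)\<^sup>2"
    using exists_state[OF b] by metis
  let ?n = "norm ?b"
  have n: "0 < ?n" using b by simp
  have "?n ^ 4 = (f (star x * (x * ?b)))\<^sup>2"
    using f(3) by (simp add: sb mult.assoc power_mult[symmetric])
  also have "\<dots> \<le> f (star (x * ?b) * (x * ?b)) * f ?b"
    by (rule positive_functional_cauchy_schwarz[OF f(1)])
  also have "\<dots> \<le> f (star (x * ?b) * (x * ?b)) * ?n"
    using f(1) f(2)[of ?b] by (intro mult_left_mono) (simp_all only: positive_functional_def)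
  finally have "?n\<^sup>2 * ?n * ?n \<le> f (star (x * ?b) * (x * ?b)) * ?n"
    by (simp only: power4_eq_xxxx power2_eq_square mult.assoc)
  then have "?n\<^sup>2 * ?n \<le> f (star (x * ?b) * (x * ?b))" using n by simp
  then show thesis
    using f n by (intro that[of f]) (simp_all add: norm_star_mult_self)
qed

text \<open>Pull back a state of the target that norms \<open>\<phi> x\<close>. The pulled-back
  functional is positive on the source, where left multiplication by \<open>x\<close> costs at most
  \<open>(norm x)\<^sup>2\<close>.\<close>

theorem star_hom_contractive:
  fixes \<phi> :: "'a::cstar_algebra \<Rightarrow> 'b::cstar_algebra"
  assumes \<phi>: "star_hom \<phi>"
  shows "norm (\<phi> x) \<le> norm x"
proof (cases "\<phi> x = 0")
  case False
  have hom: "\<phi> (x + y) = \<phi> x + \<phi> y" "\<phi> (c *\<^sub>C x) = c *\<^sub>C \<phi> x" "\<phi> (x * y) = \<phi> x * \<phi> y"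
    "\<phi> (star x) = star (\<phi> x)" for x y c
    using \<phi> by (auto simp: star_hom_def)
  let ?b = "star (\<phi> x) * \<phi> x"
  obtain f where f: "positive_functional f" "0 < f (star ?b * ?b)"
    "(norm (\<phi> x))\<^sup>2 * f (star ?b * ?b) \<le> f (star (\<phi> x * ?b) * (\<phi> x * ?b))"
    by (rule norming_state[OF False])
  have lin: "linear f" using f(1) by (simp add: positive_functional_def)
  have homR: "\<phi> (r *\<^sub>R x) = r *\<^sub>R \<phi> x" for r x
    by (simp only: scaleR_scaleC hom)
  have "linear (\<lambda>a. f (\<phi> a))"
    by (rule linearI) (simp_all only: hom homR linear_add[OF lin] linear_cmul[OF lin] real_scaleR_def)
  then have "positive_functional (\<lambda>a. f (\<phi> a))"
    using f(1) unfolding positive_functional_def hom by blast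
  from positive_functional_mult_le[OF this, of x "star x * x"]
  have "f (star (\<phi> x * ?b) * (\<phi> x * ?b)) \<le> (norm x)\<^sup>2 * f (star ?b * ?b)" by (simp add: hom)
  with f(3) have "(norm (\<phi> x))\<^sup>2 * f (star ?b * ?b) \<le> (norm x)\<^sup>2 * f (star ?b * ?b)" by simp
  with f(2) have "(norm (\<phi> x))\<^sup>2 \<le> (norm x)\<^sup>2" by simp
  then show ?thesis by (rule power2_le_imp_le) simp
qed simp

section \<open>Words and degrees in the free *-algebra\<close>

lemma star_homD:
  assumes "star_hom \<phi>"
  shows "\<phi> (x + y) = \<phi> x + \<phi> y" "\<phi> (c *\<^sub>C x) = c *\<^sub>C \<phi> x" "\<phi> (x * y) = \<phi> x * \<phi> y"
    "\<phi> (star x) = star (\<phi> x)"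
  using assms by (auto simp: star_hom_def)

lemma star_hom_0: "star_hom \<phi> \<Longrightarrow> \<phi> 0 = 0"
  using star_homD(1)[of \<phi> 0 0] by simp

lemma star_hom_minus: "star_hom \<phi> \<Longrightarrow> \<phi> (- x) = - \<phi> x"
  using star_homD(1)[of \<phi> x "- x"] star_hom_0[of \<phi>] by (simp add: eq_neg_iff_add_eq_0 add.commute)

lemma star_hom_diff: "star_hom \<phi> \<Longrightarrow> \<phi> (x - y) = \<phi> x - \<phi> y"
  using star_homD(1)[of \<phi> x "- y"] star_hom_minus[of \<phi> y] by simp

lemma star_hom_sum: "star_hom \<phi> \<Longrightarrow> \<phi> (sum f A) = (\<Sum>i\<in>A. \<phi> (f i))"
  by (induction A rule: infinite_finite_induct) (simp_all add: star_hom_0 star_homD)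

lemmas coeff_simps [simp] = zero_free_algebra.rep_eq plus_free_algebra.rep_eq
  minus_free_algebra.rep_eq uminus_free_algebra.rep_eq scaleC_free_algebra.rep_eq
  star_free_algebra.rep_eq

lemma coeff_sum: "coeff (sum f A) w = (\<Sum>i\<in>A. coeff (f i) w)"
  by (induction A rule: infinite_finite_induct) simp_all

lemma coeff_Nil [simp]: "coeff x [] = 0"
  using coeff[of x] by simp

definition support :: "'g free_algebra \<Rightarrow> 'g letter list set" where
  "support x = {w. coeff x w \<noteq> 0}"

lemma finite_support [simp]: "finite (support x)"
  using coeff[of x] by (simp add: support_def)

lemma Nil_notin_support [simp]: "[] \<notin> support x"
  by (simp add: support_def)

lemma support_mult: "support (x * y) \<subseteq> {u @ v | u v. u \<in> support x \<and> v \<in> support y}"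
proof
  fix w assume "w \<in> support (x * y)"
  then obtain i where "coeff x (take i w) * coeff y (drop i w) \<noteq> 0"
    unfolding support_def times_free_algebra.rep_eq conv_def
    by (auto elim: sum.not_neutral_contains_not_neutral)
  then show "w \<in> {u @ v | u v. u \<in> support x \<and> v \<in> support y}"
    by (intro CollectI exI[of _ "take i w"] exI[of _ "drop i w"]) (auto simp: support_def)
qed

text \<open>The coefficient of the empty word must be 0, so \<open>single []\<close> is the zero
  element; hence the later restrictions to nonempty words.\<close>

lift_definition single :: "'g letter list \<Rightarrow> 'g free_algebra" is
  "\<lambda>w v. if w \<noteq> [] \<and> v = w then 1 else 0"
  by auto

lemma single_inj: "w \<noteq> [] \<Longrightarrow> single w = single v \<Longrightarrow> w = v"
  by (metis single.rep_eq zero_neq_one)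

lemma free_algebra_expansion: "x = (\<Sum>w\<in>support x. coeff x w *\<^sub>C single w)"
proof (rule coeff_eqI)
  fix v
  have "coeff (\<Sum>w\<in>support x. coeff x w *\<^sub>C single w) v =
      (\<Sum>w\<in>support x. if v = w then coeff x w else 0)"
    unfolding coeff_sum by (rule sum.cong) (auto simp: single.rep_eq)
  also have "\<dots> = (if v \<in> support x then coeff x v else 0)" by (rule sum.delta'[OF finite_support])
  also have "\<dots> = coeff x v" by (simp add: support_def)
  finally show "coeff x v = coeff (\<Sum>w\<in>support x. coeff x w *\<^sub>C single w) v" ..
qed

lemma single_append:
  assumes "u \<noteq> []" "v \<noteq> []"
  shows "single (u @ v) = single u * single v"
proof (rule coeff_eqI)
  fix w
  have "coeff (single u * single v) w =
      (\<Sum>i\<le>length w. if i = length u \<and> w = u @ v then 1 else 0)"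
    unfolding times_free_algebra.rep_eq conv_def
    by (rule sum.cong) (use assms in \<open>auto simp: single.rep_eq\<close>)
  also have "\<dots> = (if w = u @ v then 1 else 0)"
    by (cases "w = u @ v") (simp_all add: sum.delta)
  also have "\<dots> = coeff (single (u @ v)) w" using assms by (simp add: single.rep_eq)
  finally show "coeff (single (u @ v)) w = coeff (single u * single v) w" ..
qed

lemma single_Plain: "single [Plain g] = gen g"
  by transfer auto

lemma single_Starred: "single [Starred g] = star (gen g)"
proof (rule coeff_eqI)
  fix w
  have "word_star w = [Plain g] \<longleftrightarrow> w = word_star [Plain g]" by (metis word_star_word_star)
  then show "coeff (single [Starred g]) w = coeff (star (gen g)) w"
    by (simp add: single.rep_eq gen.rep_eq) (simp add: word_star_def)
qed

lemma single_in_free_words: "w \<noteq> [] \<Longrightarrow> single w \<in> free_words"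
proof (induction w rule: rev_nonempty_induct)
  case (single l)
  show ?case
    unfolding free_words_def by (cases l) (auto simp: single_Plain single_Starred intro: products.base)
next
  case (snoc l w)
  have "single [l] \<in> range gen \<union> star ` range gen"
    by (cases l) (auto simp: single_Plain single_Starred)
  with snoc show ?case
    unfolding free_words_def by (auto simp: single_append intro: products.step)
qed

section \<open>The grading by degree\<close>

text \<open>\<open>T\<close> stands for the generators that the circle action multiplies by
  \<open>z\<close>. The degree is then the exponent of \<open>z\<close> in the action on the image
  of a word.\<close>

primrec letter_degree :: "'g set \<Rightarrow> 'g letter \<Rightarrow> int" where
  "letter_degree T (Plain g) = (if g \<in> T then 1 else 0)"
| "letter_degree T (Starred g) = (if g \<in> T then - 1 else 0)"

definition word_degree :: "'g set \<Rightarrow> 'g letter list \<Rightarrow> int" where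
  "word_degree T w = (\<Sum>l\<leftarrow>w. letter_degree T l)"

lemma word_degree_append: "word_degree T (u @ v) = word_degree T u + word_degree T v"
  by (simp add: word_degree_def)

lemma letter_degree_flip: "letter_degree T (flip l) = - letter_degree T l"
  by (cases l) auto

lemma word_degree_star: "word_degree T (word_star w) = - word_degree T w"
  by (induction w) (simp_all add: word_star_def word_degree_def letter_degree_flip)

lemma abs_word_degree_le: "\<bar>word_degree T w\<bar> \<le> int (length w)"
proof (induction w)
  case (Cons l w)
  have "\<bar>letter_degree T l\<bar> \<le> 1" by (cases l) auto
  with Cons show ?case by (simp add: word_degree_def)
qed (simp add: word_degree_def)

definition homogeneous :: "'g set \<Rightarrow> int \<Rightarrow> 'g free_algebra \<Rightarrow> bool" where
  "homogeneous T n x \<longleftrightarrow> (\<forall>w\<in>support x. word_degree T w = n)"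

lemma homogeneous_mult: "homogeneous T m x \<Longrightarrow> homogeneous T n y \<Longrightarrow> homogeneous T (m + n) (x * y)"
  unfolding homogeneous_def using support_mult[of x y] by (fastforce simp: word_degree_append)

lemma homogeneous_star: "homogeneous T n x \<Longrightarrow> homogeneous T (- n) (star x)"
  unfolding homogeneous_def support_def by (force simp: word_degree_star dest: spec[of _ "word_star _"])

lemma homogeneous_add: "homogeneous T n x \<Longrightarrow> homogeneous T n y \<Longrightarrow> homogeneous T n (x + y)"
  unfolding homogeneous_def support_def by fastforce

lemma homogeneous_scaleC: "homogeneous T n x \<Longrightarrow> homogeneous T n (c *\<^sub>C x)"
  unfolding homogeneous_def support_def by auto

lemma homogeneous_0: "homogeneous T n 0"
  by (simp add: homogeneous_def support_def)

lift_definition homogeneous_part :: "'g set \<Rightarrow> int \<Rightarrow> 'g free_algebra \<Rightarrow> 'g free_algebra" is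
  "\<lambda>T n f w. if word_degree T w = n then f w else 0"
proof -
  fix T :: "'g set" and n and f :: "'g letter list \<Rightarrow> complex"
  assume f: "finite {w. f w \<noteq> 0} \<and> f [] = 0"
  then show "finite {w. (if word_degree T w = n then f w else 0) \<noteq> 0} \<and>
      (if word_degree T [] = n then f [] else 0) = 0"
    by (auto elim: rev_finite_subset)
qed

lemma homogeneous_homogeneous_part: "homogeneous T n (homogeneous_part T n x)"
  by (simp add: homogeneous_def support_def homogeneous_part.rep_eq)

text \<open>Length is used to bound the number of degrees that occur. It at most doubles under
  \<open>star x * x\<close>, the same rate at which the exponents grow.\<close>

definition max_length_le :: "nat \<Rightarrow> 'g free_algebra \<Rightarrow> bool" where
  "max_length_le L x \<longleftrightarrow> (\<forall>w\<in>support x. length w \<le> L)"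

lemma max_length_le_exists: "\<exists>L. max_length_le L x"
  unfolding max_length_le_def using finite_support[of x]
  by (intro exI[of _ "Max (length ` support x)"]) auto

lemma max_length_le_star_mult: "max_length_le L x \<Longrightarrow> max_length_le (2 * L) (star x * x)"
proof -
  assume x: "max_length_le L x"
  then have "max_length_le L (star x)"
    unfolding max_length_le_def support_def by (force dest: spec[of _ "word_star _"])
  with x show ?thesis
    unfolding max_length_le_def using support_mult[of "star x" x] by fastforce
qed

lemma homogeneous_part_sum:
  assumes "max_length_le L x"
  shows "x = (\<Sum>n\<in>{- int L..int L}. homogeneous_part T n x)"
proof (rule coeff_eqI)
  fix w
  have "coeff (\<Sum>n\<in>{- int L..int L}. homogeneous_part T n x) w =
      (\<Sum>n\<in>{- int L..int L}. if word_degree T w = n then coeff x w else 0)"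
    by (simp add: coeff_sum homogeneous_part.rep_eq)
  also have "\<dots> = (if word_degree T w \<in> {- int L..int L} then coeff x w else 0)"
    by (rule sum.delta') simp
  also have "\<dots> = coeff x w"
    using assms abs_word_degree_le[of T w] by (auto simp: max_length_le_def support_def)
  finally show "coeff x w = coeff (\<Sum>n\<in>{- int L..int L}. homogeneous_part T n x) w" ..
qed

section \<open>Seminorms on finite-dimensional images\<close>

text \<open>On the compact unit sphere of the coordinate space the norm of the combination attains
  its minimum, which is positive by independence. \<open>C\<close> is the reciprocal of this
  minimum.\<close>

lemma independent_coordinates_bounded:
  fixes S :: "'a::cstar_algebra set"
  assumes fin: "finite S" and ind: "complex_vector.independent S"
  obtains C where "0 \<le> C" "\<And>c. (\<Sum>e\<in>S. cmod (c e)) \<le> C * norm (\<Sum>e\<in>S. c e *\<^sub>C e)"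
proof -
  \<comment> \<open>Coordinates outside \<open>S\<close> are pinned to 0, so that the set lies in a
    product of compact sets over the whole type and Tychonoff's theorem applies.\<close>
  define Z where "Z = {c :: 'a \<Rightarrow> complex. \<forall>e. c e \<in> (if e \<in> S then cball 0 1 else {0})}
      \<inter> {c. (\<Sum>e\<in>S. cmod (c e)) = 1}"
  define N where "N c = norm (\<Sum>e\<in>S. c e *\<^sub>C e)" for c :: "'a \<Rightarrow> complex"
  have "compactin (product_topology (\<lambda>_. euclidean) UNIV)
      (PiE UNIV (\<lambda>e::'a. if e \<in> S then cball 0 1 else {0::complex}))"
    unfolding compactin_PiE by (auto simp: compactin_euclidean_iff)
  then have "compact {c :: 'a \<Rightarrow> complex. \<forall>e. c e \<in> (if e \<in> S then cball 0 1 else {0})}"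
    by (simp add: euclidean_product_topology compactin_euclidean_iff PiE_UNIV_domain Pi_def)
  moreover have cont: "continuous_on UNIV (\<lambda>c :: 'a \<Rightarrow> complex. c e)" for e
    by (rule continuous_on_product_coordinates)
  then have "closed {c :: 'a \<Rightarrow> complex. (\<Sum>e\<in>S. cmod (c e)) = 1}"
    by (intro closed_Collect_eq continuous_intros)
  ultimately have Z: "compact Z" unfolding Z_def by (rule compact_Int_closed)
  have bl: "bounded_linear (\<lambda>a. a *\<^sub>C e)" for e :: 'a
    by (rule bounded_linear_intro[of _ "norm e"])
      (simp_all add: scaleC_add_left scaleR_scaleC scaleC_scaleC norm_scaleC scaleR_conv_of_real)
  have N: "continuous_on Z N"
    unfolding N_def
    by (intro continuous_intros bounded_linear.continuous_on[OF bl] continuous_on_subset[OF cont]) simp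
  have scale: "N (\<lambda>e. a * c e) = cmod a * N c" for a c
    unfolding N_def by (simp add: norm_scaleC[symmetric] complex_vector.scale_sum_right scaleC_scaleC)
  have normalized: "(\<lambda>e. if e \<in> S then complex_of_real (1 / s) * c e else 0) \<in> Z"
    if s: "s = (\<Sum>e\<in>S. cmod (c e))" "s \<noteq> 0" for s and c :: "'a \<Rightarrow> complex"
  proof -
    have pos: "0 < s" using s sum_nonneg[of S "\<lambda>e. cmod (c e)"] by simp
    have "cmod (c e) \<le> s" if "e \<in> S" for e
      unfolding s(1) by (rule member_le_sum[OF that]) (auto simp: fin)
    moreover have "(\<Sum>e\<in>S. cmod (if e \<in> S then complex_of_real (1 / s) * c e else 0)) =
        (\<Sum>e\<in>S. 1 / s * cmod (c e))"
      using pos by (intro sum.cong) (simp_all add: norm_mult norm_divide)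
    then have "(\<Sum>e\<in>S. cmod (if e \<in> S then complex_of_real (1 / s) * c e else 0)) = 1"
      using pos by (simp add: sum_divide_distrib[symmetric] s(1)[symmetric])
    ultimately show ?thesis using pos by (auto simp: Z_def norm_mult norm_divide divide_le_eq)
  qed
  show thesis
  \<comment> \<open>The sphere is empty exactly when \<open>S\<close> is empty; then
    \<open>C = 0\<close> will do.\<close>
  proof (cases "Z = {}")
    case True
    then have "(\<Sum>e\<in>S. cmod (c e)) = 0" for c using normalized[OF refl] by blast
    then show thesis by (intro that[of 0]) simp_all
  next
    case False
    then obtain c0 where c0: "c0 \<in> Z" "\<And>c. c \<in> Z \<Longrightarrow> N c0 \<le> N c"
      using continuous_attains_inf[OF Z _ N] by blast
    have "N c0 \<noteq> 0"
    proof
      assume "N c0 = 0"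
      then have "\<forall>e\<in>S. c0 e = 0"
        using ind fin by (auto simp: N_def complex_vector.independent_explicit_finite_subsets)
      then show False using c0(1) by (simp add: Z_def)
    qed
    then have N0: "0 < N c0" by (simp add: N_def)
    have "(\<Sum>e\<in>S. cmod (c e)) \<le> (1 / N c0) * N c" for c
    proof (cases "(\<Sum>e\<in>S. cmod (c e)) = 0")
      case False
      define s where "s = (\<Sum>e\<in>S. cmod (c e))"
      have s: "0 < s" using False sum_nonneg[of S "\<lambda>e. cmod (c e)"] by (simp add: s_def)
      from c0(2)[OF normalized[OF s_def False[folded s_def]]]
      have "N c0 \<le> N (\<lambda>e. if e \<in> S then complex_of_real (1 / s) * c e else 0)" .
      also have "\<dots> = N (\<lambda>e. complex_of_real (1 / s) * c e)"
        unfolding N_def by (intro arg_cong[where f = norm] sum.cong) auto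
      also have "\<dots> = N c / s" using s by (simp only: scale) (simp add: norm_divide)
      finally show ?thesis using s N0 by (simp add: field_simps s_def[symmetric])
    qed (use N0 in \<open>simp add: N_def\<close>)
    then show thesis using N0 by (intro that[of "1 / N c0"]) (simp_all add: N_def)
  qed
qed

definition seminorm :: "('b::complex_star_algebra \<Rightarrow> real) \<Rightarrow> bool" where
  "seminorm p \<longleftrightarrow> (\<forall>x. 0 \<le> p x) \<and> (\<forall>x y. p (x + y) \<le> p x + p y) \<and> (\<forall>c x. p (c *\<^sub>C x) \<le> cmod c * p x)"

lemma seminormD:
  assumes "seminorm p"
  shows "0 \<le> p x" "p (x + y) \<le> p x + p y" "p (c *\<^sub>C x) \<le> cmod c * p x"
  using assms by (auto simp: seminorm_def)

lemma seminorm_0: "seminorm p \<Longrightarrow> p 0 = 0"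
  using seminormD(1)[of p 0] seminormD(3)[of p 0 0] by simp

lemma seminorm_sum: "seminorm p \<Longrightarrow> p (sum f A) \<le> (\<Sum>i\<in>A. p (f i))"
proof (induction A rule: infinite_finite_induct)
  case (insert i A)
  then show ?case using seminormD(2)[of p "f i" "sum f A"] by simp
qed (simp_all add: seminorm_0)

text \<open>By \<open>zero\<close>, \<open>p\<close> on \<open>B\<close> depends only on the image
  under \<open>h\<close>. Preimages of a basis of that image turn the coordinate bound into a bound
  for \<open>p\<close>.\<close>

lemma finite_dimensional_seminorm_bound:
  fixes h :: "'b::complex_star_algebra \<Rightarrow> 'a::cstar_algebra"
  assumes h: "star_hom h" and p: "seminorm p" and B: "complex_vector.subspace B"
    and fd: "finite_dimensional (h ` B)"
    and zero: "\<And>z. z \<in> B \<Longrightarrow> h z = 0 \<Longrightarrow> p z = 0"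
  obtains C where "0 \<le> C" "\<And>z. z \<in> B \<Longrightarrow> p z \<le> C * norm (h z)"
proof -
  obtain F where F: "finite F" "h ` B \<subseteq> complex_vector.span F"
    using fd by (auto simp: finite_dimensional_def)
  obtain S where S: "S \<subseteq> h ` B" "complex_vector.independent S" "h ` B \<subseteq> complex_vector.span S"
    using complex_vector.maximal_independent_subset[of "h ` B"] by blast
  have fin: "finite S"
    using complex_vector.independent_span_bound[OF F(1) S(2)] S(1) F(2) by blast
  obtain C where C: "0 \<le> C" "\<And>c. (\<Sum>e\<in>S. cmod (c e)) \<le> C * norm (\<Sum>e\<in>S. c e *\<^sub>C e)"
    using independent_coordinates_bounded[OF fin S(2)] by metis
  from S(1) obtain b where b: "\<And>e. e \<in> S \<Longrightarrow> b e \<in> B \<and> h (b e) = e"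
    by (metis image_iff subsetD)
  define P where "P = (\<Sum>e\<in>S. p (b e))"
  have Pe: "p (b e) \<le> P" if "e \<in> S" for e
    unfolding P_def by (rule member_le_sum[OF that]) (auto simp: fin seminormD[OF p])
  have P: "0 \<le> P" unfolding P_def by (simp add: sum_nonneg seminormD[OF p])
  have "p z \<le> P * C * norm (h z)" if z: "z \<in> B" for z
  proof -
    have "h z \<in> complex_vector.span S" using S(3) z by blast
    then obtain c where c: "h z = (\<Sum>e\<in>S. c e *\<^sub>C e)"
      using complex_vector.span_finite[OF fin] by auto
    define z' where "z' = (\<Sum>e\<in>S. c e *\<^sub>C b e)"
    have z': "z' \<in> B"
      unfolding z'_def using b B
      by (intro complex_vector.subspace_sum complex_vector.subspace_scale) auto
    have "h z' = h z"
      unfolding z'_def c star_hom_sum[OF h] using b by (intro sum.cong) (auto simp: star_homD[OF h])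
    then have "p (z - z') = 0"
      using z z' B by (intro zero) (auto simp: star_hom_diff[OF h] complex_vector.subspace_diff)
    then have "p z \<le> p z'" using seminormD(2)[OF p, of "z - z'" z'] by simp
    also have "\<dots> \<le> (\<Sum>e\<in>S. cmod (c e) * P)"
      unfolding z'_def
    proof (rule order_trans[OF seminorm_sum[OF p]], rule sum_mono)
      fix e assume "e \<in> S"
      then show "p (c e *\<^sub>C b e) \<le> cmod (c e) * P"
        using seminormD(3)[OF p, of "c e" "b e"] mult_left_mono[OF Pe, of e "cmod (c e)"] by simp
    qed
    also have "\<dots> = P * (\<Sum>e\<in>S. cmod (c e))" by (simp add: sum_distrib_right mult.commute sum_distrib_left)
    also have "\<dots> \<le> P * (C * norm (h z))" using C(2)[of c] P by (intro mult_left_mono) (simp_all add: c)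
    finally show ?thesis by (simp add: mult.assoc)
  qed
  with C(1) P show thesis by (intro that[of "P * C"]) simp_all
qed

section \<open>C*-seminorms below the norm of A\<close>

text \<open>For \<open>m \<noteq> 0\<close> this is a geometric sum with ratio \<zeta>, where
  \<open>\<zeta> ^ K = 1\<close>. The bound on \<open>m\<close> excludes \<open>\<zeta> = 1\<close>,
  which would make \<open>K\<close> divide \<open>m\<close>.\<close>

lemma sum_powers_root_of_unity:
  fixes m :: int and K :: nat
  assumes "0 < K" "\<bar>m\<bar> < int K"
  shows "(\<Sum>k<K. (cis (2 * pi * real k / real K)) powi m) = (if m = 0 then of_nat K else 0)"
proof (cases "m = 0")
  case False
  define \<zeta> where "\<zeta> = cis (2 * pi * real_of_int m / real K)"
  have pw: "\<zeta> ^ k = (cis (2 * pi * real k / real K)) powi m" for k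
    by (simp add: \<zeta>_def cis_power_int Complex.DeMoivre mult_ac)
  have "\<zeta> ^ K = cis (2 * pi * real_of_int m)"
    using assms(1) by (simp add: \<zeta>_def Complex.DeMoivre)
  then have one: "\<zeta> ^ K = 1" by simp
  have "\<zeta> \<noteq> 1"
  proof
    assume "\<zeta> = 1"
    then obtain n :: int where "2 * pi * real_of_int m / real K = of_int (2 * n) * pi"
      by (auto simp: \<zeta>_def cis_conv_exp exp_eq_1)
    then have "real_of_int m = of_int n * real K"
      using assms(1) by (simp add: field_simps)
    then have "m = n * int K" by (metis of_int_eq_iff of_int_mult of_int_of_nat_eq)
    moreover have "n \<noteq> 0" using False calculation by auto
    then have "1 \<le> \<bar>n\<bar>" by simp
    then have "int K \<le> \<bar>n\<bar> * int K" using mult_right_mono[of 1 "\<bar>n\<bar>" "int K"] by simp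
    ultimately show False using assms(2) by (simp add: abs_mult)
  qed
  then show ?thesis
    using False geometric_sum[of \<zeta> K] by (simp add: one pw)
qed simp

text \<open>A constant or polynomial factor is removed by passing to high powers.\<close>

lemma le_if_power_le_polynomial:
  fixes a b :: real
  assumes ab: "0 \<le> a" "0 \<le> b" and le: "\<And>k. a ^ 2 ^ k \<le> (C * 2 ^ k + D) * b ^ 2 ^ k"
  shows "a \<le> b"
proof (rule ccontr)
  assume "\<not> a \<le> b"
  then have ba: "b < a" by simp
  \<comment> \<open>For \<open>b = 0\<close> the hypothesis at \<open>k = 0\<close> already says
    \<open>a \<le> 0\<close>.\<close>
  have "0 < b"
  proof (rule ccontr)
    assume "\<not> 0 < b"
    with ab have "b = 0" by simp
    with le[of 0] ba show False by simp
  qed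
  define r where "r = a / b"
  have r: "1 < r" using ba \<open>0 < b\<close> by (simp add: r_def)
  have "(\<lambda>n. C * (of_nat n / r ^ n) + D / r ^ n) \<longlonglongrightarrow> C * 0 + 0"
    using r by (intro tendsto_intros lim_n_over_pown LIMSEQ_divide_realpow_zero) auto
  then have "(\<lambda>n. C * (of_nat n / r ^ n) + D / r ^ n) \<longlonglongrightarrow> 0" by simp
  from LIMSEQ_D[OF this, of 1]
  obtain M where M: "\<And>n. M \<le> n \<Longrightarrow> \<bar>C * (of_nat n / r ^ n) + D / r ^ n\<bar> < 1"
    by auto
  \<comment> \<open>The hypothesis concerns exponents that are powers of two, so the limit is read
    along \<open>n = 2 ^ M\<close>.\<close>
  have "M \<le> 2 ^ M" using less_exp[of M] by simp
  note M[OF this]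
  moreover have "r ^ 2 ^ M * b ^ 2 ^ M = a ^ 2 ^ M"
    using \<open>0 < b\<close> by (simp add: r_def power_divide)
  then have "r ^ 2 ^ M * b ^ 2 ^ M \<le> (C * 2 ^ M + D) * b ^ 2 ^ M" using le[of M] by simp
  then have "r ^ 2 ^ M \<le> C * 2 ^ M + D"
    by (rule mult_right_le_imp_le) (simp add: \<open>0 < b\<close>)
  then have "1 \<le> C * (2 ^ M / r ^ 2 ^ M) + D / r ^ 2 ^ M"
    using r by (simp add: field_simps)
  ultimately show False by simp
qed

text \<open>Under the C*-norm of the image each step squares exactly. Under \<open>p\<close> it
  squares at least, which is the direction needed for comparing the two.\<close>

primrec square_iterate :: "'b::complex_star_algebra \<Rightarrow> nat \<Rightarrow> 'b" where
  "square_iterate x 0 = x"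
| "square_iterate x (Suc k) = star (square_iterate x k) * square_iterate x k"

lemma norm_square_iterate:
  assumes "star_hom \<Phi>"
  shows "norm (\<Phi> (square_iterate x k) :: 'a::cstar_algebra) = norm (\<Phi> x) ^ 2 ^ k"
  by (induction k) (simp_all add: star_homD[OF assms] norm_star_mult_self power_mult[symmetric] mult.commute)

lemma seminorm_square_iterate:
  assumes p: "\<And>x. 0 \<le> p x" "\<And>x. (p x)\<^sup>2 \<le> (p (star x * x) :: real)"
  shows "p x ^ 2 ^ k \<le> p (square_iterate x k)"
proof (induction k)
  case (Suc k)
  have "p x ^ 2 ^ Suc k = (p x ^ 2 ^ k)\<^sup>2" by (simp add: power_mult[symmetric] mult.commute)
  also have "\<dots> \<le> (p (square_iterate x k))\<^sup>2" using Suc p(1) by (intro power_mono) simp_all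
  also have "\<dots> \<le> p (square_iterate x (Suc k))" using p(2) by simp
  finally show ?case .
qed simp

section \<open>The circle action on homogeneous elements\<close>

locale graded_star_hom =
  fixes \<Phi> :: "'g free_algebra \<Rightarrow> 'a::cstar_algebra"
    and \<gamma> :: "complex \<Rightarrow> 'a \<Rightarrow> 'a" and T :: "'g set"
  assumes star_hom: "star_hom \<Phi>"
    and star_hom_action: "z \<in> sphere 0 1 \<Longrightarrow> star_hom (\<gamma> z)"
    and action_gen: "z \<in> sphere 0 1 \<Longrightarrow>
      \<gamma> z (\<Phi> (gen g)) = (if g \<in> T then z *\<^sub>C \<Phi> (gen g) else \<Phi> (gen g))"
begin

lemma action_letter:
  assumes z: "z \<in> sphere 0 1"
  shows "\<gamma> z (\<Phi> (single [l])) = (z powi letter_degree T l) *\<^sub>C \<Phi> (single [l])"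
proof -
  have "z * cnj z = 1" using z complex_norm_square[of z] by simp
  then have "inverse z = cnj z" by (rule inverse_unique)
  then show ?thesis
    by (cases l) (simp_all add: single_Plain single_Starred star_homD[OF star_hom] action_gen[OF z]
        star_homD(4)[OF star_hom_action[OF z]] star_scaleC power_int_minus scaleC_one)
qed

lemma action_single:
  assumes z: "z \<in> sphere 0 1" and w: "w \<noteq> []"
  shows "\<gamma> z (\<Phi> (single w)) = (z powi word_degree T w) *\<^sub>C \<Phi> (single w)"
  using w
proof (induction w rule: rev_nonempty_induct)
  case (single l)
  then show ?case using action_letter[OF z, of l] by (simp add: word_degree_def)
next
  case (snoc l w)
  have "z \<noteq> 0" using z by auto
  then have "z powi word_degree T (w @ [l]) = z powi word_degree T w * z powi letter_degree T l"
    by (simp add: word_degree_append power_int_add) (simp add: word_degree_def)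
  with snoc show ?case
    by (simp add: single_append star_homD[OF star_hom] star_homD(3)[OF star_hom_action[OF z]]
        action_letter[OF z] mult_scaleC_left mult_scaleC_right scaleC_scaleC mult.commute)
qed

lemma action_homogeneous:
  assumes z: "z \<in> sphere 0 1" and x: "homogeneous T n x"
  shows "\<gamma> z (\<Phi> x) = (z powi n) *\<^sub>C \<Phi> x"
proof -
  note \<gamma> = star_hom_action[OF z]
  have \<Phi>x: "\<Phi> x = (\<Sum>w\<in>support x. coeff x w *\<^sub>C \<Phi> (single w))"
    by (subst free_algebra_expansion[of x]) (simp add: star_hom_sum[OF star_hom] star_homD[OF star_hom])
  have "\<gamma> z (\<Phi> x) = (\<Sum>w\<in>support x. (z powi n) *\<^sub>C coeff x w *\<^sub>C \<Phi> (single w))"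
    unfolding \<Phi>x star_hom_sum[OF \<gamma>]
  proof (rule sum.cong[OF refl])
    fix w assume w: "w \<in> support x"
    then have "w \<noteq> []" "word_degree T w = n" using x by (auto simp: homogeneous_def)
    then show "\<gamma> z (coeff x w *\<^sub>C \<Phi> (single w)) = (z powi n) *\<^sub>C coeff x w *\<^sub>C \<Phi> (single w)"
      by (simp add: star_homD[OF \<gamma>] action_single[OF z] scaleC_scaleC mult.commute)
  qed
  then show ?thesis by (simp add: \<Phi>x complex_vector.scale_sum_right)
qed

text \<open>The homogeneous part of degree \<open>n\<close> is an average of \<open>z\<^sup>-\<^sup>n \<gamma>\<^sub>z\<close> over roots of unity.\<close>

lemma norm_homogeneous_part_le: "norm (\<Phi> (homogeneous_part T n x)) \<le> norm (\<Phi> x)"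
proof -
  obtain L where L: "max_length_le L x" using max_length_le_exists by blast
  \<comment> \<open>Degrees between \<open>- L\<close> and \<open>L\<close> differ by at most
    \<open>2 * L\<close>, so this many roots of unity separate them.\<close>
  define K where "K = 2 * L + 1"
  define \<omega> where "\<omega> k = cis (2 * pi * real k / real K)" for k
  have \<omega>: "\<omega> k \<in> sphere 0 1" "\<omega> k \<noteq> 0" for k by (simp_all add: \<omega>_def)
  have \<Phi>x: "\<Phi> x = (\<Sum>m\<in>{- int L..int L}. \<Phi> (homogeneous_part T m x))"
    by (subst homogeneous_part_sum[OF L, of T]) (rule star_hom_sum[OF star_hom])
  show ?thesis
  proof (cases "n \<in> {- int L..int L}")
    case True
    have "(\<Sum>k<K. (\<omega> k powi (- n)) *\<^sub>C \<gamma> (\<omega> k) (\<Phi> x)) =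
        (\<Sum>k<K. \<Sum>m\<in>{- int L..int L}. (\<omega> k powi (m - n)) *\<^sub>C \<Phi> (homogeneous_part T m x))"
    proof (rule sum.cong[OF refl])
      fix k
      show "(\<omega> k powi (- n)) *\<^sub>C \<gamma> (\<omega> k) (\<Phi> x) =
          (\<Sum>m\<in>{- int L..int L}. (\<omega> k powi (m - n)) *\<^sub>C \<Phi> (homogeneous_part T m x))"
        unfolding \<Phi>x star_hom_sum[OF star_hom_action[OF \<omega>(1)]] complex_vector.scale_sum_right
        using \<omega>(2)[of k]
        by (intro sum.cong refl)
          (simp add: action_homogeneous[OF \<omega>(1) homogeneous_homogeneous_part] scaleC_scaleC
            power_int_add[symmetric])
    qed
    also have "\<dots> = (\<Sum>m\<in>{- int L..int L}. \<Sum>k<K. (\<omega> k powi (m - n)) *\<^sub>C \<Phi> (homogeneous_part T m x))"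
      by (rule sum.swap)
    also have "\<dots> = (\<Sum>m\<in>{- int L..int L}. (if m = n then of_nat K *\<^sub>C \<Phi> (homogeneous_part T m x) else 0))"
    proof (rule sum.cong[OF refl])
      fix m assume m: "m \<in> {- int L..int L}"
      have "(\<Sum>k<K. \<omega> k powi (m - n)) = (if m - n = 0 then of_nat K else 0)"
        unfolding \<omega>_def using m True by (intro sum_powers_root_of_unity) (auto simp: K_def)
      then show "(\<Sum>k<K. (\<omega> k powi (m - n)) *\<^sub>C \<Phi> (homogeneous_part T m x)) =
          (if m = n then of_nat K *\<^sub>C \<Phi> (homogeneous_part T m x) else 0)"
        by (simp add: complex_vector.scale_sum_left[symmetric])
    qed
    also have "\<dots> = of_nat K *\<^sub>C \<Phi> (homogeneous_part T n x)"
      using True by (simp add: sum.delta)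
    finally have "real K * norm (\<Phi> (homogeneous_part T n x)) =
        norm (\<Sum>k<K. (\<omega> k powi (- n)) *\<^sub>C \<gamma> (\<omega> k) (\<Phi> x))"
      by (simp add: norm_scaleC)
    also have "\<dots> \<le> (\<Sum>k<K. norm ((\<omega> k powi (- n)) *\<^sub>C \<gamma> (\<omega> k) (\<Phi> x)))"
      by (rule norm_sum)
    also have "\<dots> \<le> (\<Sum>k<K. norm (\<Phi> x))"
    proof (rule sum_mono)
      fix k
      have "cmod (\<omega> k powi (- n)) = 1" by (simp add: \<omega>_def norm_power_int)
      then show "norm ((\<omega> k powi (- n)) *\<^sub>C \<gamma> (\<omega> k) (\<Phi> x)) \<le> norm (\<Phi> x)"
        using star_hom_contractive[OF star_hom_action[OF \<omega>(1)]] by (simp add: norm_scaleC)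
    qed
    finally show ?thesis by (simp add: K_def)
  next
    case False
    have "homogeneous_part T n x = 0"
    proof (rule coeff_eqI)
      fix w
      show "coeff (homogeneous_part T n x) w = coeff 0 w"
        using False L abs_word_degree_le[of T w]
        by (auto simp: homogeneous_part.rep_eq max_length_le_def support_def)
    qed
    then show ?thesis by (simp add: star_hom_0[OF star_hom])
  qed
qed

section \<open>Comparison of a C*-seminorm with the norm of the image\<close>

context
  fixes p :: "'g free_algebra \<Rightarrow> real"
  assumes finite_dimensional_degree_0: "\<And>W. finite W \<Longrightarrow>
      (\<And>w. w \<in> W \<Longrightarrow> w \<noteq> [] \<and> word_degree T w = 0) \<Longrightarrow>
      finite_dimensional (cstar_generated ((\<lambda>w. \<Phi> (single w)) ` W))"
    and p: "seminorm p" and p_square: "\<And>x. (p x)\<^sup>2 \<le> p (star x * x)"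
    and p_zero: "\<And>x. homogeneous T 0 x \<Longrightarrow> \<Phi> x = 0 \<Longrightarrow> p x = 0"
begin

text \<open>One constant must serve all iterates of \<open>y\<close>. So the finite-dimensional
  bound is applied not to the span of the words of \<open>y\<close> but to all elements of degree 0
  with image in \<open>D\<close>, the C*-algebra generated by the images of these words: this set is
  closed under \<open>z \<mapsto> star z * z\<close>.\<close>

lemma seminorm_le_norm_degree_0:
  assumes y: "homogeneous T 0 y"
  shows "p y \<le> norm (\<Phi> y)"
proof -
  define D where "D = cstar_generated ((\<lambda>w. \<Phi> (single w)) ` support y)"
  have D: "cstar_subalgebra D" unfolding D_def cstar_generated_def
    by (rule hull_in) (auto simp: cstar_subalgebra_def complex_vector.subspace_def)
  have gens: "\<Phi> (single w) \<in> D" if "w \<in> support y" for w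
    unfolding D_def cstar_generated_def using that by (blast intro: hull_inc)
  define B where "B = {z. homogeneous T 0 z \<and> \<Phi> z \<in> D}"
  have B: "complex_vector.subspace B"
    using D unfolding B_def cstar_subalgebra_def
    by (intro complex_vector.subspaceI)
      (auto simp: homogeneous_0 homogeneous_add homogeneous_scaleC star_hom_0[OF star_hom]
        star_homD[OF star_hom] complex_vector.subspace_0 complex_vector.subspace_add
        complex_vector.subspace_scale)
  have "finite_dimensional D"
    unfolding D_def using y by (intro finite_dimensional_degree_0) (auto simp: homogeneous_def)
  then have fd: "finite_dimensional (\<Phi> ` B)"
    unfolding finite_dimensional_def B_def by blast
  obtain C where C: "0 \<le> C" "\<And>z. z \<in> B \<Longrightarrow> p z \<le> C * norm (\<Phi> z)"
    by (rule finite_dimensional_seminorm_bound[OF star_hom p B fd]) (auto simp: B_def p_zero)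
  have "\<Phi> y = (\<Sum>w\<in>support y. coeff y w *\<^sub>C \<Phi> (single w))"
    by (subst free_algebra_expansion[of y]) (simp add: star_hom_sum[OF star_hom] star_homD[OF star_hom])
  then have "\<Phi> y \<in> D"
    using D gens unfolding cstar_subalgebra_def
    by (auto intro!: complex_vector.subspace_sum complex_vector.subspace_scale)
  with y have yB: "y \<in> B" by (simp add: B_def)
  have it: "square_iterate y k \<in> B" for k
  proof (induction k)
    case (Suc k)
    then have "homogeneous T (- 0 + 0) (square_iterate y (Suc k))"
      unfolding square_iterate.simps B_def by (intro homogeneous_mult homogeneous_star) auto
    with Suc D show ?case by (auto simp: B_def cstar_subalgebra_def star_homD[OF star_hom])
  qed (simp add: yB)
  show ?thesis
  proof (rule le_if_power_le_polynomial)
    fix k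
    have "p y ^ 2 ^ k \<le> p (square_iterate y k)"
      by (rule seminorm_square_iterate[of p, OF seminormD(1)[OF p] p_square])
    also have "\<dots> \<le> C * norm (\<Phi> (square_iterate y k))" by (rule C(2)[OF it])
    finally show "p y ^ 2 ^ k \<le> (0 * 2 ^ k + C) * norm (\<Phi> y) ^ 2 ^ k"
      by (simp add: norm_square_iterate[OF star_hom])
  qed (simp_all add: seminormD[OF p])
qed

lemma seminorm_le_norm_homogeneous:
  assumes y: "homogeneous T n y"
  shows "p y \<le> norm (\<Phi> y)"
proof -
  have "homogeneous T (- n + n) (star y * y)" using y by (intro homogeneous_mult homogeneous_star)
  then have "(p y)\<^sup>2 \<le> norm (\<Phi> (star y * y))"
    using p_square[of y] seminorm_le_norm_degree_0[of "star y * y"] by simp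
  then have "(p y)\<^sup>2 \<le> (norm (\<Phi> y))\<^sup>2" by (simp add: star_homD[OF star_hom] norm_star_mult_self)
  then show ?thesis by (rule power2_le_imp_le) simp
qed

lemma seminorm_le_length_norm:
  assumes L: "max_length_le L x"
  shows "p x \<le> (2 * real L + 1) * norm (\<Phi> x)"
proof -
  have "p x \<le> (\<Sum>n\<in>{- int L..int L}. p (homogeneous_part T n x))"
    by (subst homogeneous_part_sum[OF L, of T]) (rule seminorm_sum[OF p])
  also have "\<dots> \<le> (\<Sum>n\<in>{- int L..int L}. norm (\<Phi> x))"
    by (intro sum_mono order_trans[OF seminorm_le_norm_homogeneous[OF homogeneous_homogeneous_part]]
        norm_homogeneous_part_le)
  finally show ?thesis by simp
qed

theorem seminorm_le_norm: "p x \<le> norm (\<Phi> x)"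
proof -
  obtain L where L: "max_length_le L x" using max_length_le_exists by blast
  have it: "max_length_le (2 ^ k * L) (square_iterate x k)" for k
  proof (induction k)
    case (Suc k)
    from max_length_le_star_mult[OF this] show ?case by (simp add: mult_ac)
  qed (simp add: L)
  show ?thesis
  proof (rule le_if_power_le_polynomial)
    fix k
    have "p x ^ 2 ^ k \<le> p (square_iterate x k)"
      by (rule seminorm_square_iterate[of p, OF seminormD(1)[OF p] p_square])
    also have "\<dots> \<le> (2 * real (2 ^ k * L) + 1) * norm (\<Phi> (square_iterate x k))"
      by (rule seminorm_le_length_norm[OF it])
    finally show "p x ^ 2 ^ k \<le> (2 * real L * 2 ^ k + 1) * norm (\<Phi> x) ^ 2 ^ k"
      by (simp add: norm_square_iterate[OF star_hom] mult_ac)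
  qed (simp_all add: seminormD[OF p])
qed

end

end

section \<open>Hilbert spaces\<close>

text \<open>Restricting \<open>a\<close> to real multiples of the phase of \<beta> reduces to the
  real form with \<open>cmod \<beta>\<close> as middle coefficient. The phase
  \<open>sgn \<beta>\<close> is 0 when \<beta> is, hence only
  \<open>cmod a \<le> \<bar>c\<bar>\<close>.\<close>

lemma complex_cauchy_schwarz_form:
  fixes \<alpha> \<gamma> :: real
  assumes pos: "\<And>a. 0 \<le> \<alpha> + 2 * Re (cnj a * \<beta>) + (cmod a)\<^sup>2 * \<gamma>" and \<gamma>: "0 \<le> \<gamma>"
  shows "(cmod \<beta>)\<^sup>2 \<le> \<alpha> * \<gamma>"
proof (rule cauchy_schwarz_form)
  fix c :: real
  define a where "a = complex_of_real c * sgn \<beta>"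
  have re: "Re (cnj a * \<beta>) = c * cmod \<beta>"
  proof (cases "\<beta> = 0")
    case False
    have "cnj (sgn \<beta>) * \<beta> = complex_of_real (cmod \<beta>)"
      using False complex_norm_square[of \<beta>]
      by (simp add: sgn_div_norm scaleR_conv_of_real field_simps power2_eq_square)
    then have "cnj a * \<beta> = complex_of_real (c * cmod \<beta>)"
      by (simp add: a_def mult.assoc)
    then show ?thesis by simp
  qed simp
  have "cmod a \<le> \<bar>c\<bar>" by (simp add: a_def norm_mult norm_sgn)
  then have "(cmod a)\<^sup>2 \<le> c\<^sup>2" using power_mono[of "cmod a" "\<bar>c\<bar>" 2] by simp
  then have "(cmod a)\<^sup>2 * \<gamma> \<le> c\<^sup>2 * \<gamma>" using \<gamma> by (rule mult_right_mono)
  with pos[of a] show "0 \<le> \<alpha> + 2 * c * cmod \<beta> + c\<^sup>2 * \<gamma>" by (simp only: re)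
qed (rule \<gamma>)

context hilbert_space
begin

lemmas closed_intros = hzero_closed hadd_closed hscale_closed

lemma hdiff_closed: "u \<in> hcarrier H \<Longrightarrow> v \<in> hcarrier H \<Longrightarrow> hdiff H u v \<in> hcarrier H"
  by (simp add: hdiff_def closed_intros)

lemma hscale_zero: "u \<in> hcarrier H \<Longrightarrow> hscale H 0 u = hzero H"
  using hscale_add_left[of u 1 "-1"] hdiff_self[of u] by (simp add: hscale_one hdiff_def)

lemma hinner_add_right:
  assumes "u \<in> hcarrier H" "v \<in> hcarrier H" "w \<in> hcarrier H"
  shows "hinner H w (hadd H u v) = hinner H w u + hinner H w v"
  using hinner_commute[of w "hadd H u v"] hinner_commute[of w u] hinner_commute[of w v] assms
  by (simp add: hinner_add_left closed_intros)

lemma hinner_scale_right: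
  assumes "u \<in> hcarrier H" "w \<in> hcarrier H"
  shows "hinner H w (hscale H a u) = cnj a * hinner H w u"
  using hinner_commute[of w "hscale H a u"] hinner_commute[of w u] assms
  by (simp add: hinner_scale_left closed_intros)

lemma hnorm_ge_0: "u \<in> hcarrier H \<Longrightarrow> 0 \<le> hnorm H u"
  by (simp add: hnorm_def hinner_nonneg)

lemma hinner_self: "u \<in> hcarrier H \<Longrightarrow> hinner H u u = complex_of_real ((hnorm H u)\<^sup>2)"
  using hinner_nonneg[of u] hinner_commute[of u u] by (auto simp: hnorm_def complex_eq_iff)

lemma hnorm_power2: "u \<in> hcarrier H \<Longrightarrow> (hnorm H u)\<^sup>2 = Re (hinner H u u)"
  by (simp add: hinner_self)

lemma hnorm_add_power2:
  assumes "u \<in> hcarrier H" "v \<in> hcarrier H"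
  shows "(hnorm H (hadd H u v))\<^sup>2 = (hnorm H u)\<^sup>2 + 2 * Re (hinner H u v) + (hnorm H v)\<^sup>2"
  using assms hinner_commute[of v u]
  by (simp add: hnorm_power2 closed_intros hinner_add_left hinner_add_right)

lemma hnorm_scale:
  assumes "u \<in> hcarrier H"
  shows "hnorm H (hscale H a u) = cmod a * hnorm H u"
proof -
  have "hinner H (hscale H a u) (hscale H a u) = complex_of_real ((cmod a)\<^sup>2) * hinner H u u"
    unfolding complex_norm_square using assms
    by (simp add: closed_intros hinner_scale_left hinner_scale_right)
  then show ?thesis by (simp add: hnorm_def real_sqrt_mult)
qed

lemma hinner_cauchy_schwarz:
  assumes "u \<in> hcarrier H" "v \<in> hcarrier H"
  shows "cmod (hinner H u v) \<le> hnorm H u * hnorm H v"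
proof -
  have "(cmod (hinner H u v))\<^sup>2 \<le> (hnorm H u)\<^sup>2 * (hnorm H v)\<^sup>2"
  proof (rule complex_cauchy_schwarz_form)
    fix a
    have "0 \<le> (hnorm H (hadd H u (hscale H a v)))\<^sup>2" by simp
    also have "\<dots> = (hnorm H u)\<^sup>2 + 2 * Re (cnj a * hinner H u v) + (cmod a)\<^sup>2 * (hnorm H v)\<^sup>2"
      using assms by (simp add: hnorm_add_power2 closed_intros hinner_scale_right hnorm_scale power_mult_distrib)
    finally show "0 \<le> (hnorm H u)\<^sup>2 + 2 * Re (cnj a * hinner H u v) + (cmod a)\<^sup>2 * (hnorm H v)\<^sup>2" .
  qed simp
  then have "(cmod (hinner H u v))\<^sup>2 \<le> (hnorm H u * hnorm H v)\<^sup>2" by (simp add: power_mult_distrib)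
  then show ?thesis
    by (rule power2_le_imp_le) (use assms in \<open>auto intro!: mult_nonneg_nonneg hnorm_ge_0\<close>)
qed

lemma hnorm_triangle:
  assumes "u \<in> hcarrier H" "v \<in> hcarrier H"
  shows "hnorm H (hadd H u v) \<le> hnorm H u + hnorm H v"
proof (rule power2_le_imp_le)
  have "Re (hinner H u v) \<le> hnorm H u * hnorm H v"
    using complex_Re_le_cmod hinner_cauchy_schwarz[OF assms] by (rule order_trans)
  then show "(hnorm H (hadd H u v))\<^sup>2 \<le> (hnorm H u + hnorm H v)\<^sup>2"
    using assms by (simp add: hnorm_add_power2 power2_sum)
qed (use assms in \<open>auto intro!: add_nonneg_nonneg hnorm_ge_0\<close>)

lemma hadd_hdiff_cancel:
  assumes "u \<in> hcarrier H" "v \<in> hcarrier H"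
  shows "hadd H (hdiff H u v) v = u"
proof -
  have "hadd H (hscale H (-1) v) v = hzero H"
    using hdiff_self[of v] assms by (simp add: hdiff_def hadd_commute closed_intros)
  then show ?thesis
    using assms by (simp add: hdiff_def hadd_assoc closed_intros hadd_commute[of u "hzero H"] hadd_zero)
qed

lemma hdiff_add_hdiff:
  assumes "u \<in> hcarrier H" "v \<in> hcarrier H" "w \<in> hcarrier H"
  shows "hadd H (hdiff H u v) (hdiff H v w) = hdiff H u w"
proof -
  have "hadd H (hdiff H u v) (hdiff H v w) = hadd H (hadd H (hdiff H u v) v) (hscale H (-1) w)"
    using assms by (simp add: hdiff_def hadd_assoc closed_intros)
  then show ?thesis using assms by (simp add: hadd_hdiff_cancel) (simp add: hdiff_def)
qed

lemma hnorm_hdiff_commute: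
  assumes "u \<in> hcarrier H" "v \<in> hcarrier H"
  shows "hnorm H (hdiff H u v) = hnorm H (hdiff H v u)"
proof -
  have "hdiff H u v = hscale H (-1) (hdiff H v u)"
    using assms by (simp add: hdiff_def hscale_add_right hscale_hscale hscale_one closed_intros hadd_commute)
  then show ?thesis using assms by (simp add: hnorm_scale hdiff_closed)
qed

lemma hnorm_hdiff_triangle:
  assumes "u \<in> hcarrier H" "v \<in> hcarrier H" "w \<in> hcarrier H"
  shows "hnorm H (hdiff H u w) \<le> hnorm H (hdiff H u v) + hnorm H (hdiff H v w)"
  using hnorm_triangle[of "hdiff H u v" "hdiff H v w"] assms by (simp add: hdiff_add_hdiff hdiff_closed)

lemma hnorm_eq_0: "u \<in> hcarrier H \<Longrightarrow> hnorm H u = 0 \<Longrightarrow> u = hzero H"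
  by (rule hinner_definite) (simp_all add: hinner_self)

lemma hnorm_hzero: "hnorm H (hzero H) = 0"
  using hnorm_scale[of "hzero H" 0] hscale_zero[of "hzero H"] by (simp add: hzero_closed)

section \<open>Operator norms\<close>

lemma bounded_operatorD:
  assumes "S \<in> bounded_operators H" "u \<in> hcarrier H"
  shows "S u \<in> hcarrier H" and "S (hscale H a u) = hscale H a (S u)"
  using assms by (auto simp: bounded_operators_def)

lemma hnorm_le_operator_norm_unit:
  assumes S: "S \<in> bounded_operators H" and u: "u \<in> hcarrier H" "hnorm H u \<le> 1"
  shows "hnorm H (S u) \<le> operator_norm H S"
  unfolding operator_norm_def
proof (rule cSup_upper)
  obtain c where c: "\<And>u. u \<in> hcarrier H \<Longrightarrow> hnorm H (S u) \<le> c * hnorm H u"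
    using S unfolding bounded_operators_def by blast
  show "bdd_above {hnorm H (S u) | u. u \<in> hcarrier H \<and> hnorm H u \<le> 1}"
  proof (rule bdd_aboveI)
    fix r assume "r \<in> {hnorm H (S u) | u. u \<in> hcarrier H \<and> hnorm H u \<le> 1}"
    then obtain u where u: "r = hnorm H (S u)" "u \<in> hcarrier H" "hnorm H u \<le> 1" by blast
    have "c * hnorm H u \<le> \<bar>c\<bar> * 1"
      using u hnorm_ge_0[OF u(2)] by (intro mult_mono) auto
    with c[OF u(2)] u(1) show "r \<le> \<bar>c\<bar>" by simp
  qed
qed (use u in blast)

lemma operator_norm_nonneg:
  assumes S: "S \<in> bounded_operators H"
  shows "0 \<le> operator_norm H S"
  using hnorm_ge_0[OF bounded_operatorD(1)[OF S hzero_closed]]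
    hnorm_le_operator_norm_unit[OF S hzero_closed] by (simp add: hnorm_hzero)

lemma hnorm_le_operator_norm:
  assumes S: "S \<in> bounded_operators H" and u: "u \<in> hcarrier H"
  shows "hnorm H (S u) \<le> operator_norm H S * hnorm H u"
proof (cases "hnorm H u = 0")
  case True
  have "S (hscale H 0 u) = hscale H 0 (S u)" using S u by (rule bounded_operatorD(2))
  then have "S u = hzero H"
    using hnorm_eq_0[OF u True] u bounded_operatorD(1)[OF S u] by (simp add: hscale_zero)
  then show ?thesis by (simp add: hnorm_hzero True)
next
  case False
  then have pos: "0 < hnorm H u" using hnorm_ge_0[OF u] by simp
  let ?a = "complex_of_real (1 / hnorm H u)"
  have "hnorm H (S (hscale H ?a u)) \<le> operator_norm H S"
    using u pos by (intro hnorm_le_operator_norm_unit[OF S])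
      (auto simp: hnorm_scale norm_divide intro!: closed_intros)
  moreover have "hnorm H (S (hscale H ?a u)) = hnorm H (S u) / hnorm H u"
    using S u pos by (simp add: bounded_operatorD hnorm_scale norm_divide del: of_real_divide)
  ultimately show ?thesis using pos by (simp add: divide_le_eq)
qed

lemma operator_norm_le:
  assumes "\<And>u. u \<in> hcarrier H \<Longrightarrow> hnorm H (S u) \<le> c * hnorm H u" "0 \<le> c"
  shows "operator_norm H S \<le> c"
  unfolding operator_norm_def
proof (rule cSup_least)
  show "{hnorm H (S u) | u. u \<in> hcarrier H \<and> hnorm H u \<le> 1} \<noteq> {}"
    using hzero_closed hnorm_hzero by force
  fix r assume "r \<in> {hnorm H (S u) | u. u \<in> hcarrier H \<and> hnorm H u \<le> 1}"
  then obtain u where u: "r = hnorm H (S u)" "u \<in> hcarrier H" "hnorm H u \<le> 1" by blast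
  show "r \<le> c"
    using assms(1)[OF u(2)] mult_left_mono[OF u(3) assms(2)] u(1) by simp
qed

text \<open>These are the properties that the comparison demands of \<open>p\<close>. The second one
  is the Cauchy-Schwarz inequality applied to
  \<open>hinner H u (\<rho> (star x * x) u)\<close>.\<close>

lemma representation_seminorm:
  assumes \<rho>: "star_hom_into_operators H \<rho>"
  shows "seminorm (\<lambda>x. operator_norm H (\<rho> x))"
    and "(operator_norm H (\<rho> x))\<^sup>2 \<le> operator_norm H (\<rho> (star x * x))"
proof -
  let ?p = "\<lambda>x. operator_norm H (\<rho> x)"
  have bo: "\<rho> x \<in> bounded_operators H" for x using \<rho> by (simp add: star_hom_into_operators_def)
  note nn = operator_norm_nonneg[OF bo] and le = hnorm_le_operator_norm[OF bo]
    and cl = bounded_operatorD(1)[OF bo]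
  have add: "?p (x + y) \<le> ?p x + ?p y" for x y
  proof (rule operator_norm_le)
    fix u assume u: "u \<in> hcarrier H"
    have "hnorm H (\<rho> (x + y) u) \<le> hnorm H (\<rho> x u) + hnorm H (\<rho> y u)"
      using \<rho> u cl by (simp add: star_hom_into_operators_def hnorm_triangle)
    with le[OF u, of x] le[OF u, of y]
    show "hnorm H (\<rho> (x + y) u) \<le> (?p x + ?p y) * hnorm H u" by (simp add: distrib_right)
  qed (simp add: nn)
  moreover have "?p (c *\<^sub>C x) \<le> cmod c * ?p x" for c x
  proof (rule operator_norm_le)
    fix u assume u: "u \<in> hcarrier H"
    then show "hnorm H (\<rho> (c *\<^sub>C x) u) \<le> cmod c * ?p x * hnorm H u"
      using \<rho> cl le[OF u, of x]
      by (simp add: star_hom_into_operators_def hnorm_scale mult.assoc mult_left_mono)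
  qed (simp add: nn)
  ultimately show "seminorm ?p" using nn by (simp add: seminorm_def)
  have "?p x \<le> sqrt (?p (star x * x))"
  proof (rule operator_norm_le)
    fix u assume u: "u \<in> hcarrier H"
    have "complex_of_real ((hnorm H (\<rho> x u))\<^sup>2) = hinner H (\<rho> x u) (\<rho> x u)"
      using u cl by (simp add: hinner_self)
    also have "\<dots> = hinner H u (\<rho> (star x * x) u)"
      using \<rho> u cl by (simp add: star_hom_into_operators_def)
    finally have "complex_of_real ((hnorm H (\<rho> x u))\<^sup>2) = hinner H u (\<rho> (star x * x) u)" .
    from arg_cong[OF this, of cmod]
    have "(hnorm H (\<rho> x u))\<^sup>2 = cmod (hinner H u (\<rho> (star x * x) u))"
      by (simp only: norm_of_real abs_power2)
    also have "\<dots> \<le> hnorm H u * hnorm H (\<rho> (star x * x) u)"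
      using u cl[OF u] by (intro hinner_cauchy_schwarz)
    also have "\<dots> \<le> hnorm H u * (?p (star x * x) * hnorm H u)"
      using u by (intro mult_left_mono le hnorm_ge_0)
    also have "\<dots> = (sqrt (?p (star x * x)) * hnorm H u)\<^sup>2"
      using nn by (simp add: power_mult_distrib) (simp add: power2_eq_square)
    finally show "hnorm H (\<rho> x u) \<le> sqrt (?p (star x * x)) * hnorm H u"
      by (rule power2_le_imp_le) (use u in \<open>auto intro!: mult_nonneg_nonneg hnorm_ge_0 nn\<close>)
  qed (simp add: nn)
  then have "(?p x)\<^sup>2 \<le> (sqrt (?p (star x * x)))\<^sup>2" using nn by (intro power_mono)
  then show "(?p x)\<^sup>2 \<le> ?p (star x * x)" using nn by simp
qed

end

section \<open>Hilbert sums\<close>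

lemma summable_on_le:
  fixes f g :: "'k \<Rightarrow> real"
  assumes "g summable_on K" "\<And>k. k \<in> K \<Longrightarrow> \<bar>f k\<bar> \<le> g k"
  shows "f summable_on K"
proof -
  have "(\<lambda>k. norm (g k)) summable_on K" using assms(1) by (rule summable_on_iff_abs_summable_on_real[THEN iffD1])
  then have "(\<lambda>k. norm (f k)) summable_on K"
    by (rule Infinite_Sum.abs_summable_on_comparison_test)
      (simp, rule order_trans[OF assms(2) abs_ge_self])
  then show ?thesis by (rule abs_summable_summable)
qed

locale hilbert_family =
  fixes K :: "'k set" and H :: "'k \<Rightarrow> 'h hilbert"
  assumes hilbert: "k \<in> K \<Longrightarrow> hilbert_space (H k)"
begin

abbreviation S where "S \<equiv> hilbert_sum K H"

abbreviation sq where "sq u k \<equiv> (hnorm (H k) (u k))\<^sup>2"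

lemma carrier_iff: "u \<in> hcarrier S \<longleftrightarrow>
    (\<forall>k\<in>K. u k \<in> hcarrier (H k)) \<and> u \<in> extensional K \<and> (\<lambda>k. sq u k) summable_on K"
  by (auto simp: hilbert_sum_def PiE_def)

lemma carrierD: "u \<in> hcarrier S \<Longrightarrow> k \<in> K \<Longrightarrow> u k \<in> hcarrier (H k)"
  "u \<in> hcarrier S \<Longrightarrow> (\<lambda>k. sq u k) summable_on K"
  by (simp_all add: carrier_iff)

lemma carrier_eqI:
  "u \<in> hcarrier S \<Longrightarrow> v \<in> hcarrier S \<Longrightarrow> (\<And>k. k \<in> K \<Longrightarrow> u k = v k) \<Longrightarrow> u = v"
  unfolding carrier_iff by (blast intro: extensionalityI)

lemma sum_simps: "hzero S = (\<lambda>k\<in>K. hzero (H k))" "hadd S u v = (\<lambda>k\<in>K. hadd (H k) (u k) (v k))"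
  "hscale S a u = (\<lambda>k\<in>K. hscale (H k) a (u k))"
  "hinner S u v = (\<Sum>\<^sub>\<infinity>k\<in>K. hinner (H k) (u k) (v k))"
  "hdiff S u v = (\<lambda>k\<in>K. hdiff (H k) (u k) (v k))"
  by (auto simp: hilbert_sum_def hdiff_def)

lemma carrierI:
  assumes "\<And>k. k \<in> K \<Longrightarrow> u k \<in> hcarrier (H k)" "g summable_on K"
    "\<And>k. k \<in> K \<Longrightarrow> sq u k \<le> g k"
  shows "(\<lambda>k\<in>K. u k) \<in> hcarrier S"
proof -
  have "(\<lambda>k. sq u k) summable_on K"
    by (rule summable_on_le[OF assms(2)]) (use assms(3) in auto)
  then have "(\<lambda>k. (hnorm (H k) ((\<lambda>k\<in>K. u k) k))\<^sup>2) summable_on K"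
    by (rule summable_on_cong[THEN iffD1, rotated]) simp
  with assms(1) show ?thesis by (simp add: carrier_iff)
qed

lemma hzero_carrier: "hzero S \<in> hcarrier S"
  unfolding sum_simps
  by (rule carrierI[where g = "\<lambda>_. 0"])
    (simp_all add: hilbert_space.hnorm_hzero[OF hilbert] hilbert_space.hzero_closed[OF hilbert])

lemma hadd_carrier:
  assumes "u \<in> hcarrier S" "v \<in> hcarrier S"
  shows "hadd S u v \<in> hcarrier S"
  unfolding sum_simps
proof (rule carrierI)
  show "(\<lambda>k. 2 * sq u k + 2 * sq v k) summable_on K"
    using assms carrierD(2) by (intro summable_on_add summable_on_cmult_right)
  fix k assume k: "k \<in> K"
  interpret hilbert_space "H k" by (rule hilbert[OF k])
  note c = carrierD(1)[OF assms(1) k] carrierD(1)[OF assms(2) k]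
  show "hadd (H k) (u k) (v k) \<in> hcarrier (H k)" using c by (rule hadd_closed)
  have "(hnorm (H k) (hadd (H k) (u k) (v k)))\<^sup>2 \<le> (hnorm (H k) (u k) + hnorm (H k) (v k))\<^sup>2"
    using c by (intro power_mono hnorm_triangle hnorm_ge_0 hadd_closed)
  also have "\<dots> \<le> 2 * sq u k + 2 * sq v k"
    using sum_squares_bound[of "hnorm (H k) (u k)" "hnorm (H k) (v k)"] by (simp add: power2_sum)
  finally show "(hnorm (H k) (hadd (H k) (u k) (v k)))\<^sup>2 \<le>
    2 * sq u k + 2 * sq v k" .
qed

lemma hscale_carrier:
  assumes "u \<in> hcarrier S"
  shows "hscale S a u \<in> hcarrier S"
  unfolding sum_simps
proof (rule carrierI)
  show "(\<lambda>k. (cmod a)\<^sup>2 * sq u k) summable_on K"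
    using assms carrierD(2) by (intro summable_on_cmult_right)
  fix k assume k: "k \<in> K"
  interpret hilbert_space "H k" by (rule hilbert[OF k])
  note c = carrierD(1)[OF assms(1) k]
  show "hscale (H k) a (u k) \<in> hcarrier (H k)" using c by (rule hscale_closed)
  show "(hnorm (H k) (hscale (H k) a (u k)))\<^sup>2 \<le> (cmod a)\<^sup>2 * sq u k"
    using c by (simp add: hnorm_scale power_mult_distrib)
qed

lemma hinner_summable:
  assumes "u \<in> hcarrier S" "v \<in> hcarrier S"
  shows "(\<lambda>k. hinner (H k) (u k) (v k)) summable_on K"
proof (rule abs_summable_summable, rule summable_on_le)
  show "(\<lambda>k. sq u k + sq v k) summable_on K"
    using assms carrierD(2) by (intro summable_on_add)
  fix k assume k: "k \<in> K"
  interpret hilbert_space "H k" by (rule hilbert[OF k])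
  note c = carrierD(1)[OF assms(1) k] carrierD(1)[OF assms(2) k]
  have "2 * (hnorm (H k) (u k) * hnorm (H k) (v k)) \<le> sq u k + sq v k"
    using sum_squares_bound[of "hnorm (H k) (u k)" "hnorm (H k) (v k)"] by simp
  moreover have "0 \<le> hnorm (H k) (u k) * hnorm (H k) (v k)"
    using c by (intro mult_nonneg_nonneg hnorm_ge_0)
  ultimately show "\<bar>cmod (hinner (H k) (u k) (v k))\<bar> \<le>
      sq u k + sq v k"
    using hinner_cauchy_schwarz[OF c] by simp
qed

lemma hinner_sum_self:
  assumes "u \<in> hcarrier S"
  shows "hinner S u u = complex_of_real (\<Sum>\<^sub>\<infinity>k\<in>K. sq u k)"
proof -
  have "hinner S u u = (\<Sum>\<^sub>\<infinity>k\<in>K. complex_of_real (sq u k))"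
    unfolding sum_simps
    by (rule infsum_cong) (simp add: hilbert_space.hinner_self[OF hilbert] carrierD(1)[OF assms])
  also have "\<dots> = complex_of_real (\<Sum>\<^sub>\<infinity>k\<in>K. sq u k)"
    using has_sum_of_real[OF has_sum_infsum[OF carrierD(2)[OF assms]]] by (rule infsumI)
  finally show ?thesis .
qed

lemma hnorm_sum: "u \<in> hcarrier S \<Longrightarrow> hnorm S u = sqrt (\<Sum>\<^sub>\<infinity>k\<in>K. sq u k)"
  by (simp add: hnorm_def[of S] hinner_sum_self)

lemma hdiff_carrier: "u \<in> hcarrier S \<Longrightarrow> v \<in> hcarrier S \<Longrightarrow> hdiff S u v \<in> hcarrier S"
  unfolding hdiff_def by (intro hadd_carrier hscale_carrier)

lemma hnorm_component_le:
  assumes "u \<in> hcarrier S" "k \<in> K"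
  shows "hnorm (H k) (u k) \<le> hnorm S u"
proof -
  have "(\<Sum>k\<in>{k}. sq u k) \<le> (\<Sum>\<^sub>\<infinity>k\<in>K. sq u k)"
    by (rule finite_sum_le_infsum) (use assms carrierD in auto)
  then show ?thesis using assms(1) by (simp add: hnorm_sum real_le_rsqrt)
qed

text \<open>Components converge because they are dominated by the norm of the sum. The Cauchy
  estimate, restricted to finitely many indices, survives the limit, and the finite sums then
  control the whole.\<close>

lemma hilbert_sum_complete:
  fixes X :: "nat \<Rightarrow> 'k \<Rightarrow> 'h"
  assumes X: "\<And>n. X n \<in> hcarrier S"
    and Cauchy: "\<And>e. 0 < e \<Longrightarrow> \<exists>N. \<forall>m\<ge>N. \<forall>n\<ge>N. hnorm S (hdiff S (X m) (X n)) < e"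
  shows "\<exists>u\<in>hcarrier S. (\<lambda>n. hnorm S (hdiff S (X n) u)) \<longlonglongrightarrow> 0"
proof -
  have "\<exists>v\<in>hcarrier (H k). (\<lambda>n. hnorm (H k) (hdiff (H k) (X n k) v)) \<longlonglongrightarrow> 0" if k: "k \<in> K" for k
  proof -
    interpret hilbert_space "H k" by (rule hilbert[OF k])
    show ?thesis
    proof (rule hcomplete)
      fix e :: real assume "0 < e"
      then obtain N where "\<forall>m\<ge>N. \<forall>n\<ge>N. hnorm S (hdiff S (X m) (X n)) < e" using Cauchy by blast
      moreover have "hnorm (H k) (hdiff (H k) (X m k) (X n k)) \<le> hnorm S (hdiff S (X m) (X n))" for m n
        using hnorm_component_le[OF hdiff_carrier[OF X X] k, of m n] k by (simp add: sum_simps(5))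
      ultimately show "\<exists>N. \<forall>m\<ge>N. \<forall>n\<ge>N. hnorm (H k) (hdiff (H k) (X m k) (X n k)) < e"
        by (meson le_less_trans)
    qed (rule carrierD(1)[OF X k])
  qed
  then have "\<exists>u. \<forall>k\<in>K. u k \<in> hcarrier (H k) \<and> (\<lambda>n. hnorm (H k) (hdiff (H k) (X n k) (u k))) \<longlonglongrightarrow> 0"
    by (intro bchoice) blast
  then obtain u where u: "\<And>k. k \<in> K \<Longrightarrow> u k \<in> hcarrier (H k)"
    "\<And>k. k \<in> K \<Longrightarrow> (\<lambda>n. hnorm (H k) (hdiff (H k) (X n k) (u k))) \<longlonglongrightarrow> 0"
    by blast
  \<comment> \<open>At this stage the componentwise limit is not known to be square-summable, so the
    estimate is stated for finite \<open>F\<close> and made uniform in \<open>F\<close>.\<close>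
  have finite_le: "(\<Sum>k\<in>F. (hnorm (H k) (hdiff (H k) (X m k) (u k)))\<^sup>2) \<le> e\<^sup>2"
    if F: "finite F" "F \<subseteq> K" and e: "0 < e" and N: "\<forall>n\<ge>N. hnorm S (hdiff S (X m) (X n)) < e" for F m N e
  proof (rule LIMSEQ_le_const2)
    show "(\<lambda>n. \<Sum>k\<in>F. (hnorm (H k) (hdiff (H k) (X m k) (X n k)))\<^sup>2) \<longlonglongrightarrow>
        (\<Sum>k\<in>F. (hnorm (H k) (hdiff (H k) (X m k) (u k)))\<^sup>2)"
    proof (intro tendsto_sum tendsto_power)
      fix k assume "k \<in> F"
      with F have k: "k \<in> K" by blast
      interpret hilbert_space "H k" by (rule hilbert[OF k])
      note c = carrierD(1)[OF X k] u(1)[OF k]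
      show "(\<lambda>n. hnorm (H k) (hdiff (H k) (X m k) (X n k))) \<longlonglongrightarrow>
          hnorm (H k) (hdiff (H k) (X m k) (u k))"
      proof (rule LIM_zero_cancel, rule Lim_null_comparison[OF _ u(2)[OF k]], rule always_eventually, rule allI)
        fix n
        show "norm (hnorm (H k) (hdiff (H k) (X m k) (X n k)) - hnorm (H k) (hdiff (H k) (X m k) (u k)))
            \<le> hnorm (H k) (hdiff (H k) (X n k) (u k))"
          using hnorm_hdiff_triangle[OF c(1) c(1) c(2), of m n]
            hnorm_hdiff_triangle[OF c(1) c(2) c(1), of m n] hnorm_hdiff_commute[OF c(2) c(1), of n]
          by simp
      qed
    qed
    have "(\<Sum>k\<in>F. (hnorm (H k) (hdiff (H k) (X m k) (X n k)))\<^sup>2) \<le> e\<^sup>2" if "N \<le> n" for n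
    proof -
      note cd = hdiff_carrier[OF X X, of m n]
      have "(\<Sum>k\<in>F. (hnorm (H k) (hdiff (H k) (X m k) (X n k)))\<^sup>2) =
          (\<Sum>k\<in>F. (hnorm (H k) (hdiff S (X m) (X n) k))\<^sup>2)"
        using F by (intro sum.cong) (auto simp: sum_simps(5))
      also have "\<dots> \<le> (\<Sum>\<^sub>\<infinity>k\<in>K. (hnorm (H k) (hdiff S (X m) (X n) k))\<^sup>2)"
        using F by (intro finite_sum_le_infsum carrierD(2)[OF cd]) auto
      also have "\<dots> = (hnorm S (hdiff S (X m) (X n)))\<^sup>2"
        by (simp add: hnorm_sum[OF cd] infsum_nonneg)
      also have "\<dots> \<le> e\<^sup>2"
        using N that e by (intro power_mono) (auto simp: hnorm_sum[OF cd] infsum_nonneg intro: less_imp_le)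
      finally show ?thesis .
    qed
    then show "\<exists>N. \<forall>n\<ge>N. (\<Sum>k\<in>F. (hnorm (H k) (hdiff (H k) (X m k) (X n k)))\<^sup>2) \<le> e\<^sup>2" by blast
  qed
  define u' where "u' = (\<lambda>k\<in>K. u k)"
  have diff: "(\<lambda>k\<in>K. hdiff (H k) (X m k) (u k)) \<in> hcarrier S \<and>
      hnorm S (\<lambda>k\<in>K. hdiff (H k) (X m k) (u k)) \<le> e"
    if e: "0 < e" and N: "\<forall>n\<ge>N. hnorm S (hdiff S (X m) (X n)) < e" for m N e
  proof
    let ?d = "\<lambda>k\<in>K. hdiff (H k) (X m k) (u k)"
    have summable: "(\<lambda>k. (hnorm (H k) (hdiff (H k) (X m k) (u k)))\<^sup>2) summable_on K"
      using finite_le[OF _ _ e N] by (intro nonneg_bdd_above_summable_on bdd_aboveI2[of _ _ "e\<^sup>2"]) auto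
    show car: "?d \<in> hcarrier S"
      by (rule carrierI[OF _ summable])
        (auto intro!: hilbert_space.hdiff_closed[OF hilbert] carrierD(1)[OF X] u(1))
    have "(\<Sum>\<^sub>\<infinity>k\<in>K. (hnorm (H k) (?d k))\<^sup>2) = (\<Sum>\<^sub>\<infinity>k\<in>K. (hnorm (H k) (hdiff (H k) (X m k) (u k)))\<^sup>2)"
      by (rule infsum_cong) simp
    also have "\<dots> \<le> e\<^sup>2" by (rule infsum_le_finite_sums[OF summable]) (rule finite_le[OF _ _ e N])
    finally show "hnorm S ?d \<le> e" using e by (simp add: hnorm_sum[OF car] real_le_lsqrt infsum_nonneg)
  qed
  have diff_eq: "hdiff S (X m) u' = (\<lambda>k\<in>K. hdiff (H k) (X m k) (u k))" for m
    by (auto simp: sum_simps(5) u'_def)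
  have u': "u' \<in> hcarrier S"
  proof -
    obtain N where N: "\<forall>m\<ge>N. \<forall>n\<ge>N. hnorm S (hdiff S (X m) (X n)) < 1"
      using Cauchy[of 1] by auto
    then have d: "(\<lambda>k\<in>K. hdiff (H k) (X N k) (u k)) \<in> hcarrier S" (is "?d \<in> _")
      using diff[of 1 N N] by simp
    \<comment> \<open>The limit is \<open>X N - (X N - u)\<close>, a difference of two members of
      the carrier.\<close>
    have "u' = hadd S (hscale S (-1) ?d) (X N)"
    proof (rule extensionalityI[of _ K])
      fix k assume k: "k \<in> K"
      interpret hilbert_space "H k" by (rule hilbert[OF k])
      note c = carrierD(1)[OF X[of N] k] u(1)[OF k]
      have "hscale (H k) (-1) (hdiff (H k) (X N k) (u k)) = hdiff (H k) (u k) (X N k)"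
        using c by (simp add: hdiff_def hscale_add_right hscale_hscale hscale_one closed_intros hadd_commute)
      then show "u' k = hadd S (hscale S (-1) ?d) (X N) k"
        using k c by (simp add: u'_def sum_simps hadd_hdiff_cancel)
    qed (simp_all add: u'_def sum_simps)
    then show ?thesis using d X by (simp add: hadd_carrier hscale_carrier)
  qed
  moreover have "(\<lambda>n. hnorm S (hdiff S (X n) u')) \<longlonglongrightarrow> 0"
  proof (rule LIMSEQ_I)
    fix e :: real assume e: "0 < e"
    then obtain N where N: "\<forall>m\<ge>N. \<forall>n\<ge>N. hnorm S (hdiff S (X m) (X n)) < e / 2"
      using Cauchy[of "e / 2"] by auto
    have le: "hnorm S (hdiff S (X m) u') \<le> e / 2" if "N \<le> m" for m
      unfolding diff_eq using diff[of "e / 2" N m] N e that by simp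
    have "hnorm S (hdiff S (X m) u') < e" if "N \<le> m" for m
      using le[OF that] e by simp
    moreover have "0 \<le> hnorm S (hdiff S (X m) u')" for m
      by (simp add: hnorm_sum[OF hdiff_carrier[OF X u']] infsum_nonneg)
    ultimately show "\<exists>N. \<forall>n\<ge>N. norm (hnorm S (hdiff S (X n) u') - 0) < e"
      by (intro exI[of _ N]) simp
  qed
  ultimately show ?thesis by blast
qed

lemma hilbert_space_sum: "hilbert_space S"
proof
  fix u v w and a b
  note cl = hadd_carrier hscale_carrier hzero_carrier hdiff_carrier and cD = carrierD(1)
  show "hzero S \<in> hcarrier S" by (rule hzero_carrier)
  assume u: "u \<in> hcarrier S"
  show "hscale S a u \<in> hcarrier S" by (rule hscale_carrier[OF u])
  show "hadd S (hzero S) u = u"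
    by (rule carrier_eqI, intro cl u, intro cl u, simp add: sum_simps
        hilbert_space.hadd_zero[OF hilbert cD[OF u]])
  show "hdiff S u u = hzero S"
    by (rule carrier_eqI, intro cl u, intro cl u, simp add: sum_simps
        hilbert_space.hdiff_self[OF hilbert cD[OF u]])
  show "hscale S (a + b) u = hadd S (hscale S a u) (hscale S b u)"
    by (rule carrier_eqI, intro cl u, intro cl u, simp add: sum_simps
        hilbert_space.hscale_add_left[OF hilbert cD[OF u]])
  show "hscale S a (hscale S b u) = hscale S (a * b) u"
    by (rule carrier_eqI, intro cl u, intro cl u, simp add: sum_simps
        hilbert_space.hscale_hscale[OF hilbert cD[OF u]])
  show "hscale S 1 u = u"
    by (rule carrier_eqI, intro cl u, intro cl u, simp add: sum_simps
        hilbert_space.hscale_one[OF hilbert cD[OF u]])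
  show "0 \<le> Re (hinner S u u)" by (simp add: hinner_sum_self[OF u] infsum_nonneg)
  show "u = hzero S" if "hinner S u u = 0"
  proof (rule carrier_eqI[OF u hzero_carrier])
    fix k assume k: "k \<in> K"
    have "(\<Sum>\<^sub>\<infinity>k\<in>K. sq u k) \<le> 0" using that by (simp add: hinner_sum_self[OF u])
    from nonneg_infsum_le_0D[OF this carrierD(2)[OF u] _ k]
    have "hnorm (H k) (u k) = 0" by simp
    then show "u k = hzero S k"
      using k hilbert_space.hnorm_eq_0[OF hilbert[OF k] cD[OF u k]] by (simp add: sum_simps)
  qed
  assume v: "v \<in> hcarrier S"
  show "hadd S u v \<in> hcarrier S" by (rule hadd_carrier[OF u v])
  show "hadd S u v = hadd S v u"
    by (rule carrier_eqI, intro cl u v, intro cl u v, simp add: sum_simps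
        hilbert_space.hadd_commute[OF hilbert cD[OF u] cD[OF v]])
  show "hscale S a (hadd S u v) = hadd S (hscale S a u) (hscale S a v)"
    by (rule carrier_eqI, intro cl u v, intro cl u v, simp add: sum_simps
        hilbert_space.hscale_add_right[OF hilbert cD[OF u] cD[OF v]])
  have "(\<Sum>\<^sub>\<infinity>k\<in>K. hinner (H k) ((\<lambda>k\<in>K. hscale (H k) a (u k)) k) (v k)) =
      (\<Sum>\<^sub>\<infinity>k\<in>K. a * hinner (H k) (u k) (v k))"
    by (rule infsum_cong) (simp add: hilbert_space.hinner_scale_left[OF hilbert cD[OF u] cD[OF v]])
  then show "hinner S (hscale S a u) v = a * hinner S u v"
    by (simp only: sum_simps infsum_cmult_right')
  have "(\<Sum>\<^sub>\<infinity>k\<in>K. hinner (H k) (u k) (v k)) = (\<Sum>\<^sub>\<infinity>k\<in>K. cnj (hinner (H k) (v k) (u k)))"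
    by (rule infsum_cong) (rule hilbert_space.hinner_commute[OF hilbert cD[OF u] cD[OF v]])
  then show "hinner S u v = cnj (hinner S v u)" by (simp only: sum_simps infsum_cnj)
  assume w: "w \<in> hcarrier S"
  show "hadd S (hadd S u v) w = hadd S u (hadd S v w)"
    by (rule carrier_eqI, intro cl u v w, intro cl u v w, simp add: sum_simps
        hilbert_space.hadd_assoc[OF hilbert cD[OF u] cD[OF v] cD[OF w]])
  have "(\<Sum>\<^sub>\<infinity>k\<in>K. hinner (H k) ((\<lambda>k\<in>K. hadd (H k) (u k) (v k)) k) (w k)) =
      (\<Sum>\<^sub>\<infinity>k\<in>K. hinner (H k) (u k) (w k) + hinner (H k) (v k) (w k))"
    by (rule infsum_cong) (simp add: hilbert_space.hinner_add_left[OF hilbert cD[OF u] cD[OF v] cD[OF w]])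
  then show "hinner S (hadd S u v) w = hinner S u w + hinner S v w"
    by (simp only: sum_simps infsum_add[OF hinner_summable[OF u w] hinner_summable[OF v w]])
qed (rule hilbert_sum_complete)

section \<open>Direct sums of representations\<close>

text \<open>A bound common to all summands gives square-summability and the norm estimate together.
  It will be used with \<open>b = norm (\<Phi> x)\<close>.\<close>

lemma direct_sum_bound:
  assumes \<rho>: "\<And>k. k \<in> K \<Longrightarrow> star_hom_into_operators (H k) (\<rho> k)"
    and b: "\<And>k. k \<in> K \<Longrightarrow> operator_norm (H k) (\<rho> k x) \<le> b" "0 \<le> b" and u: "u \<in> hcarrier S"
  shows "direct_sum K \<rho> x u \<in> hcarrier S" "hnorm S (direct_sum K \<rho> x u) \<le> b * hnorm S u"
proof -
  have bo: "\<rho> k x \<in> bounded_operators (H k)" if "k \<in> K" for k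
    using \<rho>[OF that] by (simp add: star_hom_into_operators_def)
  have le: "(hnorm (H k) (\<rho> k x (u k)))\<^sup>2 \<le> b\<^sup>2 * sq u k" if k: "k \<in> K" for k
  proof -
    interpret hilbert_space "H k" by (rule hilbert[OF k])
    note c = carrierD(1)[OF u k]
    have "hnorm (H k) (\<rho> k x (u k)) \<le> b * hnorm (H k) (u k)"
      using hnorm_le_operator_norm[OF bo[OF k] c] mult_right_mono[OF b(1)[OF k] hnorm_ge_0[OF c]]
      by (rule order_trans)
    then have "(hnorm (H k) (\<rho> k x (u k)))\<^sup>2 \<le> (b * hnorm (H k) (u k))\<^sup>2"
      by (rule power_mono) (rule hnorm_ge_0[OF bounded_operatorD(1)[OF bo[OF k] c]])
    then show ?thesis by (simp add: power_mult_distrib)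
  qed
  have summable: "(\<lambda>k. b\<^sup>2 * sq u k) summable_on K"
    by (rule summable_on_cmult_right[OF carrierD(2)[OF u]])
  show car: "direct_sum K \<rho> x u \<in> hcarrier S"
    unfolding direct_sum_def
  proof (rule carrierI[OF _ summable le])
    fix k assume k: "k \<in> K"
    show "\<rho> k x (u k) \<in> hcarrier (H k)"
      by (rule hilbert_space.bounded_operatorD(1)[OF hilbert[OF k] bo[OF k] carrierD(1)[OF u k]])
  qed
  have "(\<Sum>\<^sub>\<infinity>k\<in>K. (hnorm (H k) (direct_sum K \<rho> x u k))\<^sup>2) \<le> (\<Sum>\<^sub>\<infinity>k\<in>K. b\<^sup>2 * sq u k)"
    using le by (intro infsum_mono carrierD(2)[OF car] summable) (simp add: direct_sum_def)
  also have "\<dots> = b\<^sup>2 * (\<Sum>\<^sub>\<infinity>k\<in>K. sq u k)" by (rule infsum_cmult_right')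
  finally have "sqrt (\<Sum>\<^sub>\<infinity>k\<in>K. (hnorm (H k) (direct_sum K \<rho> x u k))\<^sup>2) \<le>
      sqrt (b\<^sup>2 * (\<Sum>\<^sub>\<infinity>k\<in>K. sq u k))"
    by (rule real_sqrt_le_mono)
  then show "hnorm S (direct_sum K \<rho> x u) \<le> b * hnorm S u"
    using b(2) by (simp add: hnorm_sum car u real_sqrt_mult)
qed

lemma star_hom_into_operators_direct_sum:
  assumes \<rho>: "\<And>k. k \<in> K \<Longrightarrow> star_hom_into_operators (H k) (\<rho> k)"
    and b: "\<And>k x. k \<in> K \<Longrightarrow> operator_norm (H k) (\<rho> k x) \<le> b x" "\<And>x. 0 \<le> b x"
  shows "star_hom_into_operators S (direct_sum K \<rho>)"
proof -
  note db = direct_sum_bound[OF \<rho> b(1) b(2)]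
  have bo: "\<rho> k x \<in> bounded_operators (H k)" if "k \<in> K" for k x
    using \<rho>[OF that] by (simp add: star_hom_into_operators_def)
  have lin: "\<rho> k x (hadd (H k) u v) = hadd (H k) (\<rho> k x u) (\<rho> k x v)"
    "\<rho> k x (hscale (H k) a u) = hscale (H k) a (\<rho> k x u)"
    if "k \<in> K" "u \<in> hcarrier (H k)" "v \<in> hcarrier (H k)" for k x u v a
    using bo[OF that(1), of x] that(2,3) by (auto simp: bounded_operators_def)
  have "direct_sum K \<rho> x \<in> bounded_operators S" for x
    unfolding bounded_operators_def
  proof (intro CollectI conjI ballI allI)
    show "direct_sum K \<rho> x \<in> hcarrier S \<rightarrow> hcarrier S" using db(1) by blast
    show "\<exists>c. \<forall>u\<in>hcarrier S. hnorm S (direct_sum K \<rho> x u) \<le> c * hnorm S u" using db(2) by blast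
    fix u v assume c: "u \<in> hcarrier S" "v \<in> hcarrier S"
    show "direct_sum K \<rho> x (hadd S u v) = hadd S (direct_sum K \<rho> x u) (direct_sum K \<rho> x v)"
      unfolding direct_sum_def sum_simps using lin(1) carrierD(1)[OF c(1)] carrierD(1)[OF c(2)]
      by (auto simp: fun_eq_iff)
  next
    fix a u assume c: "u \<in> hcarrier S"
    show "direct_sum K \<rho> x (hscale S a u) = hscale S a (direct_sum K \<rho> x u)"
      unfolding direct_sum_def sum_simps using lin(2)[OF _ carrierD(1)[OF c] carrierD(1)[OF c]]
      by (auto simp: fun_eq_iff)
  qed
  moreover have "direct_sum K \<rho> (x + y) u = hadd S (direct_sum K \<rho> x u) (direct_sum K \<rho> y u)"
    "direct_sum K \<rho> (a *\<^sub>C x) u = hscale S a (direct_sum K \<rho> x u)"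
    "direct_sum K \<rho> (x * y) u = direct_sum K \<rho> x (direct_sum K \<rho> y u)"
    if "u \<in> hcarrier S" for x y a u
    unfolding direct_sum_def sum_simps using \<rho> carrierD(1)[OF that]
    by (auto simp: fun_eq_iff star_hom_into_operators_def)
  moreover have "hinner S (direct_sum K \<rho> x u) v = hinner S u (direct_sum K \<rho> (star x) v)"
    if "u \<in> hcarrier S" "v \<in> hcarrier S" for x u v
    unfolding direct_sum_def sum_simps using \<rho> carrierD(1)[OF that(1)] carrierD(1)[OF that(2)]
    by (intro infsum_cong) (auto simp: star_hom_into_operators_def)
  ultimately show ?thesis unfolding star_hom_into_operators_def by blast
qed

end

section \<open>The GNS construction\<close>

lemma seminorm_CauchyD:
  "seminorm_Cauchy n X \<Longrightarrow> 0 < e \<Longrightarrow> \<exists>N. \<forall>m\<ge>N. \<forall>k\<ge>N. n (X m - X k) < e"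
  by (simp add: seminorm_Cauchy_def)

text \<open>A positive, possibly degenerate form on a *-algebra for which left multiplication by
  \<open>x\<close> is bounded by \<open>C x\<close>. The intended case is
  \<open>S x y = \<psi> (h (star y * x))\<close> with \<open>C x = norm (h x)\<close>, linear in the
  first argument like \<open>hinner\<close>.\<close>

locale gns_form =
  fixes S :: "'b::complex_star_algebra \<Rightarrow> 'b \<Rightarrow> complex" and C :: "'b \<Rightarrow> real"
  assumes form_add_left: "S (x + y) z = S x z + S y z"
    and form_scale_left: "S (a *\<^sub>C x) z = a * S x z"
    and form_commute: "S x y = cnj (S y x)"
    and form_nonneg: "0 \<le> Re (S x x)"
    and form_adjoint: "S (x * y) z = S y (star x * z)"
    and form_bound: "Re (S (x * y) (x * y)) \<le> (C x)\<^sup>2 * Re (S y y)"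
    and bound_nonneg: "0 \<le> C x"
begin

definition n :: "'b \<Rightarrow> real" where
  "n x = sqrt (Re (S x x))"

lemma form_add_right: "S z (x + y) = S z x + S z y"
  using form_commute[of z "x + y"] form_commute[of z x] form_commute[of z y]
  by (simp add: form_add_left)

lemma form_scale_right: "S z (a *\<^sub>C x) = cnj a * S z x"
  using form_commute[of z "a *\<^sub>C x"] form_commute[of z x] by (simp add: form_scale_left)

lemma form_minus_left: "S (- x) z = - S x z"
  using form_scale_left[of "-1" x z] by simp

lemma form_minus_right: "S z (- x) = - S z x"
  using form_scale_right[of z "-1" x] by simp

lemma form_diff_left: "S (x - y) z = S x z - S y z"
  using form_add_left[of x "- y" z] form_minus_left[of y z] by simp

lemma form_diff_right: "S z (x - y) = S z x - S z y"
  using form_add_right[of z x "- y"] form_minus_right[of z y] by simp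

lemma n_nonneg: "0 \<le> n x"
  by (simp add: n_def form_nonneg)

lemma n_power2: "(n x)\<^sup>2 = Re (S x x)"
  by (simp add: n_def form_nonneg)

lemma n_scale: "n (a *\<^sub>C x) = cmod a * n x"
proof -
  have "S (a *\<^sub>C x) (a *\<^sub>C x) = complex_of_real ((cmod a)\<^sup>2) * S x x"
    unfolding complex_norm_square by (simp add: form_scale_left form_scale_right)
  then show ?thesis by (simp add: n_def real_sqrt_mult)
qed

lemma n_add_power2: "(n (x + y))\<^sup>2 = (n x)\<^sup>2 + 2 * Re (S x y) + (n y)\<^sup>2"
  using form_commute[of y x] by (simp add: n_power2 form_add_left form_add_right)

lemma form_cauchy_schwarz: "cmod (S x y) \<le> n x * n y"
proof -
  have "(cmod (S x y))\<^sup>2 \<le> (n x)\<^sup>2 * (n y)\<^sup>2"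
  proof (rule complex_cauchy_schwarz_form)
    fix a
    have "0 \<le> (n (x + a *\<^sub>C y))\<^sup>2" by simp
    then show "0 \<le> (n x)\<^sup>2 + 2 * Re (cnj a * S x y) + (cmod a)\<^sup>2 * (n y)\<^sup>2"
      by (simp add: n_add_power2 n_scale form_scale_right power_mult_distrib)
  qed simp
  then have "(cmod (S x y))\<^sup>2 \<le> (n x * n y)\<^sup>2" by (simp add: power_mult_distrib)
  then show ?thesis by (rule power2_le_imp_le) (simp add: n_nonneg)
qed

lemma n_triangle: "n (x + y) \<le> n x + n y"
proof (rule power2_le_imp_le)
  have "Re (S x y) \<le> n x * n y"
    using complex_Re_le_cmod form_cauchy_schwarz by (rule order_trans)
  then show "(n (x + y))\<^sup>2 \<le> (n x + n y)\<^sup>2" by (simp add: n_add_power2 power2_sum)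
qed (simp add: n_nonneg)

lemma n_minus: "n (- x) = n x"
  using n_scale[of "-1" x] by simp

lemma n_diff_commute: "n (x - y) = n (y - x)"
  using n_minus[of "x - y"] by simp

lemma n_diff_triangle: "n (x - z) \<le> n (x - y) + n (y - z)"
  using n_triangle[of "x - y" "y - z"] by simp

lemma n_le: "n x \<le> n (x - y) + n y"
  using n_triangle[of "x - y" y] by simp

lemma n_zero: "n 0 = 0"
  using n_scale[of 0 0] by simp

lemma n_mult: "n (x * y) \<le> C x * n y"
proof (rule power2_le_imp_le)
  show "(n (x * y))\<^sup>2 \<le> (C x * n y)\<^sup>2" using form_bound by (simp add: n_power2 power_mult_distrib)
qed (simp add: n_nonneg bound_nonneg)

section \<open>Cauchy sequences and their chosen representatives\<close>

abbreviation Q :: "(nat \<Rightarrow> 'b) \<Rightarrow> bool" where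
  "Q \<equiv> seminorm_Cauchy n"

definition equiv_seq :: "(nat \<Rightarrow> 'b) \<Rightarrow> (nat \<Rightarrow> 'b) \<Rightarrow> bool" where
  "equiv_seq X Y \<longleftrightarrow> (\<lambda>k. n (X k - Y k)) \<longlonglongrightarrow> 0"

lemma equiv_seq_refl: "equiv_seq X X"
  by (simp add: equiv_seq_def n_zero)

lemma equiv_seq_sym: "equiv_seq X Y \<Longrightarrow> equiv_seq Y X"
  unfolding equiv_seq_def by (subst n_diff_commute)

lemma n_null_comparison:
  assumes "f \<longlonglongrightarrow> 0" "\<And>k. n (X k) \<le> f k"
  shows "(\<lambda>k. n (X k)) \<longlonglongrightarrow> 0"
  by (rule Lim_null_comparison[OF _ assms(1)]) (use assms(2) in \<open>simp add: n_nonneg\<close>)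

lemma equiv_seq_trans:
  assumes "equiv_seq X Y" "equiv_seq Y Z"
  shows "equiv_seq X Z"
  unfolding equiv_seq_def
  by (rule n_null_comparison[OF tendsto_add_zero[OF assms[unfolded equiv_seq_def]] n_diff_triangle])

lemma equiv_seq_add:
  assumes "equiv_seq X X'" "equiv_seq Y Y'"
  shows "equiv_seq (\<lambda>k. X k + Y k) (\<lambda>k. X' k + Y' k)"
  unfolding equiv_seq_def add_diff_add
  by (rule n_null_comparison[OF tendsto_add_zero[OF assms[unfolded equiv_seq_def]] n_triangle])

lemma equiv_seq_scale:
  assumes "equiv_seq X X'"
  shows "equiv_seq (\<lambda>k. a *\<^sub>C X k) (\<lambda>k. a *\<^sub>C X' k)"
  using tendsto_mult_right_zero[OF assms[unfolded equiv_seq_def], of "cmod a"]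
  by (simp add: equiv_seq_def complex_vector.scale_right_diff_distrib[symmetric] n_scale)

lemma equiv_seq_mult:
  assumes "equiv_seq X X'"
  shows "equiv_seq (\<lambda>k. x * X k) (\<lambda>k. x * X' k)"
  unfolding equiv_seq_def right_diff_distrib[symmetric]
  by (rule n_null_comparison[OF tendsto_mult_right_zero[OF assms[unfolded equiv_seq_def]] n_mult])

lemma Q_const: "Q (\<lambda>_. x)"
  by (simp add: seminorm_Cauchy_def n_zero)

lemma Q_add:
  assumes X: "Q X" and Y: "Q Y"
  shows "Q (\<lambda>k. X k + Y k)"
  unfolding seminorm_Cauchy_def
proof (intro allI impI)
  fix e :: real assume e: "0 < e"
  obtain N where N: "\<forall>m\<ge>N. \<forall>k\<ge>N. n (X m - X k) < e / 2"
    using seminorm_CauchyD[OF X, of "e / 2"] e by auto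
  obtain M where M: "\<forall>m\<ge>M. \<forall>k\<ge>M. n (Y m - Y k) < e / 2"
    using seminorm_CauchyD[OF Y, of "e / 2"] e by auto
  show "\<exists>N. \<forall>m\<ge>N. \<forall>k\<ge>N. n (X m + Y m - (X k + Y k)) < e"
  proof (intro exI allI impI)
    fix m k assume "max N M \<le> m" "max N M \<le> k"
    then have "n (X m - X k) < e / 2" "n (Y m - Y k) < e / 2" using N M by auto
    then show "n (X m + Y m - (X k + Y k)) < e"
      using n_triangle[of "X m - X k" "Y m - Y k"] by (simp add: add_diff_add)
  qed
qed

lemma Q_bounded_image:
  assumes X: "Q X" and c: "0 \<le> c" "\<And>m k. n (Y m - Y k) \<le> c * n (X m - X k)"
  shows "Q Y"
  unfolding seminorm_Cauchy_def
proof (intro allI impI)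
  fix e :: real assume e: "0 < e"
  then have "0 < e / (c + 1)" using c(1) by simp
  then obtain N where N: "\<forall>m\<ge>N. \<forall>k\<ge>N. n (X m - X k) < e / (c + 1)"
    using seminorm_CauchyD[OF X] by blast
  show "\<exists>N. \<forall>m\<ge>N. \<forall>k\<ge>N. n (Y m - Y k) < e"
  proof (intro exI allI impI)
    fix m k assume "N \<le> m" "N \<le> k"
    then have lt: "n (X m - X k) < e / (c + 1)" using N by blast
    have "n (Y m - Y k) \<le> (c + 1) * n (X m - X k)"
      using c(2)[of m k] n_nonneg[of "X m - X k"] by (simp add: distrib_right)
    also have "\<dots> < e" using lt c(1) by (simp add: field_simps)
    finally show "n (Y m - Y k) < e" .
  qed
qed

lemma Q_scale: "Q X \<Longrightarrow> Q (\<lambda>k. a *\<^sub>C X k)"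
  by (rule Q_bounded_image[of X "cmod a"])
    (simp_all add: complex_vector.scale_right_diff_distrib[symmetric] n_scale)

lemma Q_mult: "Q X \<Longrightarrow> Q (\<lambda>k. x * X k)"
  by (rule Q_bounded_image[of X "C x"])
    (simp_all add: right_diff_distrib[symmetric] n_mult bound_nonneg)

lemma Q_minus: "Q X \<Longrightarrow> Q (\<lambda>k. - X k)"
  using Q_scale[of X "-1"] by simp

lemma Q_diff: "Q X \<Longrightarrow> Q Y \<Longrightarrow> Q (\<lambda>k. X k - Y k)"
  using Q_add[OF _ Q_minus, of X Y] by simp

lemma Q_bounded:
  assumes "Q X"
  obtains B where "0 \<le> B" "\<And>k. n (X k) \<le> B"
proof -
  obtain N where N: "\<forall>m\<ge>N. \<forall>k\<ge>N. n (X m - X k) < 1"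
    using seminorm_CauchyD[OF assms, of 1] by auto
  let ?B = "(\<Sum>k\<le>N. n (X k)) + 1"
  have "n (X k) \<le> ?B" for k
  proof (cases "k \<le> N")
    case True
    then have "n (X k) \<le> (\<Sum>k\<le>N. n (X k))" by (intro member_le_sum) (auto simp: n_nonneg)
    then show ?thesis by simp
  next
    case False
    then have "n (X k - X N) < 1" using N by simp
    moreover have "n (X N) \<le> (\<Sum>k\<le>N. n (X k))" by (intro member_le_sum) (auto simp: n_nonneg)
    ultimately show ?thesis using n_le[of "X k" "X N"] by simp
  qed
  moreover have "0 \<le> ?B" by (simp add: sum_nonneg n_nonneg)
  ultimately show thesis using that by blast
qed

lemma form_diff_le: "cmod (S x y - S x' y') \<le> n (x - x') * n y + n x' * n (y - y')"
proof -
  have "S x y - S x' y' = S (x - x') y + S x' (y - y')" by (simp add: form_diff_left form_diff_right)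
  then show ?thesis
    using norm_triangle_ineq[of "S (x - x') y" "S x' (y - y')"]
      form_cauchy_schwarz[of "x - x'" y] form_cauchy_schwarz[of x' "y - y'"] by simp
qed

lemma form_convergent:
  assumes X: "Q X" and Y: "Q Y"
  shows "convergent (\<lambda>k. S (X k) (Y k))"
proof (rule Cauchy_convergent, rule CauchyI)
  fix e :: real assume e: "0 < e"
  obtain B where B: "0 \<le> B" "\<And>k. n (Y k) \<le> B" using Q_bounded[OF Y] by blast
  obtain D where D: "0 \<le> D" "\<And>k. n (X k) \<le> D" using Q_bounded[OF X] by blast
  define d where "d = e / (B + D + 1)"
  have d: "0 < d" using e B(1) D(1) by (simp add: d_def)
  obtain N where N: "\<forall>m\<ge>N. \<forall>k\<ge>N. n (X m - X k) < d" using seminorm_CauchyD[OF X d] by blast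
  obtain M where M: "\<forall>m\<ge>M. \<forall>k\<ge>M. n (Y m - Y k) < d" using seminorm_CauchyD[OF Y d] by blast
  show "\<exists>M. \<forall>m\<ge>M. \<forall>k\<ge>M. norm (S (X m) (Y m) - S (X k) (Y k)) < e"
  proof (intro exI allI impI)
    fix m k assume "max N M \<le> m" "max N M \<le> k"
    then have "n (X m - X k) \<le> d" "n (Y m - Y k) \<le> d" using N M by (auto intro: less_imp_le)
    then have "n (X m - X k) * n (Y m) + n (X k) * n (Y m - Y k) \<le> d * B + D * d"
      using B D d by (intro add_mono mult_mono) (auto simp: n_nonneg)
    also have "\<dots> < d * (B + D + 1)" using d by (simp add: algebra_simps)
    also have "\<dots> = e" using B(1) D(1) by (simp add: d_def)
    finally show "norm (S (X m) (Y m) - S (X k) (Y k)) < e"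
      using form_diff_le[of "X m" "Y m" "X k" "Y k"] by simp
  qed
qed

lemma form_equiv_null:
  assumes X: "Q X'" "equiv_seq X X'" and Y: "Q Y" "equiv_seq Y Y'"
  shows "(\<lambda>k. S (X k) (Y k) - S (X' k) (Y' k)) \<longlonglongrightarrow> 0"
proof -
  obtain B where B: "0 \<le> B" "\<And>k. n (Y k) \<le> B" using Q_bounded[OF Y(1)] by blast
  obtain D where D: "0 \<le> D" "\<And>k. n (X' k) \<le> D" using Q_bounded[OF X(1)] by blast
  have "(\<lambda>k. n (X k - X' k) * B + D * n (Y k - Y' k)) \<longlonglongrightarrow> 0"
    using X(2) Y(2) unfolding equiv_seq_def
    by (intro tendsto_add_zero tendsto_mult_left_zero tendsto_mult_right_zero)
  then show ?thesis
  proof (rule Lim_null_comparison[rotated], intro always_eventually allI)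
    fix k
    have "n (X k - X' k) * n (Y k) + n (X' k) * n (Y k - Y' k) \<le> n (X k - X' k) * B + D * n (Y k - Y' k)"
      using B D by (intro add_mono mult_mono) (auto simp: n_nonneg)
    with form_diff_le[of "X k" "Y k" "X' k" "Y' k"]
    show "norm (S (X k) (Y k) - S (X' k) (Y' k)) \<le> n (X k - X' k) * B + D * n (Y k - Y' k)" by simp
  qed
qed

text \<open>A chosen representative of the class of a Cauchy sequence, so that the completion has
  sequences, rather than sets of sequences, as elements.\<close>

definition canon :: "(nat \<Rightarrow> 'b) \<Rightarrow> nat \<Rightarrow> 'b" where
  "canon X = (SOME Y. Q Y \<and> equiv_seq Y X)"

lemma canon:
  assumes "Q X"
  shows "Q (canon X)" "equiv_seq (canon X) X"
  unfolding canon_def using someI[of "\<lambda>Y. Q Y \<and> equiv_seq Y X" X] assms equiv_seq_refl by auto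

text \<open>Equivalent sequences define the same predicate for the choice operator, hence the same
  choice.\<close>

lemma canon_eq_iff:
  assumes "Q X" "Q Y"
  shows "canon X = canon Y \<longleftrightarrow> equiv_seq X Y"
proof
  assume "canon X = canon Y"
  then have "equiv_seq (canon X) Y" using canon(2)[OF assms(2)] by simp
  with equiv_seq_sym[OF canon(2)[OF assms(1)]] show "equiv_seq X Y" by (rule equiv_seq_trans)
next
  assume XY: "equiv_seq X Y"
  have "equiv_seq Z X \<longleftrightarrow> equiv_seq Z Y" for Z
    using equiv_seq_trans[OF _ XY] equiv_seq_trans[OF _ equiv_seq_sym[OF XY]] by blast
  then show "canon X = canon Y" by (simp add: canon_def)
qed

text \<open>\<open>Inl\<close> places the sequence in the summand of \<open>hilbert_universe\<close>
  that consists of sequences.\<close>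

definition point :: "(nat \<Rightarrow> 'b) \<Rightarrow> (nat \<Rightarrow> 'b) + 'u" where
  "point X = Inl (canon X)"

definition gns_space :: "((nat \<Rightarrow> 'b) + 'u) hilbert" where
  "gns_space = \<lparr>
    hcarrier = point ` {X. Q X},
    hzero = point (\<lambda>_. 0),
    hadd = (\<lambda>u v. point (\<lambda>k. projl u k + projl v k)),
    hscale = (\<lambda>a u. point (\<lambda>k. a *\<^sub>C projl u k)),
    hinner = (\<lambda>u v. lim (\<lambda>k. S (projl u k) (projl v k)))\<rparr>"

definition gns_map :: "'b \<Rightarrow> (nat \<Rightarrow> 'b) + 'u \<Rightarrow> (nat \<Rightarrow> 'b) + 'u" where
  "gns_map x u = point (\<lambda>k. x * projl u k)"

abbreviation G :: "((nat \<Rightarrow> 'b) + 'u) hilbert" where "G \<equiv> gns_space"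

lemma point_eq_iff: "Q X \<Longrightarrow> Q Y \<Longrightarrow> point X = point Y \<longleftrightarrow> equiv_seq X Y"
  by (simp add: point_def canon_eq_iff)

lemma point_carrier: "Q X \<Longrightarrow> point X \<in> hcarrier G"
  by (simp add: gns_space_def)

lemma carrier_cases:
  assumes "u \<in> hcarrier G"
  obtains X where "Q X" "u = point X"
  using assms by (auto simp: gns_space_def)

lemma hzero_G: "hzero G = point (\<lambda>_. 0)"
  by (simp add: gns_space_def)

lemma hadd_point:
  assumes "Q X" "Q Y"
  shows "hadd G (point X) (point Y) = point (\<lambda>k. X k + Y k)"
proof -
  have "hadd G (point X) (point Y) = point (\<lambda>k. canon X k + canon Y k)"
    by (simp add: gns_space_def point_def)
  also have "\<dots> = point (\<lambda>k. X k + Y k)"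
    using assms canon by (subst point_eq_iff) (auto intro!: Q_add equiv_seq_add)
  finally show ?thesis .
qed

lemma hscale_point:
  assumes "Q X"
  shows "hscale G a (point X) = point (\<lambda>k. a *\<^sub>C X k)"
proof -
  have "hscale G a (point X) = point (\<lambda>k. a *\<^sub>C canon X k)"
    by (simp add: gns_space_def point_def)
  also have "\<dots> = point (\<lambda>k. a *\<^sub>C X k)"
    using assms canon by (subst point_eq_iff) (auto intro!: Q_scale equiv_seq_scale)
  finally show ?thesis .
qed

lemma gns_map_point:
  assumes "Q X"
  shows "gns_map x (point X) = point (\<lambda>k. x * X k)"
proof -
  have "gns_map x (point X) = point (\<lambda>k. x * canon X k)"
    by (simp add: gns_map_def point_def)
  also have "\<dots> = point (\<lambda>k. x * X k)"
    using assms canon by (subst point_eq_iff) (auto intro!: Q_mult equiv_seq_mult)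
  finally show ?thesis .
qed

lemma hdiff_point: "Q X \<Longrightarrow> Q Y \<Longrightarrow> hdiff G (point X) (point Y) = point (\<lambda>k. X k - Y k)"
  by (simp add: hdiff_def hscale_point hadd_point Q_minus)

text \<open>The inner product is defined by the chosen representatives; this allows computing it
  with any representatives.\<close>

lemma tendsto_hinner:
  assumes X: "Q X" and Y: "Q Y"
  shows "(\<lambda>k. S (X k) (Y k)) \<longlonglongrightarrow> hinner G (point X) (point Y)"
proof -
  have "(\<lambda>k. S (canon X k) (canon Y k)) \<longlonglongrightarrow> hinner G (point X) (point Y)"
    using form_convergent[OF canon(1)[OF X] canon(1)[OF Y]]
    by (simp add: gns_space_def point_def convergent_LIMSEQ_iff)
  moreover have "(\<lambda>k. S (X k) (Y k) - S (canon X k) (canon Y k)) \<longlonglongrightarrow> 0"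
    using X Y canon equiv_seq_sym by (intro form_equiv_null) auto
  ultimately show ?thesis by (rule Lim_transform)
qed

lemma hinner_eqI:
  "Q X \<Longrightarrow> Q Y \<Longrightarrow> (\<lambda>k. S (X k) (Y k)) \<longlonglongrightarrow> l \<Longrightarrow> hinner G (point X) (point Y) = l"
  by (rule LIMSEQ_unique[OF tendsto_hinner])

lemma tendsto_hnorm:
  assumes X: "Q X"
  shows "(\<lambda>k. n (X k)) \<longlonglongrightarrow> hnorm (G :: ((nat \<Rightarrow> 'b) + 'u) hilbert) (point X)"
  unfolding n_def hnorm_def by (intro tendsto_real_sqrt tendsto_Re tendsto_hinner X)

lemma hnorm_le:
  assumes X: "Q X" and "\<And>k. N \<le> k \<Longrightarrow> n (X k) \<le> c"
  shows "hnorm G (point X) \<le> c"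
  by (rule LIMSEQ_le_const2[OF tendsto_hnorm[OF X]]) (use assms(2) in blast)

text \<open>A diagonal sequence: \<open>Z m\<close> is the term of a representative of
  \<open>U m\<close> from which on that representative moves by less than
  \<open>1 / real (Suc m)\<close>.\<close>

lemma gns_space_complete:
  fixes U :: "nat \<Rightarrow> (nat \<Rightarrow> 'b) + 'u"
  assumes U: "\<And>m. U m \<in> hcarrier G"
    and Cauchy: "\<And>e. 0 < e \<Longrightarrow> \<exists>N. \<forall>m\<ge>N. \<forall>l\<ge>N. hnorm G (hdiff G (U m) (U l)) < e"
  shows "\<exists>u\<in>hcarrier G. (\<lambda>m. hnorm G (hdiff G (U m) u)) \<longlonglongrightarrow> 0"
proof -
  have "\<forall>m. \<exists>X. Q X \<and> U m = point X" using carrier_cases[OF U] by blast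
  from choice[OF this] obtain X where X: "\<And>m. Q (X m)" "\<And>m. U m = point (X m)" by blast
  have "\<forall>m. \<exists>K. \<forall>k\<ge>K. n (X m k - X m K) < 1 / real (Suc m)"
  proof
    fix m
    obtain K where "\<forall>i\<ge>K. \<forall>k\<ge>K. n (X m i - X m k) < 1 / real (Suc m)"
      using seminorm_CauchyD[OF X(1)[of m], of "1 / real (Suc m)"] by auto
    then show "\<exists>K. \<forall>k\<ge>K. n (X m k - X m K) < 1 / real (Suc m)" by blast
  qed
  from choice[OF this]
  obtain K where K: "\<And>m k. K m \<le> k \<Longrightarrow> n (X m k - X m (K m)) < 1 / real (Suc m)" by blast
  define Z where "Z m = X m (K m)" for m
  have inv: "\<exists>N. \<forall>m\<ge>N. 1 / real (Suc m) < e" if e: "0 < e" for e :: real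
  proof -
    obtain N where "inverse (real (Suc N)) < e" using reals_Archimedean[OF e] by blast
    then have N: "1 / real (Suc N) < e" by (simp add: inverse_eq_divide)
    have "1 / real (Suc m) \<le> 1 / real (Suc N)" if "N \<le> m" for m
      using that by (intro divide_left_mono) auto
    with N show ?thesis by (intro exI[of _ N]) (auto intro: le_less_trans)
  qed
  have QZ: "Q Z"
    unfolding seminorm_Cauchy_def
  proof (intro allI impI)
    fix e :: real assume e: "0 < e"
    then have e3: "0 < e / 3" by simp
    obtain N where N: "\<forall>m\<ge>N. \<forall>l\<ge>N. hnorm G (hdiff G (U m) (U l)) < e / 3" using Cauchy[OF e3] by blast
    obtain M where M: "\<forall>m\<ge>M. 1 / real (Suc m) < e / 3" using inv[OF e3] by blast
    show "\<exists>N. \<forall>m\<ge>N. \<forall>l\<ge>N. n (Z m - Z l) < e"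
    proof (intro exI allI impI)
      fix m l assume ml: "max N M \<le> m" "max N M \<le> l"
      have "(\<lambda>k. n (X m k - X l k)) \<longlonglongrightarrow> hnorm G (hdiff G (U m) (U l))"
        unfolding X(2) hdiff_point[OF X(1) X(1)] by (rule tendsto_hnorm[OF Q_diff[OF X(1) X(1)]])
      moreover have "hnorm G (hdiff G (U m) (U l)) < e / 3" using N ml by simp
      ultimately have "\<forall>\<^sub>F k in sequentially. n (X m k - X l k) < e / 3" by (rule order_tendstoD)
      then obtain k0 where k0: "\<And>k. k0 \<le> k \<Longrightarrow> n (X m k - X l k) < e / 3"
        by (auto simp: eventually_sequentially)
      \<comment> \<open>An auxiliary index so late that \<open>Z m\<close> and \<open>Z l\<close>
        can be compared through \<open>X m k\<close> and \<open>X l k\<close>.\<close>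
      define k where "k = max k0 (max (K m) (K l))"
      have "n (X m k - X l k) < e / 3" by (rule k0) (simp add: k_def)
      moreover have "n (Z m - X m k) < e / 3"
      proof -
        have "n (X m k - X m (K m)) < 1 / real (Suc m)" by (rule K) (simp add: k_def)
        also have "\<dots> < e / 3" using M ml by simp
        finally show ?thesis unfolding Z_def by (subst n_diff_commute)
      qed
      moreover have "n (X l k - Z l) < e / 3"
      proof -
        have "n (X l k - X l (K l)) < 1 / real (Suc l)" by (rule K) (simp add: k_def)
        also have "\<dots> < e / 3" using M ml by simp
        finally show ?thesis unfolding Z_def .
      qed
      ultimately show "n (Z m - Z l) < e"
        using n_diff_triangle[of "Z m" "Z l" "X m k"] n_diff_triangle[of "X m k" "Z l" "X l k"] by linarith
    qed
  qed
  have "(\<lambda>m. hnorm G (hdiff G (U m) (point Z))) \<longlonglongrightarrow> 0"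
  proof (rule LIMSEQ_I)
    fix e :: real assume e: "0 < e"
    then have e3: "0 < e / 3" by simp
    obtain N where N: "\<forall>m\<ge>N. \<forall>l\<ge>N. n (Z m - Z l) < e / 3" using seminorm_CauchyD[OF QZ e3] by blast
    obtain M where M: "\<forall>m\<ge>M. 1 / real (Suc m) < e / 3" using inv[OF e3] by blast
    show "\<exists>N. \<forall>m\<ge>N. norm (hnorm G (hdiff G (U m) (point Z)) - 0) < e"
    proof (intro exI allI impI)
      fix m assume m: "max N M \<le> m"
      have eq: "hdiff G (U m) (point Z) = point (\<lambda>k. X m k - Z k)"
        unfolding X(2) by (rule hdiff_point[OF X(1) QZ])
      have Qd: "Q (\<lambda>k. X m k - Z k)" by (rule Q_diff[OF X(1) QZ])
      have "hnorm G (point (\<lambda>k. X m k - Z k) :: _ + 'u) \<le> 2 * (e / 3)"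
      proof (rule hnorm_le[OF Qd, of "max N (K m)"])
        fix k assume k: "max N (K m) \<le> k"
        have "n (X m k - Z m) < 1 / real (Suc m)" unfolding Z_def by (rule K) (use k in simp)
        moreover have "1 / real (Suc m) < e / 3" using M m by simp
        moreover have "n (Z m - Z k) < e / 3" using N m k by simp
        ultimately show "n (X m k - Z k) \<le> 2 * (e / 3)"
          using n_diff_triangle[of "X m k" "Z k" "Z m"] by linarith
      qed
      moreover have "0 \<le> hnorm G (point (\<lambda>k. X m k - Z k) :: _ + 'u)"
        by (rule LIMSEQ_le_const[OF tendsto_hnorm[OF Qd]]) (simp add: n_nonneg)
      ultimately show "norm (hnorm G (hdiff G (U m) (point Z)) - 0) < e"
        using e by (simp add: eq)
    qed
  qed
  then show ?thesis using point_carrier[OF QZ] by blast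
qed

lemma hilbert_space_gns: "hilbert_space (G :: ((nat \<Rightarrow> 'b) + 'u) hilbert)"
proof
  note Qs = Q_add Q_scale Q_const
  note ps = hadd_point hscale_point hdiff_point hzero_G
  show "hzero G \<in> hcarrier G" by (simp add: hzero_G point_carrier Q_const)
  fix u v w :: "(nat \<Rightarrow> 'b) + 'u" and a b
  assume "u \<in> hcarrier G"
  then obtain X where X: "Q X" "u = point X" by (rule carrier_cases)
  show "hscale G a u \<in> hcarrier G" using X by (simp add: ps point_carrier Qs)
  show "hadd G (hzero G) u = u" using X by (simp add: ps Qs)
  show "hdiff G u u = hzero G" using X by (simp add: ps Qs)
  show "hscale G (a + b) u = hadd G (hscale G a u) (hscale G b u)"
    using X by (simp add: ps Qs scaleC_add_left)
  show "hscale G a (hscale G b u) = hscale G (a * b) u" using X by (simp add: ps Qs scaleC_scaleC)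
  show "hscale G 1 u = u" using X by (simp add: ps Qs scaleC_one)
  show "0 \<le> Re (hinner G u u)"
    unfolding X(2) by (rule LIMSEQ_le_const[OF tendsto_Re[OF tendsto_hinner[OF X(1) X(1)]]])
      (simp add: form_nonneg)
  show "u = hzero G" if "hinner G u u = 0"
  proof -
    have "(\<lambda>k. n (X k)) \<longlonglongrightarrow> 0"
      using tendsto_hnorm[OF X(1), where 'u = 'u] that by (simp add: hnorm_def X(2))
    then have "equiv_seq X (\<lambda>_. 0)" by (simp add: equiv_seq_def)
    then show ?thesis using X by (simp add: hzero_G point_eq_iff Q_const)
  qed
  assume "v \<in> hcarrier G"
  then obtain Y where Y: "Q Y" "v = point Y" by (rule carrier_cases)
  show "hadd G u v \<in> hcarrier G" using X Y by (simp add: ps point_carrier Qs)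
  show "hadd G u v = hadd G v u" using X Y by (simp add: ps Qs add.commute)
  show "hscale G a (hadd G u v) = hadd G (hscale G a u) (hscale G a v)"
    using X Y by (simp add: ps Qs scaleC_add_right)
  have "(\<lambda>k. S (a *\<^sub>C X k) (Y k)) \<longlonglongrightarrow> a * hinner G u v"
    unfolding form_scale_left X(2) Y(2) by (rule tendsto_mult_left[OF tendsto_hinner[OF X(1) Y(1)]])
  from hinner_eqI[OF Q_scale[OF X(1)] Y(1) this]
  show "hinner G (hscale G a u) v = a * hinner G u v" by (simp add: X Y hscale_point)
  have "(\<lambda>k. S (X k) (Y k)) \<longlonglongrightarrow> cnj (hinner G v u)"
    unfolding X(2) Y(2) by (subst form_commute) (rule tendsto_cnj[OF tendsto_hinner[OF Y(1) X(1)]])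
  from hinner_eqI[OF X(1) Y(1) this]
  show "hinner G u v = cnj (hinner G v u)" by (simp add: X Y)
  assume "w \<in> hcarrier G"
  then obtain Z where Z: "Q Z" "w = point Z" by (rule carrier_cases)
  show "hadd G (hadd G u v) w = hadd G u (hadd G v w)"
    using X Y Z by (simp add: ps Qs add.assoc)
  have "(\<lambda>k. S (X k + Y k) (Z k)) \<longlonglongrightarrow> hinner G u w + hinner G v w"
    unfolding form_add_left X(2) Y(2) Z(2)
    by (rule tendsto_add[OF tendsto_hinner[OF X(1) Z(1)] tendsto_hinner[OF Y(1) Z(1)]])
  from hinner_eqI[OF Q_add[OF X(1) Y(1)] Z(1) this]
  show "hinner G (hadd G u v) w = hinner G u w + hinner G v w"
    by (simp add: X Y Z hadd_point)
qed (rule gns_space_complete)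

lemma hnorm_gns_map_le:
  assumes "u \<in> hcarrier G"
  shows "hnorm G (gns_map x u) \<le> C x * hnorm G u"
proof -
  obtain X where X: "Q X" "u = point X" using assms by (rule carrier_cases)
  show ?thesis
    unfolding X(2) gns_map_point[OF X(1)]
    by (rule LIMSEQ_le[OF tendsto_hnorm[OF Q_mult[OF X(1)]] tendsto_mult_left[OF tendsto_hnorm[OF X(1)]]])
      (simp add: n_mult)
qed

lemma bounded_gns_map: "gns_map x \<in> bounded_operators G"
  unfolding bounded_operators_def
proof (intro CollectI conjI allI ballI)
  note Qs = Q_add Q_scale Q_mult
  note ps = hadd_point hscale_point gns_map_point
  show "\<exists>c. \<forall>u\<in>hcarrier G. hnorm G (gns_map x u) \<le> c * hnorm G u"
    using hnorm_gns_map_le by blast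
  show "gns_map x \<in> hcarrier G \<rightarrow> hcarrier G"
  proof
    fix u :: "(nat \<Rightarrow> 'b) + 'u" assume "u \<in> hcarrier G"
    then obtain X where X: "Q X" "u = point X" by (rule carrier_cases)
    then show "gns_map x u \<in> hcarrier G" by (simp add: gns_map_point point_carrier Q_mult)
  qed
  fix u :: "(nat \<Rightarrow> 'b) + 'u" assume "u \<in> hcarrier G"
  then obtain X where X: "Q X" "u = point X" by (rule carrier_cases)
  show "gns_map x (hscale G a u) = hscale G a (gns_map x u)" for a
    using X by (simp add: ps Qs mult_scaleC_right)
  fix v :: "(nat \<Rightarrow> 'b) + 'u" assume "v \<in> hcarrier G"
  then obtain Y where Y: "Q Y" "v = point Y" by (rule carrier_cases)
  show "gns_map x (hadd G u v) = hadd G (gns_map x u) (gns_map x v)"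
    using X Y by (simp add: ps Qs distrib_left)
qed

lemma star_hom_into_operators_gns: "star_hom_into_operators G gns_map"
  unfolding star_hom_into_operators_def
proof (intro conjI allI ballI bounded_gns_map)
  note Qs = Q_add Q_scale Q_mult
  note ps = hadd_point hscale_point gns_map_point
  fix x y :: 'b and a and u :: "(nat \<Rightarrow> 'b) + 'u"
  assume "u \<in> hcarrier G"
  then obtain X where X: "Q X" "u = point X" by (rule carrier_cases)
  show "gns_map (x + y) u = hadd G (gns_map x u) (gns_map y u)"
    using X by (simp add: ps Qs distrib_right)
  show "gns_map (a *\<^sub>C x) u = hscale G a (gns_map x u)"
    using X by (simp add: ps Qs mult_scaleC_left)
  show "gns_map (x * y) u = gns_map x (gns_map y u)"
    using X by (simp add: ps Qs mult.assoc)
  fix v :: "(nat \<Rightarrow> 'b) + 'u" assume "v \<in> hcarrier G"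
  then obtain Y where Y: "Q Y" "v = point Y" by (rule carrier_cases)
  have "(\<lambda>k. S (x * X k) (Y k)) \<longlonglongrightarrow> hinner G u (gns_map (star x) v)"
    unfolding form_adjoint X(2) Y(2) gns_map_point[OF Y(1)]
    by (rule tendsto_hinner[OF X(1) Q_mult[OF Y(1)]])
  from hinner_eqI[OF Q_mult[OF X(1)] Y(1) this]
  show "hinner G (gns_map x u) v = hinner G u (gns_map (star x) v)"
    by (simp add: X Y gns_map_point)
qed

lemma operator_norm_gns_le: "operator_norm G (gns_map x) \<le> C x"
  by (rule hilbert_space.operator_norm_le[OF hilbert_space_gns hnorm_gns_map_le bound_nonneg])

text \<open>Constant sequences embed the algebra with its seminorm \<open>n\<close>, so the operator
  can be tested on the class of any \<open>y\<close>.\<close>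

lemma n_le_operator_norm_gns:
  "n (x * y) \<le> operator_norm (G :: ((nat \<Rightarrow> 'b) + 'u) hilbert) (gns_map x) * n y"
proof -
  have hn: "hnorm G (point (\<lambda>_. z) :: (nat \<Rightarrow> 'b) + 'u) = n z" for z
    by (rule LIMSEQ_unique[OF tendsto_hnorm[OF Q_const]]) simp
  from hilbert_space.hnorm_le_operator_norm[OF hilbert_space_gns[where 'u = 'u] bounded_gns_map
      point_carrier[OF Q_const], of x y]
  show ?thesis by (simp add: gns_map_point Q_const hn)
qed

end

section \<open>Representations from positive functionals\<close>

text \<open>\<psi> is the complex-linear functional with real part \<open>f\<close>; it is hermitian
  because \<open>f\<close> is invariant under \<open>star\<close>.\<close>

lemma gns_form_positive_functional:
  fixes h :: "'b::complex_star_algebra \<Rightarrow> 'a::cstar_algebra"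
  assumes h: "star_hom h" and f: "positive_functional f"
  defines "\<psi> \<equiv> \<lambda>a. Complex (f a) (- f (\<i> *\<^sub>C a))"
  shows "gns_form (\<lambda>x y. \<psi> (h (star y * x))) (\<lambda>x. norm (h x))"
proof -
  have lin: "linear f" and sa: "\<And>x. f (star x) = f x" and pos: "\<And>x. 0 \<le> f (star x * x)"
    using f by (auto simp: positive_functional_def)
  have Re: "Re (\<psi> a) = f a" for a by (simp add: \<psi>_def)
  have add: "\<psi> (a + b) = \<psi> a + \<psi> b" for a b
    by (simp add: \<psi>_def scaleC_add_right linear_add[OF lin] complex_eq_iff)
  have fc: "f (d *\<^sub>C b) = Re d * f b + Im d * f (\<i> *\<^sub>C b)" for d b
  proof -
    have d: "complex_of_real (Re d) + complex_of_real (Im d) * \<i> = d" by (simp add: complex_eq_iff)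
    have "Re d *\<^sub>R b + Im d *\<^sub>R \<i> *\<^sub>C b = d *\<^sub>C b"
      unfolding scaleR_scaleC scaleC_scaleC scaleC_add_left[symmetric] d ..
    then show ?thesis
      by (metis linear_add[OF lin] linear_cmul[OF lin] real_scaleR_def)
  qed
  have scale: "\<psi> (c *\<^sub>C a) = c * \<psi> a" for c a
    using fc[of "\<i> * c" a] fc[of c a] by (simp add: \<psi>_def scaleC_scaleC complex_eq_iff)
  have star: "\<psi> (star a) = cnj (\<psi> a)" for a
  proof -
    have "star ((- \<i>) *\<^sub>C a) = \<i> *\<^sub>C star a" by (simp add: star_scaleC del: complex_vector.scale_minus_left)
    then have "f (\<i> *\<^sub>C star a) = f ((- \<i>) *\<^sub>C a)" using sa[of "(- \<i>) *\<^sub>C a"] by simp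
    also have "\<dots> = - f (\<i> *\<^sub>C a)" by (simp add: linear_neg[OF lin])
    finally show ?thesis by (simp add: \<psi>_def sa complex_eq_iff)
  qed
  show ?thesis
  proof
    fix x y z :: 'b and a
    show "\<psi> (h (star z * (x + y))) = \<psi> (h (star z * x)) + \<psi> (h (star z * y))"
      by (simp add: distrib_left star_homD[OF h] add)
    show "\<psi> (h (star z * (a *\<^sub>C x))) = a * \<psi> (h (star z * x))"
      by (simp add: mult_scaleC_right star_homD(2)[OF h] scale)
    show "\<psi> (h (star y * x)) = cnj (\<psi> (h (star x * y)))"
      using star[of "h (star x * y)"] by (simp add: star_homD(4)[OF h, symmetric] star_mult star_star)
    show "0 \<le> Re (\<psi> (h (star x * x)))" by (simp add: Re star_homD[OF h] pos)
    show "\<psi> (h (star z * (x * y))) = \<psi> (h (star (star x * z) * y))"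
      by (simp add: star_mult star_star mult.assoc)
    show "Re (\<psi> (h (star (x * y) * (x * y)))) \<le> (norm (h x))\<^sup>2 * Re (\<psi> (h (star y * y)))"
      using positive_functional_mult_le[OF f, of "h x" "h y"] by (simp add: Re star_homD[OF h])
  qed simp
qed

text \<open>The form is pulled back along \<open>h\<close>, so the points of the space are sequences
  in \<open>'b\<close> rather than in the target algebra, as the prescribed universe demands. The
  norm of \<open>h x\<close> is reached on the class of \<open>star x * x\<close>.\<close>

theorem norming_representation:
  fixes h :: "'b::complex_star_algebra \<Rightarrow> 'a::cstar_algebra"
  assumes h: "star_hom h"
  obtains H :: "((nat \<Rightarrow> 'b) + 'u) hilbert" and \<rho> where
    "hilbert_space H" "star_hom_into_operators H \<rho>"
    "\<And>y. operator_norm H (\<rho> y) \<le> norm (h y)" "norm (h x) \<le> operator_norm H (\<rho> x)"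
proof -
  let ?b = "star (h x) * h x"
  have "\<exists>f. positive_functional f \<and> (h x \<noteq> 0 \<longrightarrow> 0 < f (star ?b * ?b) \<and>
      (norm (h x))\<^sup>2 * f (star ?b * ?b) \<le> f (star (h x * ?b) * (h x * ?b)))"
  proof (cases "h x = 0")
    case True
    \<comment> \<open>For \<open>h x = 0\<close> any representation bounded by
      \<open>norm (h y)\<close> will do, and the zero functional supplies one.\<close>
    have "positive_functional (\<lambda>_ :: 'a. 0)" by (simp add: positive_functional_def linear_zero)
    with True show ?thesis by blast
  next
    case False
    from norming_state[OF this] show ?thesis by blast
  qed
  then obtain f where f: "positive_functional f" and fx: "h x \<noteq> 0 \<Longrightarrow> 0 < f (star ?b * ?b)"
    "h x \<noteq> 0 \<Longrightarrow> (norm (h x))\<^sup>2 * f (star ?b * ?b) \<le> f (star (h x * ?b) * (h x * ?b))" by blast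
  let ?\<psi> = "\<lambda>a. Complex (f a) (- f (\<i> *\<^sub>C a))"
  interpret gns_form "\<lambda>x y. ?\<psi> (h (star y * x))" "\<lambda>x. norm (h x)"
    by (rule gns_form_positive_functional[OF h f])
  let ?H = "gns_space :: ((nat \<Rightarrow> 'b) + 'u) hilbert"
  have "norm (h x) \<le> operator_norm ?H (gns_map x)"
  proof (cases "h x = 0")
    case True
    then show ?thesis
      using hilbert_space.operator_norm_nonneg[OF hilbert_space_gns bounded_gns_map] by simp
  next
    case False
    let ?y = "star x * x"
    have ny: "(n z)\<^sup>2 = f (star (h z) * h z)" for z
      by (subst n_power2) (simp add: star_homD[OF h])
    have "0 < (n ?y)\<^sup>2" and le: "(norm (h x))\<^sup>2 * (n ?y)\<^sup>2 \<le> (n (x * ?y))\<^sup>2"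
      unfolding ny using fx[OF False] by (simp_all only: star_homD[OF h])
    then have pos: "0 < n ?y" using n_nonneg[of ?y] by (simp add: less_le)
    have "norm (h x) * n ?y \<le> n (x * ?y)"
      by (rule power2_le_imp_le) (simp_all only: power_mult_distrib le n_nonneg)
    also have "\<dots> \<le> operator_norm ?H (gns_map x) * n ?y" by (rule n_le_operator_norm_gns)
    finally show ?thesis using pos by simp
  qed
  then show thesis
    by (rule that[OF hilbert_space_gns star_hom_into_operators_gns operator_norm_gns_le])
qed

section \<open>Completions\<close>

lemma bounded_linear_scaleC: "bounded_linear (\<lambda>x :: 'a::cstar_algebra. c *\<^sub>C x)"
  using blinfun.bounded_linear_right[of "scaleC_blinfun c"] by (simp add: scaleC_blinfun.rep_eq)

lemma cstar_subalgebra_closure_range: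
  fixes h :: "'b::complex_star_algebra \<Rightarrow> 'a::cstar_algebra"
  assumes h: "star_hom h"
  shows "cstar_subalgebra (closure (range h))"
  unfolding cstar_subalgebra_def
proof (intro conjI ballI complex_vector.subspaceI)
  note hom = star_homD[OF h, symmetric]
  show "0 \<in> closure (range h)"
    by (rule subsetD[OF closure_subset], rule range_eqI[of _ _ 0]) (simp add: star_hom_0[OF h])
  show "closed (closure (range h))" by simp
  fix x assume x: "x \<in> closure (range h)"
  have image: "f x \<in> closure (range h)" if "bounded_linear f" "f ` range h \<subseteq> range h" for f
    using closure_bounded_linear_image_subset[OF that(1), of "range h"] closure_mono[OF that(2)] x
    by blast
  show "c *\<^sub>C x \<in> closure (range h)" for c
    by (rule image[OF bounded_linear_scaleC]) (auto simp: hom)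
  show "star x \<in> closure (range h)"
    by (rule image[OF bounded_linear_star]) (auto simp: hom)
  fix y assume y: "y \<in> closure (range h)"
  from x y obtain X Y where XY: "\<And>n. X n \<in> range h" "X \<longlonglongrightarrow> x" "\<And>n. Y n \<in> range h" "Y \<longlonglongrightarrow> y"
    by (auto simp: closure_sequential)
  have "\<forall>n. X n + Y n \<in> range h" "\<forall>n. X n * Y n \<in> range h"
  proof (safe)
    fix n
    obtain a b where "X n = h a" "Y n = h b" using XY(1)[of n] XY(3)[of n] by blast
    then show "X n + Y n \<in> range h" "X n * Y n \<in> range h"
      by (simp_all add: hom)
  qed
  then show "x + y \<in> closure (range h)" "x * y \<in> closure (range h)"
    unfolding closure_sequential using tendsto_add[OF XY(2,4)] tendsto_mult[OF XY(2,4)]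
    by (intro exI[of _ "\<lambda>n. X n + Y n"] conjI, simp_all) (intro exI[of _ "\<lambda>n. X n * Y n"] conjI, simp_all)
qed

text \<open>A class of Cauchy sequences consists of all sequences whose images have a given limit
  \<open>a\<close>. Completeness of the target provides the limit, density provides a sequence for
  every \<open>a\<close>, and \<open>k\<close> sends the class to \<open>a\<close>.\<close>

lemma completion_isomorphism:
  fixes h :: "'b::complex_star_algebra \<Rightarrow> 'a::cstar_algebra"
  assumes h: "star_hom h" and dense: "closure (range h) = UNIV"
  shows "\<exists>k. star_isomorphism (completion (\<lambda>x. norm (h x))) k \<and>
    (\<forall>x. k (completion_map (\<lambda>x. norm (h x)) x) = h x)"
proof -
  let ?p = "\<lambda>x. norm (h x)"
  define cls where "cls a = {Z. (\<lambda>n. h (Z n)) \<longlonglongrightarrow> a}" for a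
  define k where "k D = lim (\<lambda>n. h (class_rep D n))" for D
  have Cauchy: "seminorm_Cauchy ?p X \<longleftrightarrow> Cauchy (\<lambda>n. h (X n))" for X
    by (simp add: seminorm_Cauchy_def Cauchy_def dist_norm star_hom_diff[OF h])
  have null: "null_class ?p X = cls a" if X: "(\<lambda>n. h (X n)) \<longlonglongrightarrow> a" for X a
  proof (intro set_eqI iffI)
    fix Z assume "Z \<in> null_class ?p X"
    then have "(\<lambda>n. h (Z n) - h (X n)) \<longlonglongrightarrow> 0"
      by (simp add: null_class_def star_hom_diff[OF h] tendsto_norm_zero_iff)
    from Lim_transform[OF X this] show "Z \<in> cls a" by (simp add: cls_def)
  next
    fix Z assume "Z \<in> cls a"
    then have Z: "(\<lambda>n. h (Z n)) \<longlonglongrightarrow> a" by (simp add: cls_def)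
    from tendsto_diff[OF Z X] have "(\<lambda>n. norm (h (Z n) - h (X n))) \<longlonglongrightarrow> 0"
      by (simp add: tendsto_norm_zero_iff)
    then show "Z \<in> null_class ?p X"
      using LIMSEQ_imp_Cauchy[OF Z] by (simp add: null_class_def Cauchy star_hom_diff[OF h])
  qed
  have cls_ex: "\<exists>X. (\<lambda>n. h (X n)) \<longlonglongrightarrow> a" for a
  proof -
    have "a \<in> closure (range h)" using dense by simp
    then obtain Y where Y: "\<forall>n. Y n \<in> range h" "Y \<longlonglongrightarrow> a" by (auto simp: closure_sequential)
    from Y(1) have "\<forall>n. \<exists>x. Y n = h x" by blast
    from choice[OF this] obtain X where "\<forall>n. Y n = h (X n)" by blast
    then have "(\<lambda>n. h (X n)) = Y" by auto
    then show ?thesis using Y(2) by (intro exI[of _ X]) simp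
  qed
  have rep: "(\<lambda>n. h (class_rep (cls a) n)) \<longlonglongrightarrow> a" for a
  proof -
    have "class_rep (cls a) \<in> cls a"
      unfolding class_rep_def using cls_ex[of a] by (intro someI_ex[of "\<lambda>X. X \<in> cls a"]) (simp add: cls_def)
    then show ?thesis by (simp add: cls_def)
  qed
  have k: "k (cls a) = a" for a unfolding k_def by (rule limI[OF rep])
  have carrier: "ccarrier (completion ?p) = range cls"
  proof (intro set_eqI iffI)
    fix D assume "D \<in> ccarrier (completion ?p)"
    then obtain X where X: "Cauchy (\<lambda>n. h (X n))" "D = null_class ?p X"
      by (auto simp: completion_def Cauchy)
    from X(1) obtain a where "(\<lambda>n. h (X n)) \<longlonglongrightarrow> a" by (auto simp: Cauchy_convergent_iff convergent_def)
    from null[OF this] X(2) show "D \<in> range cls" by blast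
  next
    fix D assume "D \<in> range cls"
    then obtain a where a: "D = cls a" by blast
    obtain X where X: "(\<lambda>n. h (X n)) \<longlonglongrightarrow> a" using cls_ex by blast
    have "seminorm_Cauchy ?p X" using LIMSEQ_imp_Cauchy[OF X] by (simp add: Cauchy)
    then show "D \<in> ccarrier (completion ?p)" by (auto simp: completion_def a null[OF X, symmetric])
  qed
  have "star_isomorphism (completion ?p) k"
    unfolding star_isomorphism_def carrier
  proof (intro conjI ballI allI)
    show "bij_betw k (range cls) UNIV"
      by (rule bij_betwI[where g = cls]) (auto simp: k)
    fix x assume "x \<in> range cls"
    then obtain a where a: "x = cls a" by blast
    have "(\<lambda>n. h (c *\<^sub>C class_rep (cls a) n)) \<longlonglongrightarrow> c *\<^sub>C a" for c
      unfolding star_homD[OF h] by (rule bounded_linear.tendsto[OF bounded_linear_scaleC rep])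
    from null[OF this] show "k (cscale (completion ?p) c x) = c *\<^sub>C k x" for c
      by (simp add: completion_def a k)
    have "(\<lambda>n. h (star (class_rep (cls a) n))) \<longlonglongrightarrow> star a"
      unfolding star_homD[OF h] by (rule bounded_linear.tendsto[OF bounded_linear_star rep])
    from null[OF this] show "k (cstar (completion ?p) x) = star (k x)"
      by (simp add: completion_def a k)
    fix y assume "y \<in> range cls"
    then obtain b where b: "y = cls b" by blast
    have "(\<lambda>n. h (class_rep (cls a) n + class_rep (cls b) n)) \<longlonglongrightarrow> a + b"
      unfolding star_homD[OF h] by (rule tendsto_add[OF rep rep])
    from null[OF this] show "k (cadd (completion ?p) x y) = k x + k y"
      by (simp add: completion_def a b k)
    have "(\<lambda>n. h (class_rep (cls a) n * class_rep (cls b) n)) \<longlonglongrightarrow> a * b"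
      unfolding star_homD[OF h] by (rule tendsto_mult[OF rep rep])
    from null[OF this] show "k (cmult (completion ?p) x y) = k x * k y"
      by (simp add: completion_def a b k)
  qed
  moreover have "k (completion_map ?p x) = h x" for x
    unfolding completion_map_def using null[of "\<lambda>_. x" "h x"] k by simp
  ultimately show ?thesis by blast
qed

lemma star_hom_single_in_products:
  assumes h: "star_hom h" and letters: "\<And>l. h (single [l]) \<in> B" and w: "w \<noteq> []"
  shows "h (single w) \<in> products B"
  using w
proof (induction w rule: rev_nonempty_induct)
  case (single l)
  show ?case by (rule products.base[OF letters])
next
  case (snoc l w)
  then show ?case
    by (simp add: single_append star_homD[OF h] products.step[OF _ letters])
qed

section \<open>Identification of the universal C*-algebra\<close>

theorem theorem4p4:
  fixes I :: "'i set" and J :: "'j set"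
    and q :: "'i \<Rightarrow> 'a::cstar_algebra" and t :: "'j \<Rightarrow> 'a"
    and \<gamma> :: "complex \<Rightarrow> 'a \<Rightarrow> 'a"
    and p :: "'i \<Rightarrow> 'g" and s :: "'j \<Rightarrow> 'g"
    and \<Phi> :: "'g free_algebra \<Rightarrow> 'a"
    and N :: "'a set" and M :: "'g free_algebra set"
    and R1 R2 :: "'g norm_relation set"
  assumes projections: "\<And>i. i \<in> I \<Longrightarrow> projection (q i)"
    and partial_isometries: "\<And>j. j \<in> J \<Longrightarrow> partial_isometry (t j)"
    and generated: "cstar_generated (q ` I \<union> t ` J) = UNIV"
    and action: "circle_action \<gamma>" "strongly_continuous \<gamma>"
    and action_q: "\<And>z i. z \<in> sphere 0 1 \<Longrightarrow> i \<in> I \<Longrightarrow> \<gamma> z (q i) = q i"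
    and action_t: "\<And>z j. z \<in> sphere 0 1 \<Longrightarrow> j \<in> J \<Longrightarrow> \<gamma> z (t j) = z *\<^sub>C t j"
    and N: "N = products (q ` I \<union> t ` J \<union> star ` t ` J) \<inter> fixed_algebra \<gamma>"
    and finite_dim: "\<And>Y. finite Y \<Longrightarrow> Y \<subseteq> N \<Longrightarrow> finite_dimensional (cstar_generated Y)"
    and symbols: "inj_on p I" "inj_on s J" "p ` I \<inter> s ` J = {}" "p ` I \<union> s ` J = UNIV"
    and Phi: "star_hom \<Phi>"
    and Phi_p: "\<And>i. i \<in> I \<Longrightarrow> \<Phi> (gen (p i)) = q i"
    and Phi_s: "\<And>j. j \<in> J \<Longrightarrow> \<Phi> (gen (s j)) = t j"
    and M: "M = {x \<in> free_words. \<Phi> x \<in> N}"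
    and R1: "R1 =
      {equality_relation (gen (p i)) (star (gen (p i))) | i. i \<in> I} \<union>
      {equality_relation (star (gen (p i))) (gen (p i) * gen (p i)) | i. i \<in> I} \<union>
      {equality_relation (gen (s j) * star (gen (s j)) * gen (s j)) (gen (s j)) | j. j \<in> J}"
    and R2: "R2 =
      {equality_relation (\<Sum>x\<in>F. c x *\<^sub>C x) 0 | F c.
        finite F \<and> F \<subseteq> M \<and> \<Phi> (\<Sum>x\<in>F. c x *\<^sub>C x) = 0}"
  shows "admissible TYPE('k) TYPE(('g, 'u) hilbert_universe) (R1 \<union> R2) \<and>
    factors_to_isomorphism TYPE(('g, 'u) hilbert_universe) (R1 \<union> R2) \<Phi>"
proof -
  define T where "T = s ` J"
  have gens: "(\<exists>i\<in>I. g = p i \<and> g \<notin> T) \<or> (\<exists>j\<in>J. g = s j \<and> g \<in> T)" for g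
  proof -
    have "g \<in> p ` I \<union> s ` J" using symbols(4) by simp
    then show ?thesis using symbols(3) by (auto simp: T_def)
  qed
  have act: "star_hom (\<gamma> z)" if "z \<in> sphere 0 1" for z
    using action(1) that by (simp add: circle_action_def)
  have act_gen: "\<gamma> z (\<Phi> (gen g)) = (if g \<in> T then z *\<^sub>C \<Phi> (gen g) else \<Phi> (gen g))"
    if z: "z \<in> sphere 0 1" for z g
    using gens[of g] action_q[OF z] action_t[OF z] by (auto simp: Phi_p Phi_s)
  interpret graded_star_hom \<Phi> \<gamma> T
    by unfold_locales (fact Phi act act_gen)+
  let ?B = "q ` I \<union> t ` J \<union> star ` t ` J"
  \<comment> \<open>The starred symbol of a projection is sent to \<open>q i\<close> again, by
    self-adjointness.\<close>
  have letters: "\<Phi> (single [l]) \<in> ?B" for l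
  proof (cases l)
    case (Plain g)
    then show ?thesis using gens[of g] by (auto simp: single_Plain Phi_p Phi_s)
  next
    case (Starred g)
    then show ?thesis using gens[of g] projections
      by (auto simp: single_Starred star_homD[OF Phi] Phi_p Phi_s projection_def)
  qed
  \<comment> \<open>On a word of degree 0 the action is multiplication by \<open>z powi 0\<close>,
    so its image is fixed.\<close>
  have single_N: "\<Phi> (single w) \<in> N" if "w \<noteq> []" "word_degree T w = 0" for w
    using star_hom_single_in_products[OF Phi letters that(1)] action_single[OF _ that(1)] that(2)
    by (simp add: N fixed_algebra_def scaleC_one)
  have fd: "finite_dimensional (cstar_generated ((\<lambda>w. \<Phi> (single w)) ` W))"
    if "finite W" "\<And>w. w \<in> W \<Longrightarrow> w \<noteq> [] \<and> word_degree T w = 0" for W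
    using that single_N by (intro finite_dim) auto
  let ?R = "R1 \<union> R2"
  have relations: "\<eta> = 0 \<and> \<Phi> x = 0" if "(x, \<eta>) \<in> ?R" for x \<eta>
  proof -
    note hom = star_homD[OF Phi] star_hom_diff[OF Phi] star_hom_0[OF Phi]
    have "\<eta> = 0 \<and> \<Phi> x = 0" if "(x, \<eta>) \<in> R1"
      using that projections partial_isometries unfolding R1
      by (auto simp: equality_relation_def hom Phi_p Phi_s projection_def partial_isometry_def)
    moreover have "\<eta> = 0 \<and> \<Phi> x = 0" if "(x, \<eta>) \<in> R2"
      using that unfolding R2 by (auto simp: equality_relation_def)
    ultimately show ?thesis using that by blast
  qed
  have degree_0_relation: "(z, 0) \<in> R2" if z: "homogeneous T 0 z" "\<Phi> z = 0" for z
  proof -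
    have ne: "w \<noteq> []" if "w \<in> support z" for w using that by auto
    have inj: "inj_on single (support z)" using ne single_inj by (blast intro: inj_onI)
    \<comment> \<open>\<open>R2\<close> indexes sums by elements of the free algebra instead of
      words, so coefficients are transported along the inverse of \<open>single\<close>, which is
      injective on nonempty words.\<close>
    define c where "c x = coeff z (the_inv_into (support z) single x)" for x
    have "z = (\<Sum>w\<in>support z. coeff z w *\<^sub>C single w)" by (rule free_algebra_expansion)
    also have "\<dots> = (\<Sum>x\<in>single ` support z. c x *\<^sub>C x)"
      by (simp add: sum.reindex[OF inj] c_def the_inv_into_f_f[OF inj])
    finally have eq: "z = (\<Sum>x\<in>single ` support z. c x *\<^sub>C x)" .
    have "single ` support z \<subseteq> M"
      using z(1) ne single_N single_in_free_words by (auto simp: M homogeneous_def)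
    moreover have "(z, 0) = equality_relation (\<Sum>x\<in>single ` support z. c x *\<^sub>C x) 0"
      by (simp add: equality_relation_def eq[symmetric])
    moreover have "\<Phi> (\<Sum>x\<in>single ` support z. c x *\<^sub>C x) = 0"
      using z(2) by (simp add: eq[symmetric])
    ultimately show ?thesis unfolding R2 using finite_support[of z] by blast
  qed
  have upper: "operator_norm H (\<rho> x) \<le> norm (\<Phi> x)"
    if rep: "representation ?R H \<rho>" for H :: "('g, 'u) hilbert_universe hilbert" and \<rho> x
  proof -
    interpret hilbert_space H using rep by (simp add: representation_def)
    have \<rho>: "star_hom_into_operators H \<rho>" using rep by (simp add: representation_def)
    note sn = representation_seminorm[OF \<rho>]
    show ?thesis
    proof (rule seminorm_le_norm[of "\<lambda>x. operator_norm H (\<rho> x)"])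
      show "seminorm (\<lambda>x. operator_norm H (\<rho> x))" by (rule sn(1))
      show "(operator_norm H (\<rho> x))\<^sup>2 \<le> operator_norm H (\<rho> (star x * x))" for x by (rule sn(2))
      fix z assume "homogeneous T 0 z" "\<Phi> z = 0"
      then have "(z, 0) \<in> ?R" using degree_0_relation by blast
      then have "operator_norm H (\<rho> z) \<le> 0" using rep by (auto simp: representation_def)
      then show "operator_norm H (\<rho> z) = 0" using seminormD(1)[OF sn(1), of z] by simp
    qed (rule fd)
  qed
  have "admissible TYPE('k) TYPE(('g, 'u) hilbert_universe) ?R"
    unfolding admissible_def
  proof (intro allI impI)
    fix K :: "'k set" and H :: "'k \<Rightarrow> ('g, 'u) hilbert_universe hilbert" and \<rho>
    assume rep: "\<forall>\<alpha>\<in>K. representation ?R (H \<alpha>) (\<rho> \<alpha>)"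
    interpret hilbert_family K H
      by (rule hilbert_family.intro) (use rep in \<open>simp add: representation_def\<close>)
    have \<rho>: "\<And>\<alpha>. \<alpha> \<in> K \<Longrightarrow> star_hom_into_operators (H \<alpha>) (\<rho> \<alpha>)"
      using rep by (simp add: representation_def)
    \<comment> \<open>The bound does not depend on the index, and it is 0 for every \<open>x\<close>
      that occurs in a relation. So it yields both boundedness of the direct sum and the relations
      for it.\<close>
    have up: "\<And>\<alpha> x. \<alpha> \<in> K \<Longrightarrow> operator_norm (H \<alpha>) (\<rho> \<alpha> x) \<le> norm (\<Phi> x)"
      using rep upper by blast
    show "representation ?R (hilbert_sum K H) (direct_sum K \<rho>)"
      unfolding representation_def
    proof (intro conjI)
      show "hilbert_space (hilbert_sum K H)" by (rule hilbert_space_sum)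
      show "star_hom_into_operators (hilbert_sum K H) (direct_sum K \<rho>)"
        by (rule star_hom_into_operators_direct_sum[OF \<rho> up norm_ge_zero])
      show "\<forall>(x, \<eta>)\<in>?R. operator_norm (hilbert_sum K H) (direct_sum K \<rho> x) \<le> \<eta>"
      proof clarify
        fix x \<eta> assume "(x, \<eta>) \<in> ?R"
        then have "\<eta> = 0" "\<Phi> x = 0" using relations by blast+
        then show "operator_norm (hilbert_sum K H) (direct_sum K \<rho> x) \<le> \<eta>"
          using direct_sum_bound(2)[where x = x and b = "norm (\<Phi> x)", OF \<rho> up norm_ge_zero]
          by (intro hilbert_space.operator_norm_le[OF hilbert_space_sum]) simp_all
      qed
    qed
  qed
  moreover have "universal_seminorm TYPE(('g, 'u) hilbert_universe) ?R = (\<lambda>x. norm (\<Phi> x))"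
  proof
    fix x
    \<comment> \<open>For each \<open>x\<close> some representation attains the upper bound, so the
      supremum is a maximum.\<close>
    have "\<exists>(H :: ('g, 'u) hilbert_universe hilbert) \<rho>. hilbert_space H \<and> star_hom_into_operators H \<rho> \<and>
        (\<forall>y. operator_norm H (\<rho> y) \<le> norm (\<Phi> y)) \<and> norm (\<Phi> x) \<le> operator_norm H (\<rho> x)"
      by (rule norming_representation[OF Phi, of x]) blast
    then obtain H :: "('g, 'u) hilbert_universe hilbert" and \<rho> where
      H: "hilbert_space H" "star_hom_into_operators H \<rho>" and
      le: "\<And>y. operator_norm H (\<rho> y) \<le> norm (\<Phi> y)" "norm (\<Phi> x) \<le> operator_norm H (\<rho> x)"
      by blast
    have "operator_norm H (\<rho> y) \<le> \<eta>" if "(y, \<eta>) \<in> ?R" for y \<eta>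
      using relations[OF that] le(1)[of y] by simp
    with H have "representation ?R H \<rho>" by (auto simp: representation_def)
    moreover have "operator_norm H (\<rho> x) = norm (\<Phi> x)" using le by (simp add: antisym)
    ultimately show "universal_seminorm TYPE(('g, 'u) hilbert_universe) ?R x = norm (\<Phi> x)"
      unfolding universal_seminorm_def using upper[of _ _ x] by (intro cSup_eq_maximum) (force, blast)
  qed
  moreover have "closure (range \<Phi>) = UNIV"
  proof -
    have "q ` I \<union> t ` J \<subseteq> range \<Phi>"
    proof (intro Un_least image_subsetI)
      show "q i \<in> range \<Phi>" if "i \<in> I" for i
        by (rule range_eqI[of _ _ "gen (p i)"]) (simp add: Phi_p that)
      show "t j \<in> range \<Phi>" if "j \<in> J" for j
        by (rule range_eqI[of _ _ "gen (s j)"]) (simp add: Phi_s that)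
    qed
    then have "q ` I \<union> t ` J \<subseteq> closure (range \<Phi>)" using closure_subset by (rule order_trans)
    then have "cstar_generated (q ` I \<union> t ` J) \<subseteq> closure (range \<Phi>)"
      unfolding cstar_generated_def by (rule hull_minimal) (rule cstar_subalgebra_closure_range[OF Phi])
    then show ?thesis using generated by blast
  qed
  ultimately show ?thesis
    using completion_isomorphism[OF Phi]
    by (simp add: factors_to_isomorphism_def universal_cstar_def universal_map_def)
qed

end
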